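(* Any maximal submodule of $M(\eta)$ is one of: (a) $W(\eta;\kappa,c)$ with $(\kappa,c)$ non-critical; (b) $\widehat W_-(\eta;\kappa,c)$ with $(\kappa,c)$ critical.
   Context: Let $q\in\mathbb{C}$ be nonzero and not a root of unity, and $U=U_q(\mathfrak{sl}_3)$ the algebra generated by $E_1,E_2,F_1,F_2,K_1^{\pm1},K_2^{\pm1}$ with the Jimbo relations. Put $F_3=F_1F_2-qF_2F_1$, $K=K_1K_2^2$, $C_1=F_1E_1+\frac{qK_1+q^{-1}K_1^{-1}}{(q-q^{-1})^2}$. Let $U^+$ be the subalgebra generated by $E_1,E_2$, $\eta:U^+\to\mathbb{C}$ the algebra homomorphism with $\eta(E_1)=\alpha\neq0$, $\eta(E_2)=0$, and $M(\eta)=U\otimes_{U^+}\mathbb{C}v_\eta$ with $xv_\eta=\eta(x)v_\eta$. Write $[k]=\frac{q^k-q^{-k}}{q-q^{-1}}$, $[k]!=[k]\cdots[1]$, $[0]!=1$, $\genfrac{[}{]}{0pt}{}{n}{k}=\frac{[n]!}{[k]![n-k]!}$ for $0\le k\le n$ (0 otherwise). For $n\in\mathbb{Z}_+$, $l\in\mathbb{Z}$, $Q\in\mathbb{C}[K^{\pm1},C_1]$, $u(n,l,Q)=q^{2nl}K_2^l\sum_{k=0}^{n}\sum_{j=0}^{n-k}a_{kj}(n)F_2^{n-k}F_3^kK_2^{2j}K^{-2j-k}Qv_\eta$ with $a_{kj}(n)=(-1)^j\alpha^k(q^2-1)^kq^{j(n-3)}q^{\frac{1}{2}k(2n+2j+k-7)}\genfrac{[}{]}{0pt}{}{n}{k}\genfrac{[}{]}{0pt}{}{n-k}{j}$.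 For $n\in\mathbb{N}$, $h_n(K,C_1)=q^{3-2n}K+q^{2n-3}K^{-1}-(q-q^{-1})^2C_1$; $(\kappa,c)\in\mathbb{C}^2$, $\kappa\ne0$, is critical if $h_n(\kappa,c)=0$ for some $n\in\mathbb{N}$ and non-critical otherwise; for critical $(\kappa,c)$, $n_-$ denotes the smallest such $n$. $J(\kappa,c)$ is the ideal of $\mathbb{C}[K^{\pm1},C_1]$ generated by $K-\kappa$, $C_1-c$; $W(\eta;\kappa,c)=UJ(\kappa,c)v_\eta$; $\widehat W_-(\eta;\kappa,c)=Uu(n_-,0,1)+W(\eta;\kappa,c)$. *)

theory Defs
  imports Complex_Main
begin

text \<open>
  Encoding. U_q(sl_3) is presented as the free associative complex algebra on the
  generators below, modulo the two-sided ideal generated by the Jimbo relations.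
  Elements of the free algebra are complex-valued functions on words (lists of
  generators) with finite support; multiplication is concatenation-convolution.
  M(eta) = U / U ker(eta) = F / (Rel + F(E1 - alpha) + F E2).  A U-submodule of
  M(eta) is identified with its preimage in F, i.e. a left ideal of F containing
  that kernel; quotient images are submodules U J v_eta etc.
\<close>

datatype gen = GE1 | GE2 | GF1 | GF2 | GK1 | GK1i | GK2 | GK2i

type_synonym falg = "gen list \<Rightarrow> complex"

definition FA :: "falg set" where
  "FA = {f. finite {w. f w \<noteq> 0}}"

definition fzero :: falg where "fzero = (\<lambda>w. 0)"
definition fadd :: "falg \<Rightarrow> falg \<Rightarrow> falg" where "fadd f g = (\<lambda>w. f w + g w)"
definition fsub :: "falg \<Rightarrow> falg \<Rightarrow> falg" where "fsub f g = (\<lambda>w. f w - g w)"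
definition fsc :: "complex \<Rightarrow> falg \<Rightarrow> falg" where "fsc c f = (\<lambda>w. c * f w)"
definition fsum :: "('i \<Rightarrow> falg) \<Rightarrow> 'i set \<Rightarrow> falg" where
  "fsum f A = (\<lambda>w. \<Sum>i\<in>A. f i w)"
definition fmul :: "falg \<Rightarrow> falg \<Rightarrow> falg" (infixl "\<odot>" 70) where
  "fmul f g = (\<lambda>w. \<Sum>i\<le>length w. f (take i w) * g (drop i w))"
definition fone :: falg where "fone = (\<lambda>w. if w = [] then 1 else 0)"
definition fgen :: "gen \<Rightarrow> falg" where "fgen x = (\<lambda>w. if w = [x] then 1 else 0)"
definition fconst :: "complex \<Rightarrow> falg" where "fconst c = fsc c fone"

primrec fpow :: "falg \<Rightarrow> nat \<Rightarrow> falg" where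
  "fpow f 0 = fone"
| "fpow f (Suc n) = f \<odot> fpow f n"

definition E :: "nat \<Rightarrow> falg" where "E i = (if i = 1 then fgen GE1 else fgen GE2)"
definition F :: "nat \<Rightarrow> falg" where "F i = (if i = 1 then fgen GF1 else fgen GF2)"
definition Kg :: "nat \<Rightarrow> falg" where "Kg i = (if i = 1 then fgen GK1 else fgen GK2)"
definition Kgi :: "nat \<Rightarrow> falg" where "Kgi i = (if i = 1 then fgen GK1i else fgen GK2i)"

definition cartan :: "nat \<Rightarrow> nat \<Rightarrow> int" where
  "cartan i j = (if i = j then 2 else -1)"

definition jimbo_rels :: "complex \<Rightarrow> falg set" where
  "jimbo_rels q =
     {fsub (Kg 1 \<odot> Kg 2) (Kg 2 \<odot> Kg 1)}
   \<union> (\<Union>i\<in>{1,2}. {fsub (Kg i \<odot> Kgi i) fone, fsub (Kgi i \<odot> Kg i) fone})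
   \<union> (\<Union>i\<in>{1,2}. \<Union>j\<in>{1,2}.
        {fsub (Kg i \<odot> E j \<odot> Kgi i) (fsc (q powi cartan i j) (E j)),
         fsub (Kg i \<odot> F j \<odot> Kgi i) (fsc (q powi (- cartan i j)) (F j)),
         fsub (fsub (E i \<odot> F j) (F j \<odot> E i))
              (if i = j then fsc (1 / (q - inverse q)) (fsub (Kg i) (Kgi i)) else fzero)})
   \<union> (\<Union>i\<in>{1,2}. \<Union>j\<in>{1,2}. if i = j then {} else
        {fadd (fsub (E i \<odot> E i \<odot> E j) (fsc (q + inverse q) (E i \<odot> E j \<odot> E i))) (E j \<odot> E i \<odot> E i),
         fadd (fsub (F i \<odot> F i \<odot> F j) (fsc (q + inverse q) (F i \<odot> F j \<odot> F i))) (F j \<odot> F i \<odot> F i)})"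

inductive_set tideal :: "falg set \<Rightarrow> falg set" for S where
  gen: "s \<in> S \<Longrightarrow> s \<in> tideal S"
| zero: "fzero \<in> tideal S"
| add: "a \<in> tideal S \<Longrightarrow> b \<in> tideal S \<Longrightarrow> fadd a b \<in> tideal S"
| mult: "a \<in> tideal S \<Longrightarrow> x \<in> FA \<Longrightarrow> y \<in> FA \<Longrightarrow> x \<odot> a \<odot> y \<in> tideal S"

inductive_set lideal :: "falg set \<Rightarrow> falg set" for S where
  gen: "s \<in> S \<Longrightarrow> s \<in> lideal S"
| zero: "fzero \<in> lideal S"
| add: "a \<in> lideal S \<Longrightarrow> b \<in> lideal S \<Longrightarrow> fadd a b \<in> lideal S"
| mult: "a \<in> lideal S \<Longrightarrow> x \<in> FA \<Longrightarrow> x \<odot> a \<in> lideal S"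

text \<open>Preimage in F of 0 in M(eta): Rel + F(E1 - alpha) + F E2.\<close>
definition Mker :: "complex \<Rightarrow> complex \<Rightarrow> falg set" where
  "Mker q \<alpha> = lideal (tideal (jimbo_rels q) \<union> {fsub (E 1) (fconst \<alpha>), E 2})"

text \<open>Submodules of M(eta), via their preimages in F.\<close>
definition is_submodule :: "complex \<Rightarrow> complex \<Rightarrow> falg set \<Rightarrow> bool" where
  "is_submodule q \<alpha> N \<longleftrightarrow> N \<subseteq> FA \<and> Mker q \<alpha> \<subseteq> N \<and> fzero \<in> N
     \<and> (\<forall>a\<in>N. \<forall>b\<in>N. fadd a b \<in> N) \<and> (\<forall>a\<in>N. \<forall>x\<in>FA. x \<odot> a \<in> N)"

definition maximal_submodule :: "complex \<Rightarrow> complex \<Rightarrow> falg set \<Rightarrow> bool" where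
  "maximal_submodule q \<alpha> N \<longleftrightarrow> is_submodule q \<alpha> N \<and> N \<noteq> FA \<and>
     (\<forall>N'. is_submodule q \<alpha> N' \<and> N \<subseteq> N' \<and> N' \<noteq> FA \<longrightarrow> N' = N)"

definition F3 :: "complex \<Rightarrow> falg" where "F3 q = fsub (F 1 \<odot> F 2) (fsc q (F 2 \<odot> F 1))"
definition Kel :: falg where "Kel = Kg 1 \<odot> Kg 2 \<odot> Kg 2"
definition Keli :: falg where "Keli = Kgi 2 \<odot> Kgi 2 \<odot> Kgi 1"
definition C1 :: "complex \<Rightarrow> falg" where
  "C1 q = fadd (F 1 \<odot> E 1)
     (fsc (1 / (q - inverse q)^2) (fadd (fsc q (Kg 1)) (fsc (inverse q) (Kgi 1))))"

definition qint :: "complex \<Rightarrow> nat \<Rightarrow> complex" where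
  "qint q k = (q ^ k - inverse q ^ k) / (q - inverse q)"
definition qfact :: "complex \<Rightarrow> nat \<Rightarrow> complex" where
  "qfact q n = (\<Prod>i\<in>{1..n}. qint q i)"
definition qbinom :: "complex \<Rightarrow> nat \<Rightarrow> nat \<Rightarrow> complex" where
  "qbinom q n k = (if k \<le> n then qfact q n / (qfact q k * qfact q (n - k)) else 0)"

text \<open>Coefficients a_kj(n); the exponent k(2n+2j+k-7) is always even.\<close>
definition acoef :: "complex \<Rightarrow> complex \<Rightarrow> nat \<Rightarrow> nat \<Rightarrow> nat \<Rightarrow> complex" where
  "acoef q \<alpha> n k j = (-1) ^ j * \<alpha> ^ k * (q^2 - 1) ^ k * q powi (int j * (int n - 3))
     * q powi ((int k * (2 * int n + 2 * int j + int k - 7)) div 2)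
     * qbinom q n k * qbinom q (n - k) j"

text \<open>The element of U with u(n,0,1) = uel n * v_eta (l = 0, Q = 1).\<close>
definition uel :: "complex \<Rightarrow> complex \<Rightarrow> nat \<Rightarrow> falg" where
  "uel q \<alpha> n = fsum (\<lambda>k. fsum (\<lambda>j. fsc (acoef q \<alpha> n k j)
       (fpow (F 2) (n - k) \<odot> fpow (F3 q) k \<odot> fpow (Kg 2) (2 * j) \<odot> fpow Keli (2 * j + k)))
       {0..n - k}) {0..n}"

definition hfun :: "complex \<Rightarrow> nat \<Rightarrow> complex \<Rightarrow> complex \<Rightarrow> complex" where
  "hfun q n \<kappa> c = q powi (3 - 2 * int n) * \<kappa> + q powi (2 * int n - 3) * inverse \<kappa>
     - (q - inverse q)^2 * c"

definition critical :: "complex \<Rightarrow> complex \<Rightarrow> complex \<Rightarrow> bool" where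
  "critical q \<kappa> c \<longleftrightarrow> \<kappa> \<noteq> 0 \<and> (\<exists>n\<ge>1. hfun q n \<kappa> c = 0)"
definition noncritical :: "complex \<Rightarrow> complex \<Rightarrow> complex \<Rightarrow> bool" where
  "noncritical q \<kappa> c \<longleftrightarrow> \<kappa> \<noteq> 0 \<and> \<not> (\<exists>n\<ge>1. hfun q n \<kappa> c = 0)"
definition nminus :: "complex \<Rightarrow> complex \<Rightarrow> complex \<Rightarrow> nat" where
  "nminus q \<kappa> c = (LEAST n. n \<ge> 1 \<and> hfun q n \<kappa> c = 0)"

text \<open>Preimages in F of W(eta;kappa,c) = U J v_eta and of hat W_-(eta;kappa,c).\<close>
definition Wsub :: "complex \<Rightarrow> complex \<Rightarrow> complex \<Rightarrow> complex \<Rightarrow> falg set" where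
  "Wsub q \<alpha> \<kappa> c = lideal (Mker q \<alpha> \<union> {fsub Kel (fconst \<kappa>), fsub (C1 q) (fconst c)})"
definition Whatm :: "complex \<Rightarrow> complex \<Rightarrow> complex \<Rightarrow> complex \<Rightarrow> falg set" where
  "Whatm q \<alpha> \<kappa> c = lideal (Wsub q \<alpha> \<kappa> c \<union> {uel q \<alpha> (nminus q \<kappa> c)})"

end

theory Submission
  imports Defs "HOL-Library.Function_Algebras" "HOL-Computational_Algebra.Fundamental_Theorem_Algebra"
begin

text \<open>
  On the vectors \<open>x\<close> with \<open>E\<^sub>1 x = \<alpha> x\<close> consider
  \<open>T = F\<^sub>2 + q^(-2) (\<alpha> (q^2 - 1) F\<^sub>3 K^(-1) - F\<^sub>2 K\<^sub>2^2 K^(-2))\<close>. It preserves this eigenspace, and its three summands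
  commute up to powers of \<open>q^2\<close>, so that the multinomial theorem gives \<open>u(n,0,1) = T^n v\<close>. If \<open>a\<close> is a
  Whittaker vector, then \<open>E\<^sub>2 T^n a\<close> is a nonzero multiple of \<open>K\<^sub>2 K^(-1) T^(n-1) h\<^sub>n(K, C\<^sub>1) a\<close>, while
  \<open>E\<^sub>1 E\<^sub>2 - q E\<^sub>2 E\<^sub>1\<close> kills \<open>T^n a\<close> and differentiates in \<open>F\<^sub>2\<close>. Hence all Whittaker vectors of the module
  generated by \<open>v\<close> have the form \<open>\<Sum>T^n Q\<^sub>n v\<close>.

  In a simple quotient some Whittaker vector is an eigenvector of \<open>K\<close>. Otherwise there is a Whittaker vector \<open>w\<close>
  such that each \<open>h\<^sub>m\<close> is injective, or else \<open>T^m\<close> is zero, on the \<open>(K, C\<^sub>1)\<close>-orbit of \<open>w\<close>: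
  if \<open>h\<^sub>n w = 0\<close>, then \<open>w\<close> or the reflected vector \<open>T^n w\<close> will do. Expanding \<open>w\<close> in terms of \<open>(K - \<lambda>) w\<close>, the
  terms with \<open>n > 0\<close> then vanish, so \<open>w\<close> is a multiple of \<open>(K - \<lambda>) w\<close> for every \<open>\<lambda>\<close>, which is impossible for
  polynomials in two variables. Comparing weights of \<open>K\<close>, one finds that \<open>v\<close> itself is a joint eigenvector of
  \<open>K\<close> and \<open>C\<^sub>1\<close>, and that \<open>T^n v = 0\<close> as soon as \<open>h\<^sub>n(\<kappa>, c) = 0\<close>. Conversely, for a joint eigenvector \<open>v\<close> with
  this vanishing property the two lowering operators lead from any nonzero vector back to \<open>v\<close>.
\<close>

section \<open>Linear operators on functions on words\<close>

lemma fsc_apply: "fsc c x w = c * x w"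
  by (simp add: fsc_def)

text \<open>Out of the simp set, so that operator terms reach a normal form before they are evaluated at a word;
  the remaining identity between complex numbers is then left to \<open>algebra\<close>.\<close>
declare plus_fun_apply [simp del] zero_fun_apply [simp del] minus_apply [simp del] uminus_apply [simp del]

lemmas pointwise = fsc_apply plus_fun_apply zero_fun_apply minus_apply uminus_apply

lemma sum_apply: "(\<Sum>i\<in>A. f i) w = (\<Sum>i\<in>A. f i w)" for f :: "'i \<Rightarrow> 'a \<Rightarrow> complex"
  by (induction A rule: infinite_finite_induct) (auto simp: pointwise)

interpretation fv: vector_space fsc
  by unfold_locales (auto simp: fun_eq_iff pointwise algebra_simps)

definition lin :: "(falg \<Rightarrow> falg) \<Rightarrow> bool" where
  "lin f \<longleftrightarrow> (\<forall>x y. f (x + y) = f x + f y) \<and> (\<forall>c x. f (fsc c x) = fsc c (f x))"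

lemma lin_add: "lin f \<Longrightarrow> f (x + y) = f x + f y"
  and lin_sc: "lin f \<Longrightarrow> f (fsc c x) = fsc c (f x)"
  by (auto simp: lin_def)

lemma lin_zero: assumes "lin f" shows "f 0 = 0"
  using lin_sc[OF assms, of 0 0] by simp

lemma lin_neg: assumes "lin f" shows "f (- x) = - f x"
  using lin_sc[OF assms, of "-1" x] by simp

lemma lin_diff: assumes "lin f" shows "f (x - y) = f x - f y"
  using lin_add[OF assms, of x "- y"] lin_neg[OF assms] by simp

lemma lin_sum: assumes "lin f" shows "f (\<Sum>i\<in>A. g i) = (\<Sum>i\<in>A. f (g i))"
  by (induction A rule: infinite_finite_induct) (auto simp: lin_zero[OF assms] lin_add[OF assms])

lemma lin_comp: "lin f \<Longrightarrow> lin g \<Longrightarrow> lin (\<lambda>x. f (g x))"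
  by (simp add: lin_def)

lemma lin_funpow: "lin f \<Longrightarrow> lin (f ^^ n)"
  by (induction n) (auto simp: lin_def)

section \<open>Modules over the quantum group\<close>

locale jimbo_module =
  fixes q :: complex and E1 E2 F1 F2 K1 K1i K2 K2i :: "falg \<Rightarrow> falg"
  assumes q_nz: "q \<noteq> 0" and q_root: "\<And>m::nat. m > 0 \<Longrightarrow> q ^ m \<noteq> 1"
    and lin0: "lin E1" "lin E2" "lin F1" "lin F2" "lin K1" "lin K1i" "lin K2" "lin K2i"
    and K1K2: "K1 (K2 x) = K2 (K1 x)"
    and K1K1i: "K1 (K1i x) = x" "K1i (K1 x) = x" and K2K2i: "K2 (K2i x) = x" "K2i (K2 x) = x"
    and K1E1': "K1 (E1 (K1i x)) = fsc (q^2) (E1 x)" and K1E2': "K1 (E2 (K1i x)) = fsc (inverse q) (E2 x)"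
    and K2E1': "K2 (E1 (K2i x)) = fsc (inverse q) (E1 x)" and K2E2': "K2 (E2 (K2i x)) = fsc (q^2) (E2 x)"
    and K1F1': "K1 (F1 (K1i x)) = fsc (inverse q ^ 2) (F1 x)" and K1F2': "K1 (F2 (K1i x)) = fsc q (F2 x)"
    and K2F1': "K2 (F1 (K2i x)) = fsc q (F1 x)" and K2F2': "K2 (F2 (K2i x)) = fsc (inverse q ^ 2) (F2 x)"
    and E1F1': "E1 (F1 x) = F1 (E1 x) + fsc (q * inverse (q^2-1)) (K1 x - K1i x)"
    and E2F2': "E2 (F2 x) = F2 (E2 x) + fsc (q * inverse (q^2-1)) (K2 x - K2i x)"
    and E1F2: "E1 (F2 x) = F2 (E1 x)" and E2F1: "E2 (F1 x) = F1 (E2 x)"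
    and serreF1: "F1 (F1 (F2 x)) - fsc (q + inverse q) (F1 (F2 (F1 x))) + F2 (F1 (F1 x)) = 0"
    and serreF2: "F2 (F2 (F1 x)) - fsc (q + inverse q) (F2 (F1 (F2 x))) + F1 (F2 (F2 x)) = 0"
begin

text \<open>With these names the scalars below become polynomials in \<open>q\<close>,
  \<open>qi\<close> and \<open>ps\<close>, subject to \<open>q * qi = 1\<close> and
  \<open>ps * (q^2-1) = 1\<close>. Identities between them are then ideal membership questions,
  which \<open>algebra\<close> decides.\<close>

definition "qi = inverse q"
definition "ps = inverse (q^2-1)"

lemma q2: "q\<^sup>2 - 1 \<noteq> 0" "q\<^sup>2 \<noteq> 1"
  using q_root[of 2] by auto

lemma qi: "q * qi = 1" "qi * q = 1" "qi \<noteq> 0" "ps * (q^2 - 1) = 1" "ps \<noteq> 0"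
  using q_nz q2 by (auto simp: qi_def ps_def)

text \<open>\<open>Ki\<close>, \<open>G\<close> and \<open>Cas\<close> (below) are the operators of \<open>K\<close> inverse, \<open>F3\<close> and \<open>C1\<close>;
  the latter two names are taken by elements of the free algebra.\<close>

definition "K x = K1 (K2 (K2 x))"
definition "Ki x = K2i (K2i (K1i x))"
definition "G x = F1 (F2 x) - fsc q (F2 (F1 x))"

lemma lin_ops: "lin E1" "lin E2" "lin F1" "lin F2" "lin K1" "lin K1i" "lin K2" "lin K2i"
  "lin K" "lin Ki" "lin G"
proof -
  note l = lin0[THEN lin_add] lin0[THEN lin_sc]
  show "lin K" "lin Ki" by (auto simp: lin_def K_def Ki_def l)
  show "lin G" unfolding lin_def by (auto simp: G_def l) (simp_all add: fun_eq_iff pointwise algebra_simps)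
qed (use lin0 in auto)

lemmas gen_lin = lin_ops[THEN lin_add] lin_ops[THEN lin_sc] lin_ops[THEN lin_zero]
  lin_ops[THEN lin_neg] lin_ops[THEN lin_diff]

lemma KKi: "K (Ki x) = x" "Ki (K x) = x"
  by (simp_all add: K_def Ki_def K1K1i K2K2i)

lemma K1iK2: "K1i (K2 x) = K2 (K1i x)"
  by (metis K1K1i K1K2)
lemma K1K2i: "K1 (K2i x) = K2i (K1 x)"
  by (metis K2K2i K1K2)
lemma K1iK2i: "K1i (K2i x) = K2i (K1i x)"
  by (metis K1K1i K1K2i)

lemma K1_eq: "K1 x = K2i (K2i (K x))" and K1i_eq: "K1i x = K2 (K2 (Ki x))"
  by (simp_all add: K_def Ki_def K1K1i K2K2i K1K2 K1iK2)

lemma KK2: "K (K2 x) = K2 (K x)" "K (K2i x) = K2i (K x)" "Ki (K2 x) = K2 (Ki x)" "Ki (K2i x) = K2i (Ki x)"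
  by (simp_all add: K_def Ki_def K1K1i K2K2i K1K2 K1iK2 K1iK2i K1K2i)

text \<open>Conjugation by the invertible \<open>A\<close> scales \<open>X\<close>; substituting
  \<open>A x\<close> for \<open>x\<close> and applying \<open>B\<close> yields the four ways of
  moving \<open>A\<close> or \<open>B\<close> past \<open>X\<close>.\<close>

lemma flip1:
  assumes "lin B" "\<And>x. A (B x) = x" "\<And>x. B (A x) = x"
    "\<And>x. A (X (B x)) = fsc c (X x)" "c * d = 1"
  shows "A (X x) = fsc c (X (A x))" "B (X x) = fsc d (X (B x))"
    "X (A x) = fsc d (A (X x))" "X (B x) = fsc c (B (X x))"
proof -
  note AB = assms(2) and BA = assms(3) and lB = lin_sc[OF assms(1)]
  have dc: "d * c = 1" using assms(5) by (simp add: mult.commute)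
  show 1: "A (X x) = fsc c (X (A x))" for x
    using assms(4)[of "A x"] by (simp only: BA)
  have 2: "X (B x) = fsc c (B (X x))" for x
    using arg_cong[OF 1[of "B x"], of B] by (simp only: AB BA lB)
  show "X (A x) = fsc d (A (X x))" "B (X x) = fsc d (X (B x))" "X (B x) = fsc c (B (X x))"
    using dc by (simp_all add: 1 2)
qed

lemma qi2: "q ^ n * qi ^ n = 1" "qi ^ n * q ^ n = 1"
  using qi by (simp_all flip: power_mult_distrib)

lemmas K2E1 = flip1[where A=K2 and B=K2i and X=E1, OF lin_ops(8) K2K2i K2E1'[folded qi_def] qi(2)]
lemmas K2E2 = flip1[where A=K2 and B=K2i and X=E2, OF lin_ops(8) K2K2i K2E2' qi2(1)]
lemmas K2F1 = flip1[where A=K2 and B=K2i and X=F1, OF lin_ops(8) K2K2i K2F1' qi(1)]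
lemmas K2F2 = flip1[where A=K2 and B=K2i and X=F2, OF lin_ops(8) K2K2i K2F2'[folded qi_def] qi2(2)]
lemmas K1E1 = flip1[where A=K1 and B=K1i and X=E1, OF lin_ops(6) K1K1i K1E1' qi2(1)]
lemmas K1E2 = flip1[where A=K1 and B=K1i and X=E2, OF lin_ops(6) K1K1i K1E2'[folded qi_def] qi(2)]
lemmas K1F1 = flip1[where A=K1 and B=K1i and X=F1, OF lin_ops(6) K1K1i K1F1'[folded qi_def] qi2(2)]
lemmas K1F2 = flip1[where A=K1 and B=K1i and X=F2, OF lin_ops(6) K1K1i K1F2' qi(1)]

lemma qi_cancel: "q * (qi * c) = c" "qi * (q * c) = c"
  using qi by (simp_all flip: mult.assoc)

lemma EK: "E1 (K2 x) = fsc q (K2 (E1 x))" "E1 (K2i x) = fsc qi (K2i (E1 x))"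
  "E2 (K2 x) = fsc (qi^2) (K2 (E2 x))" "E2 (K2i x) = fsc (q^2) (K2i (E2 x))"
  "E1 (K x) = K (E1 x)" "E1 (Ki x) = Ki (E1 x)"
  "E2 (K x) = fsc (qi^3) (K (E2 x))" "E2 (Ki x) = fsc (q^3) (Ki (E2 x))"
  by (simp_all add: K2E1(3,4) K2E2(3,4) K1E1(3,4) K1E2(3,4) K_def Ki_def gen_lin mult.assoc qi_cancel qi eval_nat_numeral)

lemma KF: "K2 (F1 x) = fsc q (F1 (K2 x))" "K2i (F1 x) = fsc qi (F1 (K2i x))"
  "K2 (F2 x) = fsc (qi^2) (F2 (K2 x))" "K2i (F2 x) = fsc (q^2) (F2 (K2i x))"
  "K (F1 x) = F1 (K x)" "Ki (F1 x) = F1 (Ki x)"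
  "K (F2 x) = fsc (qi^3) (F2 (K x))" "Ki (F2 x) = fsc (q^3) (F2 (Ki x))"
  by (simp_all add: K2F1(1,2) K2F2(1,2) K1F1(1,2) K1F2(1,2) K_def Ki_def gen_lin mult.assoc qi_cancel qi eval_nat_numeral)

lemma KG: "K2 (G x) = fsc qi (G (K2 x))" "K2i (G x) = fsc q (G (K2i x))"
  "K (G x) = fsc (qi^3) (G (K x))" "Ki (G x) = fsc (q^3) (G (Ki x))"
  by (simp_all add: G_def KF gen_lin mult.assoc qi qi_cancel eval_nat_numeral fv.scale_right_diff_distrib)

text \<open>Each Serre relation between \<open>F1\<close> and \<open>F2\<close> says exactly that
  \<open>G\<close> commutes with one of them up to a power of \<open>q\<close>.\<close>

lemma F_comm: "F1 (F2 x) = G x + fsc q (F2 (F1 x))" "F1 (G x) = fsc qi (G (F1 x))"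
  "G (F2 x) = fsc qi (F2 (G x))"
proof -
  show "F1 (F2 x) = G x + fsc q (F2 (F1 x))" by (simp add: G_def)
  show "F1 (G x) = fsc qi (G (F1 x))"
    using serreF1[of x] unfolding G_def qi_def[symmetric]
    by (simp add: gen_lin qi) (simp add: fun_eq_iff pointwise qi_cancel algebra_simps)
  show "G (F2 x) = fsc qi (F2 (G x))"
    using serreF2[of x] unfolding G_def qi_def[symmetric]
    by (simp add: gen_lin qi) (simp add: fun_eq_iff pointwise qi_cancel algebra_simps)
qed

lemma E1F1: "E1 (F1 x) = F1 (E1 x) + fsc (q*ps) (K2i (K2i (K x)) - K2 (K2 (Ki x)))"
  by (simp add: E1F1' K1_eq K1i_eq ps_def)
lemma E2F2: "E2 (F2 x) = F2 (E2 x) + fsc (q*ps) (K2 x - K2i x)"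
  by (simp add: E2F2' ps_def)

lemma EG: "E1 (G x) = G (E1 x) + F2 (K2 (K2 (Ki x)))" "E2 (G x) = G (E2 x) - fsc q (F1 (K2 x))"
proof -
  note qi(1,4)
  then show "E1 (G x) = G (E1 x) + F2 (K2 (K2 (Ki x)))"
    unfolding G_def
    by (simp add: E1F1 E2F2 E1F2 E2F1 gen_lin KF) (rule ext, simp add: pointwise, algebra)
  show "E2 (G x) = G (E2 x) - fsc q (F1 (K2 x))"
    using qi(1,4) unfolding G_def
    by (simp add: E1F1 E2F2 E1F2 E2F1 gen_lin KF) (rule ext, simp add: pointwise, algebra)
qed

text \<open>Rewriting to the order \<open>F2, G, F1\<close>, then \<open>K2\<close> and \<open>K\<close>, with \<open>E1, E2\<close> innermost,
  where they meet the vector.\<close>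

lemmas nf = K1_eq K1i_eq KKi K2K2i KK2 EK KF KG F_comm E1F1 EG E1F2 E2F1 E2F2 gen_lin

definition "Cas x = F1 (E1 x) + fsc (q^2*ps^2) (fsc q (K1 x) + fsc qi (K1i x))"
definition "E3 x = E1 (E2 x) - fsc q (E2 (E1 x))"
text \<open>\<open>hop n\<close> is the polynomial \<open>h\<^sub>n\<close> evaluated at \<open>K\<close> and \<open>C1\<close>.\<close>

definition "hop n x = fsc (q^3*(qi^n)^2) (K x) + fsc ((q^n)^2*qi^3) (Ki x) - fsc ((q-qi)^2) (Cas x)"

lemma lin_Cas: "lin Cas" and lin_E3: "lin E3"
  unfolding lin_def
  by (auto simp: Cas_def E3_def gen_lin) (simp_all add: fun_eq_iff pointwise algebra_simps)

lemma lin_hop: "lin (hop n)"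
  unfolding lin_def
  by (auto simp: hop_def gen_lin lin_add[OF lin_Cas] lin_sc[OF lin_Cas]) (simp_all add: fun_eq_iff pointwise algebra_simps)

end

section \<open>The ladder operator\<close>

locale jimbo_whittaker = jimbo_module +
  fixes \<alpha> :: complex
  assumes \<alpha>_nz: "\<alpha> \<noteq> 0"
begin

definition "T x = F2 x + fsc (qi^2) (fsc (\<alpha> * (q^2-1)) (G (Ki x)) - F2 (K2 (K2 (Ki (Ki x)))))"

lemma lin_T: "lin T"
  unfolding lin_def by (auto simp: T_def gen_lin) (simp_all add: fun_eq_iff pointwise algebra_simps)

lemma E1_T: assumes "E1 x = fsc \<alpha> x" shows "E1 (T x) = fsc \<alpha> (T x)"
  unfolding T_def
  by (simp add: nf assms) (rule ext, simp only: pointwise, (use qi(1,4) in algebra | algebra))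

lemma E1_F2: assumes "E1 x = fsc \<alpha> x" shows "E1 (F2 x) = fsc \<alpha> (F2 x)"
  using assms by (simp add: nf)

lemma E1_K: assumes "E1 x = fsc \<alpha> x" shows "E1 (K x) = fsc \<alpha> (K x)" "E1 (Ki x) = fsc \<alpha> (Ki x)"
  using assms by (simp_all add: nf)

lemma E1_Cas: assumes "E1 x = fsc \<alpha> x" shows "E1 (Cas x) = fsc \<alpha> (Cas x)"
  unfolding Cas_def
  by (simp add: nf assms) (rule ext, simp only: pointwise, (use qi(1,4) in algebra | algebra))

text \<open>Equivalently, \<open>T - F2\<close> passes \<open>F2\<close> with the factor
  \<open>q^2\<close>; each of the two remaining summands of \<open>T\<close> does so.\<close>

lemma T_F2: "T (F2 x) = fsc (q^2) (F2 (T x)) + fsc (1-q^2) (F2 (F2 x))"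
  unfolding T_def
  by (simp add: nf) (rule ext, simp only: pointwise, (use qi(1,4) in algebra | algebra))

text \<open>On the eigenspace of \<open>E1\<close>, \<open>Cas\<close> is \<open>\<alpha>\<close>
  times \<open>F1\<close> up to \<open>K1\<close> and \<open>K1i\<close>. So this is the rule for
  moving \<open>F1\<close> past \<open>T\<close>, freed of \<open>F1\<close>.\<close>

lemma Cas_T:
  assumes "E1 x = fsc \<alpha> x"
  shows "Cas (T x) = T (fsc qi (Cas x) + fsc (q^2*ps) (K x)) - fsc (q*ps) (F2 (hop 1 x))"
  unfolding hop_def T_def Cas_def
  by (simp add: nf assms) (rule ext, simp only: pointwise, (use qi(1,4) in algebra | algebra))

lemma Cas_F2:
  assumes "E1 x = fsc \<alpha> x"
  shows "Cas (F2 x) = fsc q (F2 (Cas x)) + fsc (q^2*ps) (T (K x) - F2 (K x))"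
  unfolding T_def Cas_def
  by (simp add: nf assms) (rule ext, simp only: pointwise, (use qi(1,4) in algebra | algebra))

text \<open>\<open>E2 x\<close> enters in the factored form \<open>K2 (Ki z)\<close> because the
  result has that form again, which makes the rule iterate.\<close>

lemma E2_T:
  assumes "E1 x = fsc \<alpha> x" "E1 z = fsc \<alpha> z" "E2 x = K2 (Ki z)"
  shows "E2 (T x) = K2 (Ki (fsc q (T z) - fsc (q-qi) (F2 z) + fsc ps (hop 1 x)))"
  unfolding hop_def T_def Cas_def
  by (simp add: nf assms) (rule ext, simp only: pointwise, (use qi(1,4) in algebra | algebra))

lemma E3_T:
  assumes "E1 x = fsc \<alpha> x" "E3 x = 0"
  shows "E3 (T x) = 0"
proof -
  \<comment> \<open>Used as a rewrite rule, this removes \<open>E1 (E2 x)\<close> from the normal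
    form.\<close>
  have "E1 (E2 x) = fsc (\<alpha> * q) (E2 x)"
    using assms by (simp add: E3_def gen_lin mult.commute)
  note this [simp]
  show ?thesis
    unfolding E3_def T_def
    by (simp add: nf assms(1)) (rule ext, simp only: pointwise, (use qi(1,4) in algebra | algebra))
qed

text \<open>On eigenvectors of \<open>E1\<close> the correction is a multiple of
  \<open>K2i x\<close>, so that composition with \<open>K2\<close> will turn \<open>E3\<close> into
  a skew derivation.\<close>

lemma E3_F2: "E3 (F2 x) = F2 (E3 x) + K2i (E1 x)"
  unfolding E3_def
  by (simp add: nf) (rule ext, simp only: pointwise, (use qi(1,4) in algebra | algebra))

lemma K_T: "K (T x) = fsc (qi^3) (T (K x))"
  unfolding T_def
  by (simp add: nf) (rule ext, simp only: pointwise, (use qi(1,4) in algebra | algebra))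
lemma Ki_T: "Ki (T x) = fsc (q^3) (T (Ki x))"
  unfolding T_def
  by (simp add: nf) (rule ext, simp only: pointwise, (use qi(1,4) in algebra | algebra))

lemma Cas_K: "Cas (K x) = K (Cas x)" "Cas (Ki x) = Ki (Cas x)"
  unfolding Cas_def by (simp_all add: nf)

lemma E2_Cas: 
  assumes "E1 x = fsc \<alpha> x" "E2 x = 0"
  shows "E2 (Cas x) = 0"
  unfolding Cas_def using assms by (simp add: nf) 

end

section \<open>Sums of subspaces and separation of eigenvectors\<close>

lemma span_stable:
  assumes "lin f" "\<And>x. x \<in> B \<Longrightarrow> f x \<in> fv.span C" "x \<in> fv.span B"
  shows "f x \<in> fv.span C"
  using assms(3)
proof (induction rule: fv.span_induct_alt)
  case base
  then show ?case by (simp add: lin_zero[OF assms(1)] fv.span_zero)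
next
  case (step c x y)
  then show ?case
    by (simp add: lin_add[OF assms(1)] lin_sc[OF assms(1)] fv.span_add fv.span_scale assms(2))
qed

lemma span_UN_decomp:
  assumes "\<And>i. fv.subspace (X i)" "x \<in> fv.span (\<Union>i. X i)"
  shows "\<exists>I y. finite I \<and> (\<forall>i. y i \<in> X i) \<and> x = (\<Sum>i\<in>I. y i)"
  using assms(2)
proof (induction rule: fv.span_induct_alt)
  case base
  have "\<forall>i. 0 \<in> X i" using fv.subspace_0[OF assms(1)] by blast
  then show ?case by (intro exI[of _ "{}"] exI[of _ "\<lambda>_. 0"]) simp
next
  case (step c x z)
  then obtain I y i where y: "finite I" "\<forall>i. y i \<in> X i" "z = (\<Sum>i\<in>I. y i)" "x \<in> X i" by auto
  \<comment> \<open>The new index \<open>i\<close> may or may not lie in \<open>I\<close>, so old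
    values are cut off outside \<open>I\<close> before the new term is added.\<close>
  define y' where "y' j = (if j \<in> I then y j else 0) + (if j = i then fsc c x else 0)" for j
  have X0: "0 \<in> X j" for j using fv.subspace_0[OF assms(1)] by blast
  have "\<forall>j. y' j \<in> X j" unfolding y'_def
    using y X0 by (auto intro!: fv.subspace_add[OF assms(1)] fv.subspace_scale[OF assms(1)])
  moreover have "fsc c x + z = (\<Sum>j\<in>insert i I. y' j)"
  proof -
    have "(\<Sum>j\<in>insert i I. y' j) = (\<Sum>j\<in>insert i I. if j \<in> I then y j else 0) + (\<Sum>j\<in>insert i I. if j = i then fsc c x else 0)"
      unfolding y'_def by (rule sum.distrib)
    also have "(\<Sum>j\<in>insert i I. if j \<in> I then y j else 0) = z"
      using y(1,3) by (simp add: sum.inter_restrict[symmetric] Int_absorb1 subset_insertI)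
    also have "(\<Sum>j\<in>insert i I. if j = i then fsc c x else 0) = fsc c x"
      using y(1) by (subst sum.delta) auto
    finally show ?thesis by (simp add: add.commute)
  qed
  ultimately show ?case using y(1) by (intro exI[of _ "insert i I"] exI[of _ y']) auto
qed

lemma span_UN_decomp_nat:
  fixes X :: "nat \<Rightarrow> falg set"
  assumes "\<And>i. fv.subspace (X i)" "x \<in> fv.span (\<Union>i. X i)"
  shows "\<exists>n y. (\<forall>i. y i \<in> X i) \<and> x = (\<Sum>i<n. y i)"
proof -
  from span_UN_decomp[OF assms] obtain I y where y: "finite I" "\<forall>i. y i \<in> X i" "x = (\<Sum>i\<in>I. y i)" by auto
  from y(1) obtain n where n: "I \<subseteq> {..<n}" by (meson finite_nat_iff_bounded)
  have "\<forall>i. (if i \<in> I then y i else 0) \<in> X i" using y(2) fv.subspace_0[OF assms(1)] by auto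
  moreover have "x = (\<Sum>i<n. if i \<in> I then y i else 0)"
    using n y by (simp add: sum.inter_restrict[symmetric] Int_absorb1)
  ultimately show ?thesis by (intro exI[of _ n] exI[of _ "\<lambda>i. if i \<in> I then y i else 0"]) simp
qed

lemma subspace_image: "lin f \<Longrightarrow> fv.subspace S \<Longrightarrow> fv.subspace (f ` S)"
  unfolding fv.subspace_def
  by (auto simp: lin_zero lin_add lin_sc image_iff) (metis lin_zero lin_add lin_sc)+

text \<open>Applying \<open>f\<close> minus the scalar \<open>\<mu> j\<close> removes the
  \<open>j\<close>-th term and multiplies the others by nonzero scalars, so induction applies. For
  \<open>S = {0}\<close> this is the independence of eigenvectors.\<close>

lemma eigen_sep:
  assumes "lin f" "finite I" "\<And>i. i \<in> I \<Longrightarrow> f (x i) = fsc (\<mu> i) (x i)" "inj_on \<mu> I"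
    "fv.subspace S" "\<And>y. y \<in> S \<Longrightarrow> f y \<in> S" "(\<Sum>i\<in>I. x i) \<in> S"
  shows "\<forall>i\<in>I. x i \<in> S"
  using assms(2,3,4,7)
proof (induction I arbitrary: x rule: finite_induct)
  case (insert j I)
  let ?s = "\<Sum>i\<in>insert j I. x i"
  have "f ?s - fsc (\<mu> j) ?s = (\<Sum>i\<in>I. fsc (\<mu> i - \<mu> j) (x i))"
    using insert.hyps insert.prems(1)
    by (simp add: lin_add[OF assms(1)] lin_sum[OF assms(1)] fv.scale_right_distrib fv.scale_sum_right
        fv.scale_left_diff_distrib sum_subtractf)
  moreover have "f ?s - fsc (\<mu> j) ?s \<in> S"
    by (rule fv.subspace_diff[OF assms(5) assms(6) fv.subspace_scale[OF assms(5)]]) (rule insert.prems(3))+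
  ultimately have "(\<Sum>i\<in>I. fsc (\<mu> i - \<mu> j) (x i)) \<in> S" by simp
  moreover have "f (fsc (\<mu> i - \<mu> j) (x i)) = fsc (\<mu> i) (fsc (\<mu> i - \<mu> j) (x i))" if "i \<in> I" for i
    using that insert.prems(1) by (simp add: lin_sc[OF assms(1)] mult.commute)
  ultimately have 1: "\<forall>i\<in>I. fsc (\<mu> i - \<mu> j) (x i) \<in> S"
    using insert.prems(2) by (intro insert.IH) auto
  have 2: "x i \<in> S" if "i \<in> I" for i
  proof -
    have "\<mu> i - \<mu> j \<noteq> 0" using that insert.hyps insert.prems(2) by (auto simp: inj_on_def)
    then have "x i = fsc (1 / (\<mu> i - \<mu> j)) (fsc (\<mu> i - \<mu> j) (x i))" by simp
    also have "\<dots> \<in> S" by (rule fv.subspace_scale[OF assms(5)]) (use 1 that in blast)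
    finally show ?thesis .
  qed
  have "x j = ?s - (\<Sum>i\<in>I. x i)" using insert.hyps by simp
  also have "\<dots> \<in> S" by (rule fv.subspace_diff[OF assms(5) insert.prems(3) fv.subspace_sum[OF assms(5)]]) (rule 2)
  finally show ?case using 2 by auto
qed auto

context jimbo_whittaker
begin

definition "wh x \<longleftrightarrow> E1 x = fsc \<alpha> x \<and> E2 x = 0"

lemma whD: "wh x \<Longrightarrow> E1 x = fsc \<alpha> x" "wh x \<Longrightarrow> E2 x = 0" "wh x \<Longrightarrow> E3 x = 0"
  by (auto simp: wh_def E3_def gen_lin)

lemma wh_closed: "wh 0" "wh x \<Longrightarrow> wh y \<Longrightarrow> wh (x + y)" "wh x \<Longrightarrow> wh (fsc c x)"
  "wh x \<Longrightarrow> wh (K x)" "wh x \<Longrightarrow> wh (Ki x)" "wh x \<Longrightarrow> wh (Cas x)"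
  by (auto simp: wh_def gen_lin E1_K E1_Cas E2_Cas EK mult.commute fv.scale_right_distrib)

lemma wh_hop: "wh x \<Longrightarrow> wh (hop n x)"
  unfolding hop_def diff_conv_add_uminus fv.scale_minus_left[symmetric] by (intro wh_closed)

lemmas op_lin = lin_T[THEN lin_add] lin_T[THEN lin_sc] lin_T[THEN lin_zero] lin_T[THEN lin_neg] lin_T[THEN lin_diff]
  lin_Cas[THEN lin_add] lin_Cas[THEN lin_sc] lin_Cas[THEN lin_zero] lin_Cas[THEN lin_neg] lin_Cas[THEN lin_diff]
  lin_hop[THEN lin_add] lin_hop[THEN lin_sc] lin_hop[THEN lin_zero] lin_hop[THEN lin_neg] lin_hop[THEN lin_diff]

lemmas lT = lin_funpow[OF lin_T]
lemmas Tn_lin = lT[THEN lin_add] lT[THEN lin_sc] lT[THEN lin_zero] lT[THEN lin_neg] lT[THEN lin_diff]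

lemma E1_Tn: "E1 x = fsc \<alpha> x \<Longrightarrow> E1 ((T ^^ n) x) = fsc \<alpha> ((T ^^ n) x)"
  by (induction n) (auto simp: E1_T)

lemma E3_Tn: "E1 x = fsc \<alpha> x \<Longrightarrow> E3 x = 0 \<Longrightarrow> E3 ((T ^^ n) x) = 0"
  by (induction n) (auto simp: E3_T E1_Tn)

lemma K_Tn: "K ((T ^^ n) x) = fsc ((qi^n)^3) ((T ^^ n) (K x))"
  by (induction n) (auto simp: K_T op_lin power_mult_distrib mult.commute)

lemma Ki_Tn: "Ki ((T ^^ n) x) = fsc ((q^n)^3) ((T ^^ n) (Ki x))"
  by (induction n) (auto simp: Ki_T op_lin power_mult_distrib mult.commute)

text \<open>\<open>C1\<close> does not preserve the powers of \<open>T\<close>; the error term is the same \<open>h\<^sub>n\<close> that governs \<open>E2\<close>.\<close>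

lemma Cas_Tn:
  assumes "E1 x = fsc \<alpha> x"
  shows "Cas ((T ^^ Suc n) x) = (T ^^ Suc n) (fsc (qi^Suc n) (Cas x) + fsc (q^5*ps^2*(qi^Suc n - (qi^Suc n)^3)) (K x))
     - fsc (q^2*ps^2*(q^Suc n - qi^Suc n)) (F2 ((T ^^ n) (hop (Suc n) x)))"
proof (induction n)
  case 0
  show ?case
    by (simp add: Cas_T[OF assms] op_lin hop_def gen_lin)
      (rule ext, simp only: pointwise, use qi(1,4) in algebra)
next
  case (Suc n)
  have nz: "q \<noteq> 0" "q^n \<noteq> 0" "q^2 - 1 \<noteq> 0" using q_nz q2 by auto
  \<comment> \<open>With \<open>qi\<close> and \<open>ps\<close> as fractions and \<open>q^n\<close>
    kept as an atom, clearing denominators leaves a polynomial identity.\<close>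
  have e: "qi = 1/q" "ps = 1/(q^2-1)" "(1/q)^n = 1/q^n"
    by (simp_all add: qi_def ps_def divide_inverse power_inverse)
  show ?case
    unfolding funpow.simps(2)[of "Suc n"] o_apply
    unfolding Cas_T[OF E1_Tn[OF assms]] hop_def[of 1] Suc K_Tn Ki_Tn
    by (simp add: op_lin Tn_lin hop_def T_F2 gen_lin)
      (rule ext, simp only: pointwise e, simp add: divide_simps nz, algebra)
qed

text \<open>This is \<open>[n] / (q^2 - 1)\<close>.\<close>

definition "be n = q * ps^2 * (q^n - qi^n)"

text \<open>In the induction, the \<open>F2\<close> term of \<open>E2_T\<close> cancels against the
  one that \<open>Cas_Tn\<close> contributes through \<open>hop 1\<close>, so only powers of
  \<open>T\<close> remain.\<close>

lemma E2_Tn: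
  assumes "wh x"
  shows "E2 ((T ^^ Suc n) x) = K2 (Ki (fsc (be (Suc n)) ((T ^^ n) (hop (Suc n) x))))"
proof (induction n)
  case 0
  have "be 1 = ps" unfolding be_def using qi(1,4) by simp algebra
  then show ?case using E2_T[of x 0] assms
    by (simp add: wh_def gen_lin op_lin)
next
  case (Suc n)
  have nz: "q \<noteq> 0" "q^n \<noteq> 0" "q^2 - 1 \<noteq> 0" using q_nz q2 by auto
  have e: "qi = 1/q" "ps = 1/(q^2-1)" "(1/q)^n = 1/q^n"
    by (simp_all add: qi_def ps_def divide_inverse power_inverse)
  let ?z = "fsc (be (Suc n)) ((T ^^ n) (hop (Suc n) x))"
  have z: "E1 ?z = fsc \<alpha> ?z"
    using whD(1)[OF wh_hop[OF assms]] by (simp add: E1_Tn gen_lin mult.commute)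
  have "E2 ((T ^^ Suc (Suc n)) x) = K2 (Ki (fsc q (T ?z) - fsc (q-qi) (F2 ?z) + fsc ps (hop 1 ((T ^^ Suc n) x))))"
    unfolding funpow.simps(2)[of "Suc n"] o_apply
    by (rule E2_T[OF E1_Tn[OF whD(1)[OF assms]] z Suc])
  also have "fsc q (T ?z) - fsc (q-qi) (F2 ?z) + fsc ps (hop 1 ((T ^^ Suc n) x)) = 
      fsc (be (Suc (Suc n))) ((T ^^ Suc n) (hop (Suc (Suc n)) x))"
    unfolding hop_def[of 1] Cas_Tn[OF whD(1)[OF assms]] K_Tn Ki_Tn be_def
    by (simp add: op_lin Tn_lin hop_def gen_lin)
       (rule ext, simp only: pointwise e, simp add: divide_simps nz, algebra)
  finally show ?case .
qed


section \<open>Submodules generated by Whittaker vectors\<close>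

lemma q_pow_inj: "q ^ m = q ^ n \<Longrightarrow> m = n"
proof (induction m n rule: linorder_wlog)
  case (le m n)
  show ?case
  proof (rule ccontr)
    assume "m \<noteq> n"
    with le have "n - m > 0" by auto
    have "q ^ n = q ^ m * q ^ (n - m)" using le(1) by (simp flip: power_add)
    then have "q ^ (n - m) = 1" using le q_nz by simp
    with q_root[OF \<open>n - m > 0\<close>] show False by simp
  qed
qed auto

lemma q_powi_inj: "q powi m = q powi n \<Longrightarrow> m = n"
proof -
  have *: "q powi k \<noteq> 1" if "k \<noteq> 0" for k :: int
  proof (cases "k > 0")
    case True
    then show ?thesis using q_root[of "nat k"] by (simp add: power_int_def)
  next
    case False
    then show ?thesis using q_root[of "nat (-k)"] that by (simp add: power_int_def power_inverse)
  qed
  assume "q powi m = q powi n"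
  then have "q powi (m - n) = 1" using q_nz by (simp add: power_int_diff)
  with * show "m = n" by (cases "m - n = 0") auto
qed

lemma qi_pow_inj: "qi ^ m = qi ^ n \<Longrightarrow> m = n"
  using q_pow_inj by (simp add: qi_def power_inverse)

lemma be_nz: "n > 0 \<Longrightarrow> be n \<noteq> 0"
proof
  assume "n > 0" "be n = 0"
  then have "q ^ n = qi ^ n" using q_nz qi(5) by (simp add: be_def)
  then have "q ^ n * q ^ n = 1" using qi2(1)[of n] by simp
  then show False using q_root[of "n + n"] \<open>n > 0\<close> by (simp add: power_add)
qed

text \<open>The orbit of \<open>w\<close> under \<open>C[K, K^(-1), C1]\<close>, given as a closure
  so that stability goes by rule induction.\<close>

inductive_set Orb for w where
  Orb_base: "w \<in> Orb w"
| Orb_zero: "0 \<in> Orb w"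
| Orb_add: "x \<in> Orb w \<Longrightarrow> y \<in> Orb w \<Longrightarrow> x + y \<in> Orb w"
| Orb_sc: "x \<in> Orb w \<Longrightarrow> fsc c x \<in> Orb w"
| Orb_K: "x \<in> Orb w \<Longrightarrow> K x \<in> Orb w"
| Orb_Ki: "x \<in> Orb w \<Longrightarrow> Ki x \<in> Orb w"
| Orb_Cas: "x \<in> Orb w \<Longrightarrow> Cas x \<in> Orb w"

lemma Orb_subspace: "fv.subspace (Orb w)"
  by (rule fv.subspaceI) (auto intro: Orb.intros)

lemma Orb_hop: "x \<in> Orb w \<Longrightarrow> hop n x \<in> Orb w"
  unfolding hop_def diff_conv_add_uminus fv.scale_minus_left[symmetric] by (intro Orb.intros)

lemma Orb_wh: "x \<in> Orb w \<Longrightarrow> wh w \<Longrightarrow> wh x"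
  by (induction rule: Orb.induct) (auto intro: wh_closed)

text \<open>For a Whittaker vector \<open>w\<close> these nested spaces can be told apart by
  operators: \<open>K2z l\<close> moves the \<open>E1\<close> eigenvalue from
  \<open>\<alpha>\<close> to \<open>\<alpha> * q powi l\<close>, \<open>del\<close> lowers the
  degree in \<open>F2\<close> inside \<open>FTsp w\<close>, and it kills \<open>Tsp w\<close>. The
  largest space is a submodule.\<close>

definition "Tsp w = fv.span (\<Union>k. (T ^^ k) ` Orb w)"
definition "FTsp w = fv.span (\<Union>j. (F2 ^^ j) ` Tsp w)"
definition "K2z l = (if l \<ge> 0 then K2 ^^ nat l else K2i ^^ nat (- l))" for l :: int
definition "KFTsp w = fv.span (\<Union>l. K2z l ` FTsp w)"

lemma lin_K2z: "lin (K2z l)"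
  by (simp add: K2z_def lin_funpow lin_ops)

lemma K2z0 [simp]: "K2z 0 x = x"
  by (simp add: K2z_def)

lemma K2_K2z: "K2 (K2z l x) = K2z (l + 1) x"
proof (cases "l \<ge> 0")
  case True
  then have "nat (l + 1) = Suc (nat l)" by simp
  with True show ?thesis by (simp add: K2z_def)
next
  case False
  then have "nat (- l) = Suc (nat (- (l + 1)))" by simp
  with False show ?thesis by (auto simp: K2z_def K2K2i)
qed

lemma K2i_K2z: "K2i (K2z l x) = K2z (l - 1) x"
  using K2_K2z[of "l - 1" x] by (metis K2K2i(2) diff_add_cancel)

lemma K2z_inv: "K2z (- l) (K2z l x) = x"
proof -
  have 1: "(K2i ^^ n) ((K2 ^^ n) x) = x" for n x
  proof (induction n arbitrary: x)
    case (Suc n)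
    have "(K2i ^^ Suc n) ((K2 ^^ Suc n) x) = (K2i ^^ n) (K2i (K2 ((K2 ^^ n) x)))"
      by (simp only: funpow_Suc_right[of n K2i] funpow.simps(2)[of n K2] o_apply)
    then show ?case by (simp add: K2K2i Suc)
  qed simp
  have 2: "(K2 ^^ n) ((K2i ^^ n) x) = x" for n x
  proof (induction n arbitrary: x)
    case (Suc n)
    have "(K2 ^^ Suc n) ((K2i ^^ Suc n) x) = (K2 ^^ n) (K2 (K2i ((K2i ^^ n) x)))"
      by (simp only: funpow_Suc_right[of n K2] funpow.simps(2)[of n K2i] o_apply)
    then show ?case by (simp add: K2K2i Suc)
  qed simp
  show ?thesis by (cases "l = 0") (auto simp: K2z_def 1 2)
qed

lemma Tsp_T: "x \<in> Tsp w \<Longrightarrow> T x \<in> Tsp w"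
  unfolding Tsp_def
proof (rule span_stable[OF lin_T])
  fix x assume "x \<in> (\<Union>k. (T ^^ k) ` Orb w)"
  then obtain k a where "x = (T ^^ k) a" "a \<in> Orb w" by auto
  then have "T x = (T ^^ Suc k) a" by simp
  with \<open>a \<in> Orb w\<close> show "T x \<in> fv.span (\<Union>k. (T ^^ k) ` Orb w)" by (intro fv.span_base) blast
qed

lemma Tsp_base: "a \<in> Orb w \<Longrightarrow> (T ^^ k) a \<in> Tsp w"
  unfolding Tsp_def by (rule fv.span_base) blast

lemma Tsp_subspace: "fv.subspace (Tsp w)" and FTsp_subspace: "fv.subspace (FTsp w)" and KFTsp_subspace: "fv.subspace (KFTsp w)"
  by (simp_all add: Tsp_def FTsp_def KFTsp_def)

lemma Tsp_ind [consumes 1, case_names 0 add gen]: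
  assumes "x \<in> Tsp w" "Q 0" "\<And>x y c. Q x \<Longrightarrow> Q y \<Longrightarrow> Q (fsc c x + y)" "\<And>k a. a \<in> Orb w \<Longrightarrow> Q ((T ^^ k) a)"
  shows "Q x"
  using assms(1) unfolding Tsp_def by (induction rule: fv.span_induct_alt) (use assms in auto)

lemma FTsp_ind [consumes 1, case_names 0 add gen]:
  assumes "x \<in> FTsp w" "Q 0" "\<And>x y c. Q x \<Longrightarrow> Q y \<Longrightarrow> Q (fsc c x + y)" "\<And>j a. a \<in> Tsp w \<Longrightarrow> Q ((F2 ^^ j) a)"
  shows "Q x"
  using assms(1) unfolding FTsp_def by (induction rule: fv.span_induct_alt) (use assms in auto)

lemma KFTsp_ind [consumes 1, case_names 0 add gen]:
  assumes "x \<in> KFTsp w" "Q 0" "\<And>x y c. Q x \<Longrightarrow> Q y \<Longrightarrow> Q (fsc c x + y)" "\<And>l a. a \<in> FTsp w \<Longrightarrow> Q (K2z l a)"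
  shows "Q x"
  using assms(1) unfolding KFTsp_def by (induction rule: fv.span_induct_alt) (use assms in auto)

lemmas FTsp_closed = FTsp_subspace[THEN fv.subspace_add] FTsp_subspace[THEN fv.subspace_scale] FTsp_subspace[THEN fv.subspace_0]
  FTsp_subspace[THEN fv.subspace_diff]
lemmas Tsp_closed = Tsp_subspace[THEN fv.subspace_add] Tsp_subspace[THEN fv.subspace_scale] Tsp_subspace[THEN fv.subspace_0]
lemmas KFTsp_closed = KFTsp_subspace[THEN fv.subspace_add] KFTsp_subspace[THEN fv.subspace_scale] KFTsp_subspace[THEN fv.subspace_0]
  KFTsp_subspace[THEN fv.subspace_diff]

lemma FTsp_base: "a \<in> Tsp w \<Longrightarrow> (F2 ^^ j) a \<in> FTsp w"
  unfolding FTsp_def by (rule fv.span_base) blast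
lemma Tsp_FTsp: "a \<in> Tsp w \<Longrightarrow> a \<in> FTsp w"
  using FTsp_base[of a w 0] by simp
lemma KFTsp_base: "a \<in> FTsp w \<Longrightarrow> K2z l a \<in> KFTsp w"
  unfolding KFTsp_def by (rule fv.span_base) blast
lemma FTsp_KFTsp: "a \<in> FTsp w \<Longrightarrow> a \<in> KFTsp w"
  using KFTsp_base[of a w 0] by simp

lemma Tsp_K: "x \<in> Tsp w \<Longrightarrow> K x \<in> Tsp w" "x \<in> Tsp w \<Longrightarrow> Ki x \<in> Tsp w"
  by (induction rule: Tsp_ind)
    (auto simp: gen_lin K_Tn Ki_Tn intro!: Tsp_closed Tsp_base Orb_K Orb_Ki)

lemma FTsp_F2: "x \<in> FTsp w \<Longrightarrow> F2 x \<in> FTsp w"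
proof (induction rule: FTsp_ind)
  case (gen j a)
  have "F2 ((F2 ^^ j) a) = (F2 ^^ Suc j) a" by simp
  then show ?case using FTsp_base[OF gen, of "Suc j"] by simp
qed (auto simp: gen_lin intro!: FTsp_closed)

lemma FTsp_K: "x \<in> FTsp w \<Longrightarrow> K x \<in> FTsp w \<and> Ki x \<in> FTsp w"
proof (induction rule: FTsp_ind)
  case (gen j a)
  then show ?case
    by (induction j) (simp_all add: Tsp_K Tsp_FTsp KF FTsp_closed FTsp_F2)
qed (auto simp: gen_lin intro!: FTsp_closed)

lemma FTsp_T: "x \<in> FTsp w \<Longrightarrow> T x \<in> FTsp w"
proof (induction rule: FTsp_ind)
  case (gen j a)
  show ?case
  proof (induction j)
    case 0
    show ?case using Tsp_FTsp[OF Tsp_T[OF gen]] by simp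
  next
    case (Suc j)
    then show ?case using FTsp_base[OF gen, of j]
      by (auto simp: T_F2 intro!: FTsp_closed FTsp_F2)
  qed
qed (auto simp: op_lin intro!: FTsp_closed)

text \<open>On \<open>FTsp w\<close>, \<open>del\<close> below acts as a q-derivative in \<open>F2\<close>. It makes the sum of the spaces
  \<open>F2\<^sup>j (Tsp w)\<close> direct, which replaces the PBW theorem.\<close>

definition "br n = (\<Sum>i<n. (qi^2)^i)"

lemma br_nz: assumes "n > 0" shows "br n \<noteq> 0"
proof
  assume 0: "br n = 0"
  have "qi^2 \<noteq> 1" using qi_pow_inj[of 2 0] by auto
  then have "br n * (qi^2 - 1) = (qi^2)^n - 1"
    unfolding br_def by (simp add: geometric_sum)
  with 0 have "qi ^ (2 * n) = 1" by (simp add: power_mult)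
  then show False using qi_pow_inj[of "2*n" 0] assms by simp
qed

lemma lin_Fn: "lin (F2 ^^ n)" by (intro lin_funpow lin_ops)

definition "del x = K2 (E3 x)"

lemma lin_del: "lin del"
  by (auto simp: lin_def del_def lin_E3[THEN lin_add] lin_E3[THEN lin_sc] gen_lin)

lemma del_F2: "del (F2 x) = fsc (qi^2) (F2 (del x)) + E1 x"
  by (simp add: del_def E3_F2 gen_lin KF K2K2i)

text \<open>Weaker than \<open>wh\<close>: for a Whittaker vector \<open>a\<close>, all
  \<open>(T ^^ n) a\<close> are killed by \<open>E3\<close>, though in general not by
  \<open>E2\<close>.\<close>

definition "pv x \<longleftrightarrow> E1 x = fsc \<alpha> x \<and> E3 x = 0"

lemma E1_Fn: "E1 x = fsc \<alpha> x \<Longrightarrow> E1 ((F2 ^^ n) x) = fsc \<alpha> ((F2 ^^ n) x)"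
  by (induction n) (auto simp: E1_F2)

lemma br_Suc: "br (Suc n) = 1 + qi^2 * br n"
  unfolding br_def by (simp only: sum.lessThan_Suc_shift) (simp add: sum_distrib_left mult.commute)

lemma del_Fn: assumes "pv x" shows "del ((F2 ^^ Suc n) x) = fsc (\<alpha> * br (Suc n)) ((F2 ^^ n) x)"
proof (induction n)
  case 0
  show ?case using assms by (simp add: del_F2 pv_def del_def[of x] gen_lin br_def)
next
  case (Suc n)
  show ?case
    unfolding funpow.simps(2)[of "Suc n"] o_apply del_F2 Suc br_Suc[of "Suc n"]
    using E1_Fn[of x "Suc n"] assms
    by (simp add: pv_def gen_lin) (simp add: fun_eq_iff pointwise algebra_simps)
qed

lemma pv_Tsp: assumes "wh w" "x \<in> Tsp w" shows "pv x"
  using assms(2)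
proof (induction rule: Tsp_ind)
  case (gen k a)
  then show ?case using whD[OF Orb_wh[OF gen assms(1)]]
    by (simp add: pv_def E1_Tn E3_Tn)
qed (auto simp: pv_def gen_lin lin_E3[THEN lin_add] lin_E3[THEN lin_sc] lin_E3[THEN lin_zero]
     fv.scale_right_distrib mult.commute)

lemma E1_FTsp: assumes "wh w" "x \<in> FTsp w" shows "E1 x = fsc \<alpha> x"
  using assms(2)
proof (induction rule: FTsp_ind)
  case (gen k a)
  then show ?case using pv_Tsp[OF assms(1)] by (simp add: pv_def E1_Fn)
qed (auto simp: gen_lin fv.scale_right_distrib mult.commute)

text \<open>The correction in \<open>Cas_Tn\<close> carries a factor \<open>F2\<close> and can lead
  out of \<open>Tsp w\<close>, whereas \<open>FTsp w\<close> is closed under it and under the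
  corrections in \<open>Cas_F2\<close>.\<close>

lemma FTsp_Cas: assumes "wh w" "x \<in> FTsp w" shows "Cas x \<in> FTsp w"
  using assms(2)
proof (induction rule: FTsp_ind)
  case (gen j a)
  show ?case
  proof (induction j)
    case 0
    have "Cas a \<in> FTsp w" using gen
    proof (induction rule: Tsp_ind)
      case (gen k a)
      show ?case
      proof (cases k)
        case 0
        then show ?thesis using Tsp_base[OF Orb_Cas[OF gen], where k = 0] Tsp_FTsp by simp
      next
        case (Suc n)
        show ?thesis unfolding Suc Cas_Tn[OF whD(1)[OF Orb_wh[OF gen assms(1)]]]
          by (intro FTsp_closed Tsp_FTsp FTsp_F2 Tsp_base Orb.intros Orb_hop gen)
      qed
    qed (auto simp: op_lin intro!: FTsp_closed)
    then show ?case by simp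
  next
    case (Suc j)
    have m: "(F2 ^^ j) a \<in> FTsp w" using gen by (rule FTsp_base)
    show ?case unfolding funpow.simps(2) o_apply Cas_F2[OF E1_FTsp[OF assms(1) m]]
      using Suc m FTsp_K[OF m] by (intro FTsp_closed FTsp_F2 FTsp_T) auto
  qed
qed (auto simp: op_lin intro!: FTsp_closed)

lemma KFTsp_K2: "x \<in> KFTsp w \<Longrightarrow> K2 x \<in> KFTsp w" "x \<in> KFTsp w \<Longrightarrow> K2i x \<in> KFTsp w"
  by (induction rule: KFTsp_ind)
    (auto simp: gen_lin K2_K2z K2i_K2z intro!: KFTsp_closed KFTsp_base)

text \<open>An operator that passes \<open>K2\<close> and \<open>K2i\<close> up to scalars need only
  be tested on \<open>FTsp w\<close>.\<close>

lemma KFTsp_lift: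
  assumes "lin f" "\<And>x. \<exists>c. f (K2 x) = fsc c (K2 (f x))" "\<And>x. \<exists>c. f (K2i x) = fsc c (K2i (f x))"
    "\<And>x. x \<in> FTsp w \<Longrightarrow> f x \<in> KFTsp w" "x \<in> KFTsp w"
  shows "f x \<in> KFTsp w"
  using assms(5)
proof (induction rule: KFTsp_ind)
  case (gen l a)
  have 1: "f ((K2 ^^ n) a) \<in> KFTsp w" for n
  proof (induction n)
    case (Suc n)
    obtain c where "f (K2 ((K2 ^^ n) a)) = fsc c (K2 (f ((K2 ^^ n) a)))" using assms(2) by blast
    then show ?case using Suc by (auto intro!: KFTsp_closed KFTsp_K2)
  qed (use assms(4) gen in auto)
  have 2: "f ((K2i ^^ n) a) \<in> KFTsp w" for n
  proof (induction n)
    case (Suc n)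
    obtain c where "f (K2i ((K2i ^^ n) a)) = fsc c (K2i (f ((K2i ^^ n) a)))" using assms(3) by blast
    then show ?case using Suc by (auto intro!: KFTsp_closed KFTsp_K2)
  qed (use assms(4) gen in auto)
  show ?case using 1 2 by (simp add: K2z_def)
qed (use assms(1) in \<open>auto simp: lin_def lin_zero intro!: KFTsp_closed\<close>)

lemma scale1: "\<exists>c. x = fsc c x" by (rule exI[of _ 1]) simp

lemma KFTsp_K: "x \<in> KFTsp w \<Longrightarrow> K x \<in> KFTsp w" "x \<in> KFTsp w \<Longrightarrow> Ki x \<in> KFTsp w"
  by (rule KFTsp_lift[OF lin_ops(9)], auto simp: KK2 intro: scale1 FTsp_KFTsp FTsp_K[THEN conjunct1])
     (rule KFTsp_lift[OF lin_ops(10)], auto simp: KK2 intro: scale1 FTsp_KFTsp FTsp_K[THEN conjunct2])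

lemma KFTsp_E1: "wh w \<Longrightarrow> x \<in> KFTsp w \<Longrightarrow> E1 x \<in> KFTsp w"
  by (rule KFTsp_lift[OF lin_ops(1)]) (auto simp: EK E1_FTsp intro!: FTsp_KFTsp FTsp_closed)

lemma KFTsp_F2: "x \<in> KFTsp w \<Longrightarrow> F2 x \<in> KFTsp w"
  by (rule KFTsp_lift[OF lin_ops(4)]) (auto intro: FTsp_KFTsp FTsp_F2 K2F2)

lemma KFTsp_K1: "x \<in> KFTsp w \<Longrightarrow> K1 x \<in> KFTsp w" "x \<in> KFTsp w \<Longrightarrow> K1i x \<in> KFTsp w"
  unfolding K1_eq[of x] K1i_eq[of x] by (intro KFTsp_K2 KFTsp_K; assumption)+

text \<open>Here \<open>\<alpha> \<noteq> 0\<close> enters: \<open>E1\<close> acts on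
  \<open>FTsp w\<close> as an invertible scalar, so \<open>F1\<close> can be recovered from
  \<open>F1 E1\<close>, that is, from \<open>Cas\<close>, \<open>K1\<close> and
  \<open>K1i\<close>.\<close>

lemma KFTsp_F1: assumes "wh w" "x \<in> KFTsp w" shows "F1 x \<in> KFTsp w"
proof (rule KFTsp_lift[OF lin_ops(3) _ _ _ assms(2)])
  fix x assume x: "x \<in> FTsp w"
  have "F1 x = fsc (1/\<alpha>) (F1 (E1 x))" using \<alpha>_nz by (simp add: E1_FTsp[OF assms(1) x] gen_lin)
  also have "F1 (E1 x) = Cas x - fsc (q^2*ps^2) (fsc q (K1 x) + fsc qi (K1i x))"
    by (simp add: Cas_def)
  finally show "F1 x \<in> KFTsp w"
    using FTsp_KFTsp[OF x] FTsp_KFTsp[OF FTsp_Cas[OF assms(1) x]] by (auto intro!: KFTsp_closed KFTsp_K1)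
qed (auto intro: K2F1)

lemma KFTsp_E2: assumes "wh w" "x \<in> KFTsp w" shows "E2 x \<in> KFTsp w"
proof (rule KFTsp_lift[OF lin_ops(2) _ _ _ assms(2)])
  fix x assume "x \<in> FTsp w"
  then show "E2 x \<in> KFTsp w"
  proof (induction rule: FTsp_ind)
    case (gen j a)
    show ?case
    proof (induction j)
      case 0
      have "E2 a \<in> KFTsp w" using gen
      proof (induction rule: Tsp_ind)
        case (gen k a)
        show ?case
        proof (cases k)
          case 0
          then show ?thesis using Orb_wh[OF gen assms(1)] by (simp add: wh_def KFTsp_closed)
        next
          case (Suc n)
          show ?thesis unfolding Suc E2_Tn[OF Orb_wh[OF gen assms(1)]]
            by (intro KFTsp_K2 KFTsp_K KFTsp_closed FTsp_KFTsp Tsp_FTsp Tsp_base Orb_hop gen)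
        qed
      qed (auto simp: gen_lin intro!: KFTsp_closed)
      then show ?case by simp
    next
      case (Suc j)
      have m: "(F2 ^^ j) a \<in> FTsp w" using gen by (rule FTsp_base)
      show ?case unfolding funpow.simps(2) o_apply E2F2
        by (intro KFTsp_closed KFTsp_F2 Suc KFTsp_K2 FTsp_KFTsp m)
    qed
  qed (auto simp: gen_lin intro!: KFTsp_closed)
qed (auto intro: EK)

definition "submod S \<longleftrightarrow> fv.subspace S \<and> (\<forall>x\<in>S. E1 x \<in> S \<and> E2 x \<in> S \<and> F1 x \<in> S \<and> F2 x \<in> S \<and>
   K1 x \<in> S \<and> K1i x \<in> S \<and> K2 x \<in> S \<and> K2i x \<in> S)"

definition "Gen w = \<Inter> {S. submod S \<and> w \<in> S}"

lemma submod_KFTsp: "wh w \<Longrightarrow> submod (KFTsp w)"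
  by (auto simp: submod_def KFTsp_subspace KFTsp_E1 KFTsp_E2 KFTsp_F1 KFTsp_F2 KFTsp_K1 KFTsp_K2)

lemma base_Tsp: "w \<in> Tsp w"
  using Tsp_base[OF Orb_base, where k = 0] by simp

lemma Gen_KFTsp: "wh w \<Longrightarrow> Gen w \<subseteq> KFTsp w"
  using submod_KFTsp[of w] base_Tsp[of w] Tsp_FTsp FTsp_KFTsp by (auto simp: Gen_def)

lemma submod_Gen: "submod (Gen w)" and Gen_base: "w \<in> Gen w" and Gen_min: "submod S \<Longrightarrow> w \<in> S \<Longrightarrow> Gen w \<subseteq> S"
  unfolding Gen_def by (auto simp: submod_def fv.subspace_Inter) 

lemma submod_ops:
  assumes "submod S" "x \<in> S"
  shows "K x \<in> S" "Ki x \<in> S" "G x \<in> S" "T x \<in> S" "Cas x \<in> S" "E3 x \<in> S" "del x \<in> S" "K2z l x \<in> S" "(T ^^ n) x \<in> S"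
proof -
  have s: "fv.subspace S" using assms(1) by (simp add: submod_def)
  have ops: "E1 x \<in> S" "E2 x \<in> S" "F1 x \<in> S" "F2 x \<in> S"
     "K1 x \<in> S" "K1i x \<in> S" "K2 x \<in> S" "K2i x \<in> S" if "x \<in> S" for x
    using assms(1) that by (simp_all add: submod_def)
  note I = s[THEN fv.subspace_add] s[THEN fv.subspace_scale] s[THEN fv.subspace_diff]
  have T: "T x \<in> S" if "x \<in> S" for x
    using that by (simp add: K_def Ki_def G_def T_def I ops)
  then show "T x \<in> S" using assms(2) .
  show "K x \<in> S" "Ki x \<in> S" "G x \<in> S" "Cas x \<in> S" "E3 x \<in> S" "del x \<in> S"
    using assms(2) by (simp_all add: K_def Ki_def G_def Cas_def E3_def del_def I ops)
  have n: "(K2 ^^ n) x \<in> S" "(K2i ^^ n) x \<in> S" "(T ^^ n) x \<in> S" for n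
    by (induction n) (simp_all add: ops T assms(2))
  then show "K2z l x \<in> S" "(T ^^ n) x \<in> S" by (simp_all add: K2z_def)
qed

lemma E1_K2z: "E1 x = fsc \<alpha> x \<Longrightarrow> E1 (K2z l x) = fsc (\<alpha> * q powi l) (K2z l x)"
proof -
  assume x: "E1 x = fsc \<alpha> x"
  have 1: "E1 ((K2 ^^ n) x) = fsc (\<alpha> * q ^ n) ((K2 ^^ n) x)" for n
    by (induction n) (auto simp: EK x gen_lin mult_ac)
  have 2: "E1 ((K2i ^^ n) x) = fsc (\<alpha> * qi ^ n) ((K2i ^^ n) x)" for n
    by (induction n) (auto simp: EK x gen_lin mult_ac)
  show ?thesis by (simp add: K2z_def power_int_def 1 2 qi_def)
qed

lemma KFTsp_decomp: assumes "x \<in> KFTsp w"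
  obtains I s where "finite I" "\<And>l. s l \<in> FTsp w" "x = (\<Sum>l\<in>I. K2z l (s l))"
proof -
  from span_UN_decomp[of "\<lambda>l. K2z l ` FTsp w" x] assms obtain I y where
    y: "finite I" "\<forall>l. y l \<in> K2z l ` FTsp w" "x = (\<Sum>l\<in>I. y l)"
    unfolding KFTsp_def by (auto simp: subspace_image lin_K2z FTsp_subspace)
  from y(2) have "\<forall>l. \<exists>s. s \<in> FTsp w \<and> y l = K2z l s" by blast
  from choice[OF this] obtain s where s: "\<And>l. s l \<in> FTsp w" "\<And>l. y l = K2z l (s l)" by blast
  show ?thesis by (rule that[OF y(1) s(1)]) (use y(3) s(2) in simp)
qed

lemma FTsp_decomp: assumes "x \<in> FTsp w"
  obtains n p where "\<And>j. p j \<in> Tsp w" "x = (\<Sum>j<n::nat. (F2 ^^ j) (p j))"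
proof -
  from span_UN_decomp_nat[of "\<lambda>l. (F2 ^^ l) ` Tsp w" x] assms obtain n y where
    y: "\<forall>l. y l \<in> (F2 ^^ l) ` Tsp w" "x = (\<Sum>l<n. y l)"
    unfolding FTsp_def by (auto simp: subspace_image lin_Fn Tsp_subspace)
  from y(1) have "\<forall>l. \<exists>s. s \<in> Tsp w \<and> y l = (F2 ^^ l) s" by blast
  from choice[OF this] obtain s where s: "\<And>l. s l \<in> Tsp w" "\<And>l. y l = (F2 ^^ l) (s l)" by blast
  show ?thesis by (rule that[OF s(1)]) (use y(2) s(2) in simp)
qed

lemma Tsp_decomp: assumes "x \<in> Tsp w"
  obtains n a where "\<And>j. a j \<in> Orb w" "x = (\<Sum>j<n::nat. (T ^^ j) (a j))"
proof -
  from span_UN_decomp_nat[of "\<lambda>l. (T ^^ l) ` Orb w" x] assms obtain n y where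
    y: "\<forall>l. y l \<in> (T ^^ l) ` Orb w" "x = (\<Sum>l<n. y l)"
    unfolding Tsp_def by (auto simp: subspace_image lT Orb_subspace)
  from y(1) have "\<forall>l. \<exists>s. s \<in> Orb w \<and> y l = (T ^^ l) s" by blast
  from choice[OF this] obtain s where s: "\<And>l. s l \<in> Orb w" "\<And>l. y l = (T ^^ l) (s l)" by blast
  show ?thesis by (rule that[OF s(1)]) (use y(2) s(2) in simp)
qed

end

section \<open>Leading terms with respect to lowering operators\<close>

lemma funpow_split: "m \<le> n \<Longrightarrow> (h ^^ n) x = (h ^^ (n - m)) ((h ^^ m) x)"
  by (metis comp_apply funpow_add le_add_diff_inverse2)

lemma eigen_sep0:
  assumes "lin f" "finite I" "\<And>i. i \<in> I \<Longrightarrow> f (x i) = fsc (\<mu> i) (x i)" "inj_on \<mu> I" "(\<Sum>i\<in>I. x i) = 0" "i \<in> I"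
  shows "x i = 0"
  using eigen_sep[OF assms(1-4), of "{0}"] assms(5,6) lin_zero[OF assms(1)] by simp

text \<open>Cutting the sum after its last nonzero term lets an operator that kills the lower terms
  isolate that term.\<close>

lemma sum_top:
  fixes r :: "nat \<Rightarrow> falg"
  assumes "(\<Sum>j<n. r j) \<noteq> 0"
  obtains m where "m < n" "r m \<noteq> 0" "(\<Sum>j<n. r j) = (\<Sum>j<Suc m. r j)"
proof -
  have "\<exists>m<n. r m \<noteq> 0 \<and> (\<Sum>j<n. r j) = (\<Sum>j<Suc m. r j)"
    using assms
  proof (induction n)
    case (Suc n)
    show ?case
    proof (cases "r n = 0")
      case True
      then show ?thesis using Suc by (auto intro: less_SucI)
    next
      case False
      then show ?thesis by auto
    qed
  qed simp
  then show ?thesis using that by blast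
qed

lemma ladder_top:
  assumes "lin D" "\<And>j. j < m \<Longrightarrow> D (r j) = 0"
  shows "D (\<Sum>j<Suc m. r j) = D (r m)"
  using assms(2) by (simp add: lin_add[OF assms(1)] lin_sum[OF assms(1)])

lemma funpow_zero: "lin D \<Longrightarrow> D x = 0 \<Longrightarrow> k > 0 \<Longrightarrow> (D ^^ k) x = 0"
proof (induction k)
  case (Suc k)
  then show ?case by (cases k) (auto simp: lin_zero)
qed simp

context jimbo_whittaker
begin

lemma del_pow: "pv p \<Longrightarrow> (del ^^ j) ((F2 ^^ j) p) = fsc (\<Prod>i<j. \<alpha> * br (Suc i)) p"
proof (induction j)
  case (Suc j)
  have "(del ^^ Suc j) ((F2 ^^ Suc j) p) = (del ^^ j) (del ((F2 ^^ Suc j) p))"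
    by (simp only: funpow_Suc_right o_apply)
  also have "\<dots> = fsc (\<alpha> * br (Suc j)) ((del ^^ j) ((F2 ^^ j) p))"
    unfolding del_Fn[OF Suc.prems] by (rule lin_sc[OF lin_funpow[OF lin_del]])
  finally show ?case by (simp add: Suc mult.commute)
qed simp

lemma del_pow_less: assumes "pv p" "j < m" shows "(del ^^ m) ((F2 ^^ j) p) = 0"
proof -
  have "(del ^^ m) ((F2 ^^ j) p) = (del ^^ (m - j)) ((del ^^ j) ((F2 ^^ j) p))"
    using assms(2) by (intro funpow_split) simp
  also have "\<dots> = 0" using assms
    by (simp add: del_pow lin_sc[OF lin_funpow[OF lin_del]] funpow_zero[OF lin_del] del_def pv_def gen_lin)
  finally show ?thesis .
qed

lemma del_prod_nz: "(\<Prod>i<j. \<alpha> * br (Suc i)) \<noteq> 0"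
  using \<alpha>_nz br_nz by (simp)

text \<open>\<open>m\<close> is the degree in \<open>F2\<close>: \<open>del ^^ m\<close> kills the
  lower terms and turns the top one into a nonzero multiple of its coefficient. The last clause
  serves vectors killed by \<open>del\<close>.\<close>

lemma FTsp_top:
  assumes "wh w" "y \<in> FTsp w" "y \<noteq> 0"
  obtains m p where "p \<in> Tsp w" "p \<noteq> 0" "(del ^^ m) y = p" "m = 0 \<Longrightarrow> p = y"
proof -
  from FTsp_decomp[OF assms(2)] obtain n p where p: "\<And>j. p j \<in> Tsp w" "y = (\<Sum>j<n. (F2 ^^ j) (p j))" by blast
  from sum_top[of "\<lambda>j. (F2 ^^ j) (p j)" n] assms(3) p(2) obtain m where
    m: "(F2 ^^ m) (p m) \<noteq> 0" "y = (\<Sum>j<Suc m. (F2 ^^ j) (p j))" by metis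
  have pv: "pv (p j)" for j by (rule pv_Tsp[OF assms(1) p(1)])
  let ?c = "\<Prod>i<m. \<alpha> * br (Suc i)"
  have "(del ^^ m) y = fsc ?c (p m)"
    unfolding m(2) del_pow[OF pv, symmetric]
    by (rule ladder_top[OF lin_funpow[OF lin_del]]) (rule del_pow_less[OF pv])
  moreover have "p m \<noteq> 0" using m(1) lin_zero[OF lin_Fn] by metis
  ultimately show ?thesis
    using that[of "fsc ?c (p m)" m] del_prod_nz[of m] p(1) Tsp_closed(2) m(2) by auto
qed

text \<open>The eigenvalue of \<open>E1\<close> singles out the part of \<open>x\<close> without
  powers of \<open>K2\<close>; the vanishing of \<open>del x\<close> then forces degree 0 in
  \<open>F2\<close>.\<close>

lemma wh_in_Tsp:
  assumes "wh w" "x \<in> KFTsp w" "E1 x = fsc \<alpha> x" "E3 x = 0"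
  shows "x \<in> Tsp w"
proof -
  from KFTsp_decomp[OF assms(2)] obtain I s where
    s: "finite I" "\<And>l. s l \<in> FTsp w" "x = (\<Sum>l\<in>I. K2z l (s l))" by blast
  \<comment> \<open>Subtracting \<open>x\<close> at index 0 gives eigenvectors with distinct
    eigenvalues and sum zero. The index 0 need not lie in \<open>I\<close>, whence the default
    0.\<close>
  define y where "y l = K2z l (if l \<in> I then s l else 0) - (if l = 0 then x else 0)" for l
  have s0: "(if l \<in> I then s l else 0) \<in> FTsp w" for l using s(2) FTsp_closed(3) by auto
  have "(\<Sum>l\<in>insert 0 I. y l) = (\<Sum>l\<in>insert 0 I. K2z l (if l \<in> I then s l else 0)) - (\<Sum>l\<in>insert 0 I. if l = 0 then x else 0)"
    unfolding y_def by (rule sum_subtractf)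
  also have "(\<Sum>l\<in>insert 0 I. if l = 0 then x else 0) = x" using s(1) by (subst sum.delta) auto
  also have "(\<Sum>l\<in>insert 0 I. K2z l (if l \<in> I then s l else 0)) = (\<Sum>l\<in>I. K2z l (if l \<in> I then s l else 0))"
    using s(1) by (intro sum.mono_neutral_right) (auto simp: lin_zero[OF lin_K2z])
  also have "\<dots> = x" unfolding s(3) by (intro sum.cong) auto
  finally have y0: "(\<Sum>l\<in>insert 0 I. y l) = 0" by simp
  have y1: "E1 (y l) = fsc (\<alpha> * q powi l) (y l)" for l
    unfolding y_def using E1_K2z[OF E1_FTsp[OF assms(1) s0]] assms(3) by (auto simp: gen_lin fv.scale_right_diff_distrib)
  have y2: "inj_on (\<lambda>l. \<alpha> * q powi l) (insert 0 I)"
    using \<alpha>_nz q_powi_inj by (intro inj_onI) simp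
  have "y 0 = 0"
    by (rule eigen_sep0[OF lin_ops(1) _ y1 y2 y0]) (use s(1) in auto)
  then have "x = (if 0 \<in> I then s 0 else 0)" by (simp add: y_def)
  then have x: "x \<in> FTsp w" using s0 by simp
  show ?thesis
  proof (cases "x = 0")
    case True
    then show ?thesis using Tsp_closed(3) by simp
  next
    case False
    from FTsp_top[OF assms(1) x False] obtain m p where p: "p \<in> Tsp w" "p \<noteq> 0" "(del ^^ m) x = p" "m = 0 \<Longrightarrow> p = x" by blast
    have "del x = 0" using assms(4) by (simp add: del_def gen_lin)
    then have "m = 0" using p(2,3) funpow_zero[OF lin_del] by (metis gr0I)
    with p show ?thesis by simp
  qed
qed

lemma submod_sub: "submod S \<Longrightarrow> fv.subspace S"
  by (simp add: submod_def)

text \<open>\<open>S\<close> contains the \<open>E1\<close>-components of its elements; a nonzero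
  component, freed of its power of \<open>K2\<close>, is lowered into \<open>Tsp w\<close> by
  \<open>del\<close>.\<close>

lemma top_Tsp:
  assumes "wh w" "submod S" "x \<in> S" "x \<in> KFTsp w" "x \<noteq> 0"
  obtains y where "y \<in> S" "y \<in> Tsp w" "y \<noteq> 0"
proof -
  from KFTsp_decomp[OF assms(4)] obtain I s where
    s: "finite I" "\<And>l. s l \<in> FTsp w" "x = (\<Sum>l\<in>I. K2z l (s l))" by blast
  have "inj_on (\<lambda>l. \<alpha> * q powi l) I"
    using \<alpha>_nz q_powi_inj by (auto simp: inj_on_def)
  then have 1: "\<forall>l\<in>I. K2z l (s l) \<in> S"
    using s(1,3) assms(2,3) E1_K2z[OF E1_FTsp[OF assms(1) s(2)]]
    by (intro eigen_sep[OF lin_ops(1)]) (auto simp: submod_def)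
  from assms(5) s(3) obtain l where l: "l \<in> I" "K2z l (s l) \<noteq> 0" by (metis sum.neutral)
  have "s l \<in> S" using submod_ops(8)[OF assms(2) bspec[OF 1 l(1)], of "- l"] by (simp add: K2z_inv)
  moreover have "s l \<noteq> 0" using l(2) lin_zero[OF lin_K2z] by metis
  ultimately obtain m p where p: "p \<in> Tsp w" "p \<noteq> 0" "(del ^^ m) (s l) = p"
    using FTsp_top[OF assms(1) s(2)] by metis
  have "(del ^^ m) (s l) \<in> S"
    using \<open>s l \<in> S\<close> submod_ops(7)[OF assms(2)] by (induction m) auto
  with p that show ?thesis by blast
qed

section \<open>Simple modules\<close>

text \<open>\<open>E2\<close> with the factor \<open>K2 Ki\<close> of \<open>E2_Tn\<close> stripped
  off: it lowers the power of \<open>T\<close> as \<open>del\<close> lowers that of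
  \<open>F2\<close>.\<close>

definition "eps x = K (K2i (E2 x))"

lemma lin_eps: "lin eps"
  by (auto simp: lin_def eps_def gen_lin)

lemma eps_T: "wh a \<Longrightarrow> eps ((T ^^ Suc n) a) = fsc (be (Suc n)) ((T ^^ n) (hop (Suc n) a))"
  unfolding eps_def E2_Tn by (simp only: K2K2i KKi)

text \<open>The composite \<open>hop 1 (... (hop n a))\<close>, which for a Whittaker vector
  \<open>a\<close> is what \<open>eps ^^ n\<close> leaves of \<open>(T ^^ n) a\<close>, up to a
  nonzero scalar.\<close>

fun HH :: "nat \<Rightarrow> falg \<Rightarrow> falg" where
  "HH 0 a = a"
| "HH (Suc n) a = HH n (hop (Suc n) a)"

lemma lin_HH: "lin (HH n)"
proof (induction n)
  case (Suc n)
  have "HH (Suc n) = (\<lambda>a. HH n (hop (Suc n) a))" by (simp add: fun_eq_iff)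
  then show ?case using lin_comp[OF Suc lin_hop] by simp
qed (simp add: lin_def)

lemma wh_HH: "wh a \<Longrightarrow> wh (HH n a)"
  by (induction n arbitrary: a) (auto intro: wh_hop)

lemma eps_pow: "wh a \<Longrightarrow> (eps ^^ j) ((T ^^ j) a) = fsc (\<Prod>i<j. be (Suc i)) (HH j a)"
proof (induction j arbitrary: a)
  case (Suc j)
  have "(eps ^^ Suc j) ((T ^^ Suc j) a) = (eps ^^ j) (eps ((T ^^ Suc j) a))"
    by (simp only: funpow_Suc_right o_apply)
  also have "\<dots> = fsc (be (Suc j)) ((eps ^^ j) ((T ^^ j) (hop (Suc j) a)))"
    unfolding eps_T[OF Suc.prems] by (rule lin_sc[OF lin_funpow[OF lin_eps]])
  finally show ?case using wh_hop[OF Suc.prems] by (simp add: Suc mult.commute)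
qed simp

lemma eps_pow_less: assumes "wh p" "j < m" shows "(eps ^^ m) ((T ^^ j) p) = 0"
proof -
  have "(eps ^^ m) ((T ^^ j) p) = (eps ^^ (m - j)) ((eps ^^ j) ((T ^^ j) p))"
    using assms(2) by (intro funpow_split) simp
  also have "\<dots> = 0"
  proof (rule funpow_zero[OF lin_eps])
    have "eps (HH j p) = 0" unfolding eps_def whD(2)[OF wh_HH[OF assms(1)]] gen_lin ..
    then show "eps ((eps ^^ j) ((T ^^ j) p)) = 0"
      unfolding eps_pow[OF assms(1)] by (simp add: lin_sc[OF lin_eps])
  qed (use assms(2) in simp)
  finally show ?thesis .
qed

lemma be_prod_nz: "(\<Prod>i<j. be (Suc i)) \<noteq> 0"
  using be_nz by simp

text \<open>The analogue of \<open>FTsp_top\<close> for \<open>eps\<close>, except that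
  \<open>HH m a\<close> may vanish although \<open>(T ^^ m) a\<close> does not. This is where
  critical parameters come in.\<close>

lemma Tsp_top:
  assumes "wh w" "y \<in> Tsp w" "y \<noteq> 0"
  obtains m a c where "a \<in> Orb w" "(T ^^ m) a \<noteq> 0" "c \<noteq> 0" "(eps ^^ m) y = fsc c (HH m a)" "m = 0 \<Longrightarrow> y = a"
proof -
  from Tsp_decomp[OF assms(2)] obtain n a where p: "\<And>j. a j \<in> Orb w" "y = (\<Sum>j<n. (T ^^ j) (a j))" by blast
  from sum_top[of "\<lambda>j. (T ^^ j) (a j)" n] assms(3) p(2) obtain m where
    m: "(T ^^ m) (a m) \<noteq> 0" "y = (\<Sum>j<Suc m. (T ^^ j) (a j))" by metis
  have pv: "wh (a j)" for j by (rule Orb_wh[OF p(1) assms(1)])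
  let ?c = "\<Prod>i<m. be (Suc i)"
  have "(eps ^^ m) y = fsc ?c (HH m (a m))"
    unfolding m(2) eps_pow[OF pv, symmetric]
    by (rule ladder_top[OF lin_funpow[OF lin_eps]]) (rule eps_pow_less[OF pv])
  then show ?thesis
    using that[of "a m" m ?c] be_prod_nz[of m] p(1) m by auto
qed

lemma eps_Gen: "submod S \<Longrightarrow> x \<in> S \<Longrightarrow> (eps ^^ m) x \<in> S"
proof (induction m)
  case (Suc m)
  have eps: "eps y \<in> S" if "y \<in> S" for y
    unfolding eps_def using that Suc.prems(1) by (intro submod_ops(1)[OF Suc.prems(1)]) (simp add: submod_def)
  from Suc have "(eps ^^ m) x \<in> S" by simp
  then show ?case by (simp add: eps)
qed simp

definition "joint \<kappa> c v \<longleftrightarrow> wh v \<and> v \<noteq> 0 \<and> K v = fsc \<kappa> v \<and> Cas v = fsc c v"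

lemma joint_kappa: "joint \<kappa> c v \<Longrightarrow> \<kappa> \<noteq> 0"
proof
  assume j: "joint \<kappa> c v" "\<kappa> = 0"
  then have "K v = 0" by (simp add: joint_def)
  then have "Ki (K v) = 0" by (simp only: gen_lin)
  with j(1) show False by (simp only: KKi) (simp add: joint_def)
qed

lemma joint_Ki: "joint \<kappa> c v \<Longrightarrow> Ki v = fsc (1/\<kappa>) v"
proof -
  assume j: "joint \<kappa> c v"
  then have "Ki (K v) = fsc \<kappa> (Ki v)" by (simp add: joint_def gen_lin)
  then have v: "v = fsc \<kappa> (Ki v)" by (simp only: KKi)
  have "fsc (1/\<kappa>) v = fsc (1/\<kappa>) (fsc \<kappa> (Ki v))" using v by (rule arg_cong)
  then show ?thesis using joint_kappa[OF j] by simp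
qed

lemma joint_hop: "joint \<kappa> c v \<Longrightarrow> hop n v = fsc (hfun q n \<kappa> c) v"
proof -
  assume j: "joint \<kappa> c v"
  have "q powi (3 - 2 * int n) = q^3 * (qi^n)^2"
    using q_nz by (simp add: power_int_diff qi_def power_int_mult field_simps)
  moreover have "q powi (2 * int n - 3) = (q^n)^2 * qi^3"
    using q_nz by (simp add: power_int_diff qi_def power_int_mult field_simps)
  ultimately show ?thesis
    using j joint_Ki[OF j] unfolding hop_def hfun_def joint_def
    by (simp add: qi_def divide_inverse fv.scale_left_diff_distrib fv.scale_left_distrib)
qed

lemma joint_A: "a \<in> Orb v \<Longrightarrow> joint \<kappa> c v \<Longrightarrow> \<exists>t. a = fsc t v"
proof (induction rule: Orb.induct)
  case Orb_base
  show ?case by (rule exI[of _ 1]) simp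
next
  case Orb_zero
  show ?case by (rule exI[of _ 0]) simp
next
  case (Orb_add x y)
  then obtain s t where "x = fsc s v" "y = fsc t v" by auto
  then show ?case by (intro exI[of _ "s + t"]) (simp add: fv.scale_left_distrib)
next
  case (Orb_sc x c)
  then show ?case by auto
next
  case (Orb_K x)
  then show ?case by (auto simp: gen_lin joint_def)
next
  case (Orb_Ki x)
  then show ?case using joint_Ki by (auto simp: gen_lin)
next
  case (Orb_Cas x)
  then show ?case by (auto simp: op_lin joint_def)
qed

lemma joint_HH: "joint \<kappa> c v \<Longrightarrow> HH n v = fsc (\<Prod>i<n. hfun q (Suc i) \<kappa> c) v"
  by (induction n) (simp_all add: joint_hop lin_sc[OF lin_HH] mult.commute)

definition "simple v \<longleftrightarrow> (\<forall>x\<in>Gen v. x \<noteq> 0 \<longrightarrow> v \<in> Gen x)"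

text \<open>A nonzero vector is lowered into \<open>Tsp v\<close> and from there by
  \<open>eps ^^ m\<close> to a multiple of \<open>v\<close>. The scalar is nonzero because its
  factors \<open>hfun q i \<kappa> c\<close> have \<open>i \<le> m\<close>, while
  \<open>(T ^^ m) v\<close> is nonzero.\<close>

lemma joint_simple:
  assumes j: "joint \<kappa> c v" and h: "\<And>n i. (T ^^ n) v \<noteq> 0 \<Longrightarrow> 1 \<le> i \<Longrightarrow> i \<le> n \<Longrightarrow> hfun q i \<kappa> c \<noteq> 0"
  shows "simple v"
  unfolding simple_def
proof (intro ballI impI)
  fix x assume x: "x \<in> Gen v" "x \<noteq> 0"
  have wv: "wh v" using j by (simp add: joint_def)
  have "x \<in> KFTsp v" using x(1) Gen_KFTsp[OF wv] by blast
  from top_Tsp[OF wv submod_Gen Gen_base this x(2)] obtain y where y: "y \<in> Gen x" "y \<in> Tsp v" "y \<noteq> 0" .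
  from Tsp_top[OF wv y(2,3)] obtain m a b where a: "a \<in> Orb v" "(T ^^ m) a \<noteq> 0" "b \<noteq> 0" "(eps ^^ m) y = fsc b (HH m a)" by metis
  from joint_A[OF a(1) j] obtain t where t: "a = fsc t v" by blast
  have Tv: "(T ^^ m) v \<noteq> 0" "t \<noteq> 0" using a(2) by (auto simp: t Tn_lin)
  have "(eps ^^ m) y = fsc (b * t * (\<Prod>i<m. hfun q (Suc i) \<kappa> c)) v"
    unfolding a(4) t lin_sc[OF lin_HH] joint_HH[OF j] by (simp add: mult_ac)
  moreover have "b * t * (\<Prod>i<m. hfun q (Suc i) \<kappa> c) \<noteq> 0" (is "?d \<noteq> 0")
    using a(3) Tv h[OF Tv(1)] by auto
  ultimately have "v = fsc (1 / ?d) ((eps ^^ m) y)" by simp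
  also have "\<dots> \<in> Gen x"
    by (rule fv.subspace_scale[OF submod_sub[OF submod_Gen] eps_Gen[OF submod_Gen y(1)]])
  finally show "v \<in> Gen x" .
qed

lemma Orb_weight: "a \<in> Orb y \<Longrightarrow> K y = fsc \<mu> y \<Longrightarrow> K a = fsc \<mu> a"
proof (induction rule: Orb.induct)
  case (Orb_Ki x)
  then have "Ki (K x) = fsc \<mu> (Ki x)" by (simp add: gen_lin)
  then show ?case by (simp add: KKi)
next
  case (Orb_Cas x)
  then show ?case by (metis Cas_K(1) lin_Cas lin_sc)
qed (auto simp: gen_lin fv.scale_right_distrib mult.commute)

text \<open>Each \<open>T\<close> multiplies the weight of \<open>K\<close> by \<open>qi^3\<close>,
  and these weights are pairwise distinct, so only one term of the expansion can contribute.\<close>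

lemma Tsp_weight:
  assumes "z \<in> Tsp y" "K y = fsc \<mu> y" "\<mu> \<noteq> 0" "K z = fsc (\<mu> * qi^(3*j)) z"
  shows "\<exists>a\<in>Orb y. z = (T ^^ j) a"
proof -
  from Tsp_decomp[OF assms(1)] obtain n a where p: "\<And>j. a j \<in> Orb y" "z = (\<Sum>j<n. (T ^^ j) (a j))" by blast
  define a' where "a' i = (if i < n then a i else 0)" for i
  have a': "a' i \<in> Orb y" for i using p(1) Orb_zero by (simp add: a'_def)
  define r where "r i = (T ^^ i) (a' i) - (if i = j then z else 0)" for i
  \<comment> \<open>\<open>N\<close> exceeds \<open>j\<close>, so that the index carrying
    \<open>z\<close> occurs even when the expansion stops earlier.\<close>
  define N where "N = max n (Suc j)"
  have "(\<Sum>i<N. r i) = (\<Sum>i<N. (T ^^ i) (a' i)) - (\<Sum>i<N. if i = j then z else 0)"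
    unfolding r_def by (rule sum_subtractf)
  also have "(\<Sum>i<N. if i = j then z else 0) = z" by (subst sum.delta) (auto simp: N_def)
  also have "(\<Sum>i<N. (T ^^ i) (a' i)) = (\<Sum>i<n. (T ^^ i) (a' i))"
    by (intro sum.mono_neutral_right) (auto simp: Tn_lin N_def a'_def)
  also have "\<dots> = z" unfolding p(2) by (intro sum.cong) (auto simp: a'_def)
  finally have r0: "(\<Sum>i<N. r i) = 0" by simp
  have r1: "K (r i) = fsc (\<mu> * qi^(3*i)) (r i)" for i
    unfolding r_def using assms(4) Orb_weight[OF a' assms(2)]
    by (auto simp: gen_lin K_Tn Tn_lin fv.scale_right_diff_distrib mult.commute power_mult power_commutes simp flip: power_mult)
  have r2: "inj_on (\<lambda>i. \<mu> * qi^(3*i)) {..<N}"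
    using assms(3) by (auto intro!: inj_onI dest!: qi_pow_inj)
  have "r j = 0" by (rule eigen_sep0[OF lin_ops(9) _ r1 r2 r0]) (auto simp: N_def)
  then show ?thesis using a'[of j] by (auto simp: r_def)
qed

lemma Tsp_weight_zero:
  assumes "z \<in> Tsp y" "K y = fsc \<mu> y" "K z = fsc \<nu> z" "\<And>i. \<nu> \<noteq> \<mu> * qi^(3*i)" "\<mu> \<noteq> 0"
  shows "z = 0"
proof -
  from Tsp_decomp[OF assms(1)] obtain n a where p: "\<And>j. a j \<in> Orb y" "z = (\<Sum>j<n. (T ^^ j) (a j))" by blast
  \<comment> \<open>\<open>- z\<close> is appended at index \<open>n\<close> as one more
    eigenvector, with a weight different from the others.\<close>
  define r where "r i = (if i < n then (T ^^ i) (a i) else - z)" for i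
  define w where "w i = (if i < n then \<mu> * qi^(3*i) else \<nu>)" for i
  have "(\<Sum>i<Suc n. r i) = (\<Sum>i<n. (T ^^ i) (a i)) - z"
    unfolding r_def by simp
  then have r0: "(\<Sum>i<Suc n. r i) = 0" using p(2) by simp
  have r1: "K (r i) = fsc (w i) (r i)" for i
    unfolding r_def w_def using assms(3) Orb_weight[OF p(1) assms(2)]
    by (auto simp: gen_lin K_Tn Tn_lin mult.commute simp flip: power_mult)
  have r2: "inj_on w {..<Suc n}"
  proof (rule inj_onI)
    fix i j assume ij: "i \<in> {..<Suc n}" "j \<in> {..<Suc n}" "w i = w j"
    show "i = j"
    proof (cases "i < n \<and> j < n")
      case True
      with ij(3) assms(5) have "qi ^ (3*i) = qi ^ (3*j)" by (simp add: w_def)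
      then show ?thesis using qi_pow_inj by fastforce
    next
      case False
      then show ?thesis using ij assms(4)[of i] assms(4)[of j] by (auto simp: w_def split: if_splits)
    qed
  qed
  have "r n = 0" by (rule eigen_sep0[OF lin_ops(9) _ r1 r2 r0]) auto
  then show ?thesis by (auto simp: r_def)
qed

text \<open>By simplicity \<open>x\<close> generates \<open>v\<close> and with it \<open>w\<close>,
  which \<open>wh_in_Tsp\<close> then locates.\<close>

lemma simple_swap:
  assumes "simple v" "x \<in> Gen v" "x \<noteq> 0" "w \<in> Gen v" "wh x" "wh w"
  shows "w \<in> Tsp x"
proof -
  have "v \<in> Gen x" using assms by (auto simp: simple_def)
  then have "w \<in> Gen x" using assms(4) Gen_min[OF submod_Gen] by blast
  then have "w \<in> KFTsp x" using Gen_KFTsp[OF assms(5)] by blast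
  then show ?thesis using wh_in_Tsp[OF assms(5)] whD[OF assms(6)] by blast
qed

lemma T_Gen: "x \<in> Gen v \<Longrightarrow> (T ^^ n) x \<in> Gen v"
  by (rule submod_ops(9)[OF submod_Gen])

lemma wh_Tn: "wh a \<Longrightarrow> hop (Suc n) a = 0 \<Longrightarrow> wh ((T ^^ Suc n) a)"
  unfolding wh_def by (auto simp: E1_Tn[of _ "Suc n", simplified] E2_Tn[unfolded wh_def, of _ n, simplified] Tn_lin gen_lin)

text \<open>Otherwise \<open>(T ^^ n) w\<close> is a nonzero Whittaker vector from which
  \<open>w\<close> can be expanded. But its weight is already \<open>\<kappa> * qi^(3*n)\<close>,
  and further powers of \<open>T\<close> never lead back to \<open>\<kappa>\<close>.\<close>

lemma singular_power_zero:
  assumes "simple v" "w \<in> Gen v" "joint \<kappa> c w" "n \<ge> 1" "hfun q n \<kappa> c = 0"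
  shows "(T ^^ n) w = 0"
proof (rule ccontr)
  assume nz: "(T ^^ n) w \<noteq> 0"
  obtain k where k: "n = Suc k" using assms(4) by (cases n) auto
  have w: "wh w" "K w = fsc \<kappa> w" "w \<noteq> 0" using assms(3) by (auto simp: joint_def)
  have "hop n w = 0" using joint_hop[OF assms(3)] assms(5) by simp
  then have "wh ((T ^^ n) w)" using wh_Tn w(1) k by blast
  from simple_swap[OF assms(1) T_Gen[OF assms(2)] nz assms(2) this w(1)]
  have "w \<in> Tsp ((T ^^ n) w)" .
  moreover have "K ((T ^^ n) w) = fsc (\<kappa> * qi^(3*n)) ((T ^^ n) w)"
    by (simp add: K_Tn w Tn_lin mult.commute flip: power_mult)
  moreover have "\<kappa> \<noteq> \<kappa> * qi^(3*n) * qi^(3*i)" for i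
    using joint_kappa[OF assms(3)] qi_pow_inj[of 0 "3*n+3*i"] assms(4) by (auto simp: power_add)
  moreover have "\<kappa> * qi^(3*n) \<noteq> 0" using joint_kappa[OF assms(3)] qi(3) by simp
  ultimately have "w = 0"
    using Tsp_weight_zero[OF _ _ w(2)] by blast
  with w(3) show False by simp
qed

end

section \<open>Polynomials in one operator and in two commuting operators\<close>

definition pev :: "(falg \<Rightarrow> falg) \<Rightarrow> complex poly \<Rightarrow> falg \<Rightarrow> falg" where
  "pev f p x = fold_coeffs (\<lambda>a y. fsc a x + f y) p 0"

lemma pev_0 [simp]: "pev f 0 x = 0"
  by (simp add: pev_def)

lemma pev_pCons: assumes "lin f" shows "pev f (pCons a p) x = fsc a x + f (pev f p x)"
  by (cases "a = 0 \<and> p = 0") (auto simp: pev_def lin_zero[OF assms] fold_coeffs_pCons_eq)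

lemma pev_add: assumes "lin f" shows "pev f (p + r) x = pev f p x + pev f r x"
proof (induction p r rule: poly_induct2)
  case (pCons a p b r)
  then show ?case by (simp add: pev_pCons[OF assms] lin_add[OF assms] fv.scale_left_distrib)
qed simp

lemma pev_smult: assumes "lin f" shows "pev f (smult c p) x = fsc c (pev f p x)"
  by (induction p) (auto simp: pev_pCons[OF assms] lin_sc[OF assms] fv.scale_right_distrib)

lemma pev_mult: assumes "lin f" shows "pev f (p * r) x = pev f p (pev f r x)"
proof (induction p)
  case (pCons a p)
  then show ?case
    by (simp add: pev_add[OF assms] pev_smult[OF assms] pev_pCons[OF assms])
qed simp

lemma lin_pev: assumes "lin f" shows "lin (pev f p)"
proof -
  have "pev f p (x + y) = pev f p x + pev f p y" for x y
    by (induction p) (auto simp: pev_pCons[OF assms] lin_add[OF assms] fv.scale_right_distrib)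
  moreover have "pev f p (fsc c x) = fsc c (pev f p x)" for c x
    by (induction p) (auto simp: pev_pCons[OF assms] lin_sc[OF assms] fv.scale_right_distrib mult.commute)
  ultimately show ?thesis by (simp add: lin_def)
qed

lemma pev_comm: assumes "lin f" "lin g" "\<And>x. f (g x) = g (f x)" shows "pev f p (g x) = g (pev f p x)"
  by (induction p) (auto simp: pev_pCons[OF assms(1)] assms(3) lin_zero[OF assms(2)] lin_add[OF assms(2)] lin_sc[OF assms(2)])

lemma pev_factor:
  assumes "lin f" "degree p = Suc d"
  obtains r p' where "degree p' = d" "p' \<noteq> 0" "\<And>x. pev f p x = f (pev f p' x) - fsc r (pev f p' x)"
proof -
  have "\<not> constant (poly p)" using assms(2) by (simp add: constant_degree)
  then obtain r where "poly p r = 0" using fundamental_theorem_of_algebra by blast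
  then obtain p' where p': "p = [:- r, 1:] * p'" by (auto simp: poly_eq_0_iff_dvd)
  have "p' \<noteq> 0" using assms(2) p' by auto
  moreover from this have "degree p' = d" using assms(2) unfolding p' by (subst (asm) degree_mult_eq) auto
  moreover have "pev f p x = f (pev f p' x) - fsc r (pev f p' x)" for x
    unfolding p' pev_mult[OF assms(1)] by (simp add: pev_pCons[OF assms(1)] lin_zero[OF assms(1)])
  ultimately show ?thesis using that by blast
qed

text \<open>Linear factors are split off until the remaining polynomial no longer kills
  \<open>w\<close>; the last factor removed gives the eigenvalue.\<close>

lemma pev_eigen:
  assumes "lin f" "pev f p w = 0" "p \<noteq> 0" "w \<noteq> 0"
  shows "\<exists>r p'. pev f p' w \<noteq> 0 \<and> f (pev f p' w) = fsc r (pev f p' w)"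
  using assms(2,3)
proof (induction "degree p" arbitrary: p)
  case 0
  then obtain a where "p = [:a:]" "a \<noteq> 0" by (metis degree_eq_zeroE pCons_0_0)
  with 0 assms(4) show ?case by (simp add: pev_pCons[OF assms(1)] lin_zero[OF assms(1)])
next
  case (Suc d)
  from pev_factor[OF assms(1) Suc(2)[symmetric]] obtain r p' where
    p: "degree p' = d" "p' \<noteq> 0" "\<And>x. pev f p x = f (pev f p' x) - fsc r (pev f p' x)" by metis
  show ?case
  proof (cases "pev f p' w = 0")
    case True
    then show ?thesis using Suc(1)[of p'] p by simp
  next
    case False
    then show ?thesis using p(3)[of w] Suc.prems by auto
  qed
qed

text \<open>Evaluation of a polynomial in the outer variable \<open>g\<close> and the inner variable \<open>f\<close>.\<close>
definition pev2 :: "(falg \<Rightarrow> falg) \<Rightarrow> (falg \<Rightarrow> falg) \<Rightarrow> complex poly poly \<Rightarrow> falg \<Rightarrow> falg" where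
  "pev2 f g p x = fold_coeffs (\<lambda>a y. pev f a x + g y) p 0"

lemma pev2_0 [simp]: "pev2 f g 0 x = 0"
  by (simp add: pev2_def)

context
  fixes f g :: "falg \<Rightarrow> falg"
  assumes f: "lin f" and g: "lin g" and fg: "\<And>x. f (g x) = g (f x)"
begin

lemma pev2_pCons: "pev2 f g (pCons a p) x = pev f a x + g (pev2 f g p x)"
  by (cases "a = 0 \<and> p = 0") (auto simp: pev2_def lin_zero[OF g] fold_coeffs_pCons_eq)

lemma pev2_add: "pev2 f g (p + r) x = pev2 f g p x + pev2 f g r x"
proof (induction p r rule: poly_induct2)
  case (pCons a p b r)
  then show ?case by (simp add: pev2_pCons lin_add[OF g] pev_add[OF f])
qed simp

lemma pev2_smult: "pev2 f g (smult c p) x = pev f c (pev2 f g p x)"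
  by (induction p) (auto simp: pev2_pCons lin_zero[OF lin_pev[OF f]] lin_add[OF lin_pev[OF f]] pev_mult[OF f] pev_comm[OF f g fg])

lemma pev2_mult: "pev2 f g (p * r) x = pev2 f g p (pev2 f g r x)"
proof (induction p)
  case (pCons a p)
  then show ?case by (simp add: pev2_add pev2_smult pev2_pCons)
qed simp

lemma pev2_diff: "pev2 f g (p - r) x = pev2 f g p x - pev2 f g r x"
  using pev2_add[of "p - r" r x] by simp

lemma lin_pev2: "lin (pev2 f g p)"
proof -
  have "pev2 f g p (x + y) = pev2 f g p x + pev2 f g p y" for x y
    by (induction p) (auto simp: pev2_pCons lin_add[OF g] lin_add[OF lin_pev[OF f]])
  moreover have "pev2 f g p (fsc c x) = fsc c (pev2 f g p x)" for c x
    by (induction p) (auto simp: pev2_pCons lin_sc[OF g] lin_sc[OF lin_pev[OF f]] fv.scale_right_distrib)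
  ultimately show ?thesis by (simp add: lin_def)
qed

end

lemma poly_poly_map: "poly (poly g [:x:]) l = poly (map_poly (\<lambda>p. poly p l) g) x"
  by (induction g) (auto simp: map_poly_pCons)

text \<open>For \<open>g\<close> in \<open>J\<close> of minimal degree in the outer variable and \<open>l\<close> not a root of its leading coefficient,
  setting the inner variable to \<open>l\<close> keeps \<open>g\<close> nonconstant, but turns a pseudo-multiple of it
  into a nonzero constant.\<close>

lemma ideal_contra:
  fixes J :: "complex poly poly set"
  assumes J_diff: "\<And>a b. a \<in> J \<Longrightarrow> b \<in> J \<Longrightarrow> a - b \<in> J" and J_mult: "\<And>a b. a \<in> J \<Longrightarrow> b * a \<in> J"
    and const: "\<And>a. [:a:] \<in> J \<Longrightarrow> a = 0"
    and unit: "\<And>l. \<exists>s f. [:monom 1 s:] - f * [:[:- l, 1:]:] \<in> J"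
  shows False
proof (cases "J \<subseteq> {0}")
  case True
  \<comment> \<open>If \<open>J\<close> is zero, \<open>monom 1 s\<close> is a multiple of
    \<open>X - 1\<close>, which fails at \<open>X = 1\<close>.\<close>
  then obtain s f where "[:monom 1 s:] - f * [:[:- 1, 1:]:] = (0 :: complex poly poly)" using unit[of 1] by blast
  then have "poly (poly ([:monom 1 s:] - f * [:[:- 1, 1:]:]) 0) (1::complex) = 0" by simp
  then show False by (simp add: poly_monom)
next
  case False
  define g where "g = arg_min degree (\<lambda>g. g \<in> J \<and> g \<noteq> 0)"
  have g: "g \<in> J" "g \<noteq> 0" and gmin: "\<And>r. r \<in> J \<Longrightarrow> r \<noteq> 0 \<Longrightarrow> degree g \<le> degree r"
    using arg_min_nat_lemma[of "\<lambda>g. g \<in> J \<and> g \<noteq> 0" _ degree] False unfolding g_def by auto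
  have dg: "degree g > 0"
  proof (rule ccontr)
    assume "\<not> degree g > 0"
    then obtain a where "g = [:a:]" by (meson degree_eq_zeroE gr_zeroI)
    with g const show False by auto
  qed
  let ?a = "lead_coeff g"
  \<comment> \<open>The factor \<open>[:0,1:]\<close> keeps \<open>l\<close> away from 0, because
    the final evaluation yields a multiple of \<open>l^s\<close>.\<close>
  have "?a * [:0,1:] \<noteq> 0" using g(2) by auto
  then have "finite {x. poly (?a * [:0,1:]) x = 0}" by (rule poly_roots_finite)
  then obtain l where "l \<notin> {x. poly (?a * [:0,1:]) x = 0}" using ex_new_if_finite[OF infinite_UNIV_char_0] by blast
  then have l: "poly ?a l \<noteq> 0" "l \<noteq> 0" by auto
  obtain s f where sf: "[:monom 1 s:] - f * [:[:- l, 1:]:] \<in> J" using unit by blast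
  define H where "H = [:monom 1 s:] - f * [:[:- l, 1:]:]"
  \<comment> \<open>Pseudo-division, as the coefficients form only a polynomial ring. The remainder
    lies in \<open>J\<close>, so the minimality of \<open>degree g\<close> makes it zero.\<close>
  obtain b r where br: "pseudo_divmod H g = (b, r)" by fastforce
  define e where "e = Suc (degree H) - degree g"
  from pseudo_divmod[OF g(2) br] have H: "smult (?a ^ e) H = g * b + r" "r = 0 \<or> degree r < degree g"
    by (auto simp: e_def)
  have r: "r = [:?a ^ e:] * H - b * g" using H(1) by (simp add: mult.commute)
  have "H \<in> J" using sf by (simp only: H_def)
  then have "r \<in> J" unfolding r by (intro J_diff J_mult g(1))
  with H(2) gmin[of r] have "r = 0" by force
  let ?\<phi> = "map_poly (\<lambda>p. poly p l)"
  have "degree (?\<phi> g) = degree g"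
    by (rule map_poly_degree_eq) (use l(1) in simp)
  then have "\<not> constant (poly (?\<phi> g))" using dg by (simp add: constant_degree)
  then obtain x where "poly (?\<phi> g) x = 0" using fundamental_theorem_of_algebra by blast
  then have "poly (poly g [:x:]) l = 0" by (simp add: poly_poly_map)
  then have "poly (poly (smult (?a ^ e) H) [:x:]) l = 0" using H(1) \<open>r = 0\<close> by simp
  then show False using l by (simp add: H_def poly_monom)
qed

text \<open>The coefficients of \<open>K\<close> and \<open>Ki\<close> in
  \<open>hop_reflect\<close>, where \<open>Q\<close> is \<open>q^n\<close>, \<open>R\<close> its
  inverse and \<open>M\<close> a power of \<open>qi\<close> or of \<open>q\<close>.\<close>

lemma reflect_coeffs:
  fixes q qi ps Q R M :: complex
  assumes "q * qi = 1" "ps * (q^2 - 1) = 1" "Q * R = 1"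
  shows "q^3*(M^2 - Q^2) * R^3 = q^3*M^2*R^3
      - (q-qi)^2 * (R * (q^2*ps^2) * (q^3*R^2) + q^5*ps^2*(R - R^3))"
    and "qi^3*(M^2 - R^2) * Q^3 = M^2*qi^3*Q^3 - (q-qi)^2 * (R * (q^2*ps^2) * (Q^2*qi^3))"
proof -
  have pp: "(q-qi)^2*(q^2*ps^2) = 1" using assms by algebra
  have Q1: "Q^2*R^3 = R" and Q2: "R^2*Q^3 = Q" and Q3: "R * Q^2 = Q"
    using assms(3) by (algebra, algebra, algebra)
  show "q^3*(M^2 - Q^2) * R^3 = q^3*M^2*R^3
      - (q-qi)^2 * (R * (q^2*ps^2) * (q^3*R^2) + q^5*ps^2*(R - R^3))"
    using pp Q1 by algebra
  show "qi^3*(M^2 - R^2) * Q^3 = M^2*qi^3*Q^3 - (q-qi)^2 * (R * (q^2*ps^2) * (Q^2*qi^3))"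
    using pp Q2 Q3 by algebra
qed

section \<open>Existence of joint eigenvectors in the simple case\<close>

context jimbo_whittaker
begin

lemmas pK = pev_pCons[OF lin_ops(9)]
lemmas pC = pev_pCons[OF lin_Cas]

lemma Orb_sub_Gen: "a \<in> Orb w \<Longrightarrow> w \<in> Gen v \<Longrightarrow> a \<in> Gen v"
  by (induction rule: Orb.induct)
    (use submod_ops[OF submod_Gen, of _ v] submod_sub[OF submod_Gen, of v] in \<open>auto simp: fv.subspace_def\<close>)

lemma Orb_trans: "a \<in> Orb b \<Longrightarrow> b \<in> Orb w \<Longrightarrow> a \<in> Orb w"
  by (induction rule: Orb.induct) (auto intro: Orb.intros)

lemma Orb_pevC: "w' \<in> Orb w \<Longrightarrow> pev Cas p w' \<in> Orb w"
  by (induction p) (auto simp: pC intro: Orb.intros)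

lemma Orb_weight_pev: "a \<in> Orb w \<Longrightarrow> K w = fsc \<kappa> w \<Longrightarrow> \<exists>p. a = pev Cas p w"
proof (induction rule: Orb.induct)
  case Orb_base
  then show ?case by (intro exI[of _ "[:1:]"]) (simp add: pC op_lin)
next
  case Orb_zero
  show ?case by (intro exI[of _ 0]) simp
next
  case (Orb_add x y)
  then show ?case by (metis pev_add[OF lin_Cas])
next
  case (Orb_sc x c)
  then show ?case by (metis pev_smult[OF lin_Cas])
next
  case (Orb_K x)
  then show ?case by (metis Orb_weight pev_smult[OF lin_Cas])
next
  case (Orb_Ki x)
  then obtain p where p: "x = pev Cas p w" by auto
  have k: "K x = fsc \<kappa> x" using Orb_weight[OF Orb_Ki(1,3)] .
  show ?case
  proof (cases "\<kappa> = 0")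
    case True
    then have "K x = 0" using k by simp
    then have "Ki (K x) = 0" by (simp only: gen_lin)
    then have "x = 0" by (simp only: KKi)
    then show ?thesis by (intro exI[of _ 0]) (simp add: gen_lin)
  next
    case False
    have "x = fsc \<kappa> (Ki x)" using arg_cong[OF k, of Ki] by (simp only: KKi gen_lin)
    then have "Ki x = fsc (1/\<kappa>) x" using False by (metis divide_self_if fv.scale_one fv.scale_scale times_divide_eq_left mult_1)
    then show ?thesis using p pev_smult[OF lin_Cas, of "1/\<kappa>" p w] by metis
  qed
next
  case (Orb_Cas x)
  then obtain p where "x = pev Cas p w" by auto
  then have "Cas x = pev Cas (pCons 0 p) w" by (simp add: pC)
  then show ?case by blast
qed

text \<open>A polynomial relation for \<open>Cas\<close> on \<open>w\<close> yields a joint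
  eigenvector \<open>x\<close> in its orbit. Then \<open>v\<close> expands in powers of
  \<open>T\<close> from \<open>x\<close>, and only the zeroth power can occur.\<close>

lemma joint_of_K_eigenvector:
  assumes "simple v" "wh v" "v \<noteq> 0" "w \<in> Gen v" "wh w" "w \<noteq> 0" "K w = fsc \<kappa> w"
  shows "\<exists>\<kappa> c. joint \<kappa> c v"
proof -
  have k0: "\<kappa> \<noteq> 0"
  proof
    assume "\<kappa> = 0"
    then have "K w = 0" using assms by simp
    then have "Ki (K w) = 0" by (simp only: gen_lin)
    then show False using assms(6) by (simp only: KKi)
  qed
  \<comment> \<open>Otherwise \<open>Cas w\<close> is nonzero and of the same weight as
    \<open>w\<close>, so \<open>w\<close> is a polynomial in \<open>Cas\<close> applied to
    \<open>Cas w\<close>; this is itself a polynomial relation.\<close>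
  have "\<exists>p. p \<noteq> 0 \<and> pev Cas p w = 0"
  proof (rule ccontr)
    assume "\<not> ?thesis"
    then have inj: "\<And>p. pev Cas p w = 0 \<Longrightarrow> p = 0" by blast
    define z where "z = Cas w"
    have "z = pev Cas [:0,1:] w" by (simp add: z_def pC op_lin)
    then have "z \<noteq> 0" using inj[of "[:0,1:]"] by auto
    have zA: "z \<in> Orb w" unfolding z_def by (intro Orb.intros)
    have "w \<in> Tsp z"
      using simple_swap[OF assms(1) Orb_sub_Gen[OF zA assms(4)] \<open>z \<noteq> 0\<close> assms(4) Orb_wh[OF zA assms(5)] assms(5)] .
    moreover have kz: "K z = fsc \<kappa> z" by (rule Orb_weight[OF zA assms(7)])
    ultimately obtain a where a: "a \<in> Orb z" "w = (T ^^ 0) a" using Tsp_weight[of w z \<kappa> 0] k0 assms(7) by auto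
    obtain p where p: "w = pev Cas p z" using Orb_weight_pev[OF a(1) kz] a(2) by auto
    have "pev Cas (p * [:0,1:] + [:-1:]) w = 0"
      unfolding pev_add[OF lin_Cas] pev_mult[OF lin_Cas]
      using p by (simp add: pC op_lin z_def)
    then have "p * [:0,1:] + [:-1:] = 0" by (rule inj)
    then have "poly (p * [:0,1:] + [:-1:]) 0 = 0" by simp
    then show False by simp
  qed
  then obtain p where p: "p \<noteq> 0" "pev Cas p w = 0" by blast
  from pev_eigen[OF lin_Cas p(2,1) assms(6)] obtain c p' where
    p': "pev Cas p' w \<noteq> 0" "Cas (pev Cas p' w) = fsc c (pev Cas p' w)" by blast
  define x where "x = pev Cas p' w"
  have xA: "x \<in> Orb w" unfolding x_def by (rule Orb_pevC[OF Orb_base])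
  have j: "joint \<kappa> c x"
    using p' Orb_wh[OF xA assms(5)] Orb_weight[OF xA assms(7)] by (simp add: joint_def flip: x_def)
  have xG: "x \<in> Gen v" by (rule Orb_sub_Gen[OF xA assms(4)])
  have x: "x \<noteq> 0" "wh x" using j by (auto simp: joint_def)
  have vP: "v \<in> Tsp x" by (rule simple_swap[OF assms(1) xG x(1) Gen_base x(2) assms(2)])
  from Tsp_top[OF x(2) vP assms(3)] obtain m a b where
    a: "a \<in> Orb x" "(T ^^ m) a \<noteq> 0" "b \<noteq> 0" "(eps ^^ m) v = fsc b (HH m a)" "m = 0 \<Longrightarrow> v = a" by blast
  from joint_A[OF a(1) j] obtain t where t: "a = fsc t x" by blast
  \<comment> \<open>For \<open>m > 0\<close>, \<open>eps\<close> kills \<open>v\<close>, which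
    forces \<open>hfun q i \<kappa> c = 0\<close> for some \<open>i\<close> from 1 to
    \<open>m\<close>; but then \<open>(T ^^ m) x = 0\<close> by
    \<open>singular_power_zero\<close>.\<close>
  have m0: "m = 0"
  proof (rule ccontr)
    assume "m \<noteq> 0"
    then have "(eps ^^ m) v = 0"
      by (intro funpow_zero[OF lin_eps]) (simp_all add: eps_def whD(2)[OF assms(2)] gen_lin)
    with a(3,4) have "HH m a = 0" by simp
    then have "fsc (t * (\<Prod>i<m. hfun q (Suc i) \<kappa> c)) x = 0"
      unfolding t lin_sc[OF lin_HH] joint_HH[OF j] by simp
    then have "t = 0 \<or> (\<exists>i<m. hfun q (Suc i) \<kappa> c = 0)" using x(1) by auto
    then show False
    proof
      assume "t = 0"
      then show False using a(2) t by (simp add: Tn_lin)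
    next
      assume "\<exists>i<m. hfun q (Suc i) \<kappa> c = 0"
      then obtain i where i: "i < m" "hfun q (Suc i) \<kappa> c = 0" by blast
      have "(T ^^ Suc i) x = 0" by (rule singular_power_zero[OF assms(1) xG j _ i(2)]) simp
      moreover have "(T ^^ m) x = (T ^^ (m - Suc i)) ((T ^^ Suc i) x)"
        using i(1) by (intro funpow_split) simp
      ultimately show False using a(2) t by (simp add: Tn_lin del: funpow.simps)
    qed
  qed
  with a(5) t have v: "v = fsc t x" by simp
  then have "joint \<kappa> c v" using j assms(2,3) by (auto simp: joint_def gen_lin op_lin)
  then show ?thesis by blast
qed

definition "regular w \<longleftrightarrow> (\<forall>m\<ge>1. (\<forall>a\<in>Orb w. hop m a = 0 \<longrightarrow> a = 0) \<or> (\<forall>a\<in>Orb w. (T ^^ m) a = 0))"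

text \<open>Closes the gap left by \<open>Tsp_top\<close>: either some power of \<open>T\<close> up
  to the \<open>m\<close>-th vanishes on the orbit, or all factors of \<open>HH m\<close> are
  injective there.\<close>

lemma HH_regular:
  assumes "regular w" "a \<in> Orb w" "HH m a = 0"
  shows "(T ^^ m) a = 0"
proof (cases "\<exists>i. 1 \<le> i \<and> i \<le> m \<and> (\<forall>a\<in>Orb w. (T ^^ i) a = 0)")
  case True
  then obtain i where i: "i \<le> m" "\<forall>a\<in>Orb w. (T ^^ i) a = 0" by blast
  have "(T ^^ m) a = (T ^^ (m - i)) ((T ^^ i) a)"
    using i(1) by (rule funpow_split)
  then show ?thesis using i(2) assms(2) by (simp add: Tn_lin)
next
  case False
  have "a = 0" using assms(2,3) False
  proof (induction m arbitrary: a)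
    case (Suc m)
    then have "hop (Suc m) a = 0" using Orb_hop[OF Suc.prems(1)] by (auto simp: le_SucI)
    moreover have "\<not> (\<forall>a\<in>Orb w. (T ^^ Suc m) a = 0)"
      using Suc.prems(3) by (metis le_refl le_add1 plus_1_eq_Suc)
    ultimately show ?case
      using assms(1)[unfolded regular_def, rule_format, of "Suc m"] Suc.prems(1) by auto
  qed simp
  then show ?thesis by (simp add: Tn_lin)
qed

text \<open>The factor \<open>K ^^ s\<close> clears the negative powers of \<open>K\<close>, so that
  ordinary bivariate polynomials suffice.\<close>

lemma Orb_pev2: "a \<in> Orb z \<Longrightarrow> \<exists>s f. (K ^^ s) a = pev2 K Cas f z"
proof -
  note c = lin_ops(9) lin_Cas Cas_K(1)[symmetric]
  have Ks: "(K ^^ s) (pev2 K Cas f z) = pev2 K Cas (smult (monom 1 s) f) z" for s f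
  proof (induction s)
    case (Suc s)
    then show ?case by (simp add: pev2_smult[OF c] monom_Suc pK)
  qed (simp add: pev2_smult[OF c] monom_0 pK gen_lin)
  assume "a \<in> Orb z"
  then show ?thesis
  proof (induction rule: Orb.induct)
    case Orb_base
    show ?case by (rule exI[of _ 0], rule exI[of _ "[:[:1:]:]"]) (simp add: pev2_pCons[OF c] pK gen_lin op_lin)
  next
    case Orb_zero
    show ?case by (rule exI[of _ 0], rule exI[of _ 0]) simp
  next
    case (Orb_add x y)
    then obtain s f t g where x: "(K ^^ s) x = pev2 K Cas f z" and y: "(K ^^ t) y = pev2 K Cas g z" by blast
    have "(K ^^ (s + t)) (x + y) = (K ^^ t) ((K ^^ s) x) + (K ^^ s) ((K ^^ t) y)"
    proof -
      have "(K ^^ (s + t)) x = (K ^^ t) ((K ^^ s) x)" by (simp only: add.commute[of s t] funpow_add o_apply)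
      moreover have "(K ^^ (s + t)) y = (K ^^ s) ((K ^^ t) y)" by (simp only: funpow_add o_apply)
      ultimately show ?thesis by (simp only: lin_add[OF lin_funpow[OF lin_ops(9)]])
    qed
    then show ?case unfolding x y Ks pev2_add[OF c, symmetric] by blast
  next
    case (Orb_sc x c')
    then obtain s f where x: "(K ^^ s) x = pev2 K Cas f z" by blast
    have "(K ^^ s) (fsc c' x) = pev2 K Cas (smult [:c':] f) z"
      by (simp add: lin_sc[OF lin_funpow[OF lin_ops(9)]] x pev2_smult[OF c] pK gen_lin)
    then show ?case by blast
  next
    case (Orb_K x)
    then obtain s f where x: "(K ^^ s) x = pev2 K Cas f z" by blast
    have "(K ^^ s) (K x) = (K ^^ 1) ((K ^^ s) x)" by (simp add: funpow_swap1)
    then show ?case unfolding x Ks by blast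
  next
    case (Orb_Ki x)
    then obtain s f where x: "(K ^^ s) x = pev2 K Cas f z" by blast
    have "(K ^^ Suc s) (Ki x) = (K ^^ s) x" by (simp only: funpow_Suc_right o_apply KKi)
    then show ?case unfolding x by blast
  next
    case (Orb_Cas x)
    then obtain s f where x: "(K ^^ s) x = pev2 K Cas f z" by blast
    have "(K ^^ s) (Cas x) = Cas ((K ^^ s) x)" by (induction s) (auto simp: Cas_K)
    then have "(K ^^ s) (Cas x) = pev2 K Cas (pCons 0 f) z" by (simp add: x pev2_pCons[OF c])
    then show ?case by blast
  qed
qed

lemma pevK_inj:
  assumes "\<And>w \<kappa>. w \<in> Gen v \<Longrightarrow> wh w \<Longrightarrow> w \<noteq> 0 \<Longrightarrow> K w \<noteq> fsc \<kappa> w"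
    "p \<noteq> 0" "w \<in> Gen v" "wh w" "pev K p w = 0"
  shows "w = 0"
proof (rule ccontr)
  assume "w \<noteq> 0"
  from pev_eigen[OF lin_ops(9) assms(5,2) this] obtain r p' where
    p': "pev K p' w \<noteq> 0" "K (pev K p' w) = fsc r (pev K p' w)" by blast
  have "pev K p' w \<in> Orb w" for p' by (induction p') (auto simp: pK intro: Orb.intros)
  from this[of p'] assms(1)[of "pev K p' w" r] p' Orb_wh[OF _ assms(4)] Orb_sub_Gen[OF _ assms(3)] show False by blast
qed

lemma no_regular_vector:
  assumes "simple v" and noeig: "\<And>w \<kappa>. w \<in> Gen v \<Longrightarrow> wh w \<Longrightarrow> w \<noteq> 0 \<Longrightarrow> K w \<noteq> fsc \<kappa> w"
    and w: "w \<in> Gen v" "wh w" "w \<noteq> 0" and reg: "regular w"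
  shows False
proof -
  note c = lin_ops(9) lin_Cas Cas_K(1)[symmetric]
  \<comment> \<open>In the expansion of \<open>w\<close> from \<open>(K - l) w\<close> only the
    zeroth power of \<open>T\<close> survives: as \<open>eps\<close> kills \<open>w\<close>, a
    higher top term would have \<open>HH m a = 0\<close>, which regularity rules out.\<close>
  have *: "\<exists>a\<in>Orb (K w - fsc l w). w = a" for l
  proof -
    define z where "z = K w - fsc l w"
    have zA: "z \<in> Orb w" unfolding z_def by (intro fv.subspace_diff[OF Orb_subspace] Orb.intros)
    have "z \<noteq> 0" using noeig[OF w, of l] by (simp add: z_def)
    have wz: "wh z" by (rule Orb_wh[OF zA w(2)])
    have "w \<in> Tsp z"
      by (rule simple_swap[OF assms(1) Orb_sub_Gen[OF zA w(1)] \<open>z \<noteq> 0\<close> w(1) wz w(2)])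
    from Tsp_top[OF wz this w(3)] obtain m a b where
      a: "a \<in> Orb z" "(T ^^ m) a \<noteq> 0" "b \<noteq> 0" "(eps ^^ m) w = fsc b (HH m a)" "m = 0 \<Longrightarrow> w = a" by blast
    have aw: "a \<in> Orb w" by (rule Orb_trans[OF a(1) zA])
    have "m = 0"
    proof (rule ccontr)
      assume "m \<noteq> 0"
      then have "(eps ^^ m) w = 0"
        by (intro funpow_zero[OF lin_eps]) (simp_all add: eps_def whD(2)[OF w(2)] gen_lin)
      with a(3,4) have "HH m a = 0" by simp
      with HH_regular[OF reg aw] a(2) show False by blast
    qed
    with a show ?thesis by (auto simp: z_def)
  qed
  \<comment> \<open>The annihilator of \<open>w\<close>, with \<open>K\<close> as inner and
    \<open>Cas\<close> as outer variable. A constant in it is a polynomial in \<open>K\<close>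
    alone, and is zero since \<open>K\<close> has no eigenvectors here.\<close>
  define J where "J = {g. pev2 K Cas g w = 0}"
  show False
  proof (rule ideal_contra[of J])
    fix l
    from *[of l] have "w \<in> Orb (K w - fsc l w)" by blast
    from Orb_pev2[OF this] obtain s f where sf: "(K ^^ s) w = pev2 K Cas f (K w - fsc l w)" by blast
    have 1: "K w - fsc l w = pev2 K Cas [:[:- l, 1:]:] w"
      by (simp add: pev2_pCons[OF c] pK gen_lin op_lin)
    have 2: "(K ^^ s) w = pev2 K Cas [:monom 1 s:] w"
    proof -
      have "(K ^^ s) w = pev K (monom 1 s) w"
        by (induction s) (auto simp: monom_Suc pK monom_0 gen_lin)
      then show ?thesis by (simp add: pev2_pCons[OF c] op_lin)
    qed
    have "[:monom 1 s:] - f * [:[:- l, 1:]:] \<in> J"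
      unfolding J_def mem_Collect_eq pev2_diff[OF c] pev2_mult[OF c] 1[symmetric] 2[symmetric] sf by simp
    then show "\<exists>s f. [:monom 1 s:] - f * [:[:- l, 1:]:] \<in> J" by blast
  next
    fix a assume "[:a:] \<in> J"
    then have "pev K a w = 0" by (simp add: J_def pev2_pCons[OF c] op_lin)
    then show "a = 0" using pevK_inj[OF noeig _ w(1,2)] w(3) by blast
  qed (auto simp: J_def pev2_diff[OF c] pev2_mult[OF c] lin_zero[OF lin_pev2[OF c]])
qed

lemma hop_hop: "hop n (K x) = K (hop n x)" "hop n (Ki x) = Ki (hop n x)" "hop n (Cas x) = Cas (hop n x)"
  by (simp_all add: hop_def gen_lin op_lin Cas_K KKi)

lemma Orb_hop_zero: "a \<in> Orb w \<Longrightarrow> hop n w = 0 \<Longrightarrow> hop n a = 0"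
  by (induction rule: Orb.induct) (auto simp: hop_hop gen_lin op_lin)

text \<open>Multiplication by \<open>K\<close> turns the relation into \<open>c K^2 + d\<close>, a
  nonzero polynomial in \<open>K\<close>.\<close>

lemma KKi_inj:
  assumes noeig: "\<And>w \<kappa>. w \<in> Gen v \<Longrightarrow> wh w \<Longrightarrow> w \<noteq> 0 \<Longrightarrow> K w \<noteq> fsc \<kappa> w"
    and b: "b \<in> Gen v" "wh b" "fsc c (K b) + fsc d (Ki b) = 0" "c \<noteq> 0"
  shows "b = 0"
proof -
  have "K (fsc c (K b) + fsc d (Ki b)) = 0" by (simp only: b(3) gen_lin)
  then have "pev K [:d, 0, c:] b = 0" by (simp add: gen_lin KKi pK add.commute)
  then show ?thesis using pevK_inj[OF noeig, where p = "[:d,0,c:]" and w = b] b(1,2,4) by auto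
qed

lemma hop_Cas:
  assumes "hop n b = 0"
  shows "Cas b = fsc (q^2*ps^2) (fsc (q^3*(qi^n)^2) (K b) + fsc ((q^n)^2*qi^3) (Ki b))"
proof -
  have *: "fsc (q^3*(qi^n)^2) (K b) + fsc ((q^n)^2*qi^3) (Ki b) = fsc ((q-qi)^2) (Cas b)"
    using assms by (simp add: hop_def)
  have "q^2*ps^2 * (q-qi)^2 = 1" using qi(1,4) by algebra
  then show ?thesis unfolding * by simp
qed

text \<open>On vectors killed by \<open>hop n\<close>, \<open>Cas\<close> is a combination of
  \<open>K\<close> and \<open>Ki\<close>, and these commute with powers of \<open>T\<close> up to
  scalars.\<close>

lemma Orb_T_zero:
  assumes "hop n w = 0" "(T ^^ n) w = 0" "a \<in> Orb w"
  shows "(T ^^ n) a = 0"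
  using assms(3)
proof (induction rule: Orb.induct)
  case (Orb_K x)
  have "fsc ((qi^n)^3) ((T ^^ n) (K x)) = 0" unfolding K_Tn[symmetric] Orb_K.IH by (rule gen_lin)
  then show ?case using qi(3) by simp
next
  case (Orb_Ki x)
  have "fsc ((q^n)^3) ((T ^^ n) (Ki x)) = 0" unfolding Ki_Tn[symmetric] Orb_Ki.IH by (rule gen_lin)
  then show ?case using q_nz by simp
next
  case (Orb_Cas x)
  have "fsc ((qi^n)^3) ((T ^^ n) (K x)) = 0" unfolding K_Tn[symmetric] Orb_Cas.IH by (rule gen_lin)
  moreover have "fsc ((q^n)^3) ((T ^^ n) (Ki x)) = 0" unfolding Ki_Tn[symmetric] Orb_Cas.IH by (rule gen_lin)
  ultimately show ?case unfolding hop_Cas[OF Orb_hop_zero[OF Orb_Cas.hyps assms(1)]]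
    using q_nz qi(3) by (simp add: Tn_lin)
qed (auto simp: assms(2) Tn_lin)

lemma hop_two:
  assumes "hop n b = 0"
  shows "hop m b = fsc (q^3*((qi^m)^2 - (qi^n)^2)) (K b) + fsc (qi^3*((q^m)^2 - (q^n)^2)) (Ki b)"
proof -
  have "hop m b = hop m b - hop n b" using assms by simp
  then show ?thesis unfolding hop_def by (simp add: fun_eq_iff pointwise algebra_simps)
qed

lemma Cas_Tn_hop:
  assumes "E1 a = fsc \<alpha> a" "hop (Suc k) a = 0" "n = Suc k"
  shows "Cas ((T ^^ n) a) = (T ^^ n) (fsc (qi^n) (Cas a) + fsc (q^5*ps^2*(qi^n - (qi^n)^3)) (K a))"
  unfolding assms(3) Cas_Tn[OF assms(1)] assms(2) by (simp add: Tn_lin gen_lin)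

text \<open>The eigenvalue of \<open>C1\<close> on \<open>(T ^^ n) a\<close> is the one that would make \<open>h\<close> with index \<open>-n\<close> vanish,
  so no \<open>h\<^sub>m\<close> with \<open>m \<ge> 1\<close> does.\<close>

lemma hop_reflect:
  assumes "E1 a = fsc \<alpha> a" "hop (Suc k) a = 0" "n = Suc k"
  shows "hop m ((T ^^ n) a) = fsc (q^3*(qi^(2*m) - q^(2*n))) (K ((T ^^ n) a)) + fsc (qi^3*(q^(2*m) - qi^(2*n))) (Ki ((T ^^ n) a))"
proof -
  have QR: "q^n * qi^n = 1" by (rule qi2)
  note k1 = reflect_coeffs(1)[OF qi(1,4) QR, of "qi^m"] and k2 = reflect_coeffs(2)[OF qi(1,4) QR, of "q^m"]
  have e: "q^(2*m) = (q^m)^2" "qi^(2*m) = (qi^m)^2" "q^(2*n) = (q^n)^2" "qi^(2*n) = (qi^n)^2"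
    by (simp_all add: power_mult mult.commute)
  note C = Cas_Tn_hop[OF assms]
  show ?thesis
    unfolding hop_def C hop_Cas[OF assms(2)[folded assms(3)]] K_Tn Ki_Tn e
    by (simp add: Tn_lin) (rule ext, simp only: pointwise k1 k2, algebra)
qed

lemma K_eigenvector_exists:
  assumes s: "simple v" and v: "wh v" "v \<noteq> 0"
    and noeig: "\<And>w \<kappa>. w \<in> Gen v \<Longrightarrow> wh w \<Longrightarrow> w \<noteq> 0 \<Longrightarrow> K w \<noteq> fsc \<kappa> w"
  shows False
proof (cases "regular v")
  case True
  then show False using no_regular_vector[OF s noeig Gen_base v] by blast
next
  case False
  then obtain n w where n: "n \<ge> 1" and w: "w \<in> Orb v" "hop n w = 0" "w \<noteq> 0"
    unfolding regular_def by blast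
  have ww: "wh w" and wG: "w \<in> Gen v" using Orb_wh[OF w(1) v(1)] Orb_sub_Gen[OF w(1) Gen_base] by auto
  show False
  proof (cases "(T ^^ n) w = 0")
    case True
    \<comment> \<open>For \<open>m = n\<close> the second alternative of \<open>regular\<close>
      holds. For \<open>m \<noteq> n\<close>, \<open>hop_two\<close> eliminates \<open>Cas\<close>
      and leaves a combination of \<open>K\<close> and \<open>Ki\<close> with nonzero coefficient at
      \<open>K\<close>.\<close>
    have "regular w" unfolding regular_def
    proof (intro allI impI)
      fix m :: nat assume "m \<ge> 1"
      show "(\<forall>a\<in>Orb w. hop m a = 0 \<longrightarrow> a = 0) \<or> (\<forall>a\<in>Orb w. (T ^^ m) a = 0)"
      proof (cases "m = n")
        case True
        then show ?thesis using Orb_T_zero[OF w(2) \<open>(T ^^ n) w = 0\<close>] by blast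
      next
        case False
        then have "qi^(2*m) \<noteq> qi^(2*n)" using qi_pow_inj by fastforce
        then have c: "q^3*((qi^m)^2 - (qi^n)^2) \<noteq> 0" using q_nz by (simp add: power_mult mult.commute flip: power_mult)
        have "a = 0" if a: "a \<in> Orb w" "hop m a = 0" for a
          using KKi_inj[OF noeig Orb_sub_Gen[OF a(1) wG] Orb_wh[OF a(1) ww] _ c] hop_two[OF Orb_hop_zero[OF a(1) w(2)], of m] a(2) by simp
        then show ?thesis by blast
      qed
    qed
    then show False using no_regular_vector[OF s noeig wG ww w(3)] by blast
  next
    case False
    obtain k where k: "n = Suc k" using n by (cases n) auto
    define y where "y = (T ^^ n) w"
    have wy: "wh y" using wh_Tn[OF ww] w(2) unfolding y_def k by blast
    have yG: "y \<in> Gen v" unfolding y_def by (rule T_Gen[OF wG])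
    \<comment> \<open>The orbit of \<open>y\<close> stays in the image of the orbit of
      \<open>w\<close> under \<open>T ^^ n\<close>, because \<open>hop n\<close> vanishes on the
      latter and so removes the \<open>F2\<close> term of \<open>Cas_Tn\<close>.\<close>
    have Ay: "\<exists>a\<in>Orb w. b = (T ^^ n) a" if "b \<in> Orb y" for b
      using that
    proof (induction rule: Orb.induct)
      case Orb_base
      then show ?case unfolding y_def by (intro bexI[of _ w] Orb.intros) simp
    next
      case Orb_zero
      then show ?case by (intro bexI[of _ 0] Orb.intros) (simp add: Tn_lin)
    next
      case (Orb_add x y)
      then obtain a b where "a \<in> Orb w" "b \<in> Orb w" "x = (T ^^ n) a" "y = (T ^^ n) b" by blast
      then show ?case by (intro bexI[of _ "a + b"] Orb.intros) (simp add: Tn_lin)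
    next
      case (Orb_sc x c)
      then obtain a where "a \<in> Orb w" "x = (T ^^ n) a" by blast
      then show ?case by (intro bexI[of _ "fsc c a"] Orb.intros) (simp add: Tn_lin)
    next
      case (Orb_K x)
      then obtain a where "a \<in> Orb w" "x = (T ^^ n) a" by blast
      then show ?case by (intro bexI[of _ "fsc ((qi^n)^3) (K a)"] Orb.intros) (simp_all add: Tn_lin K_Tn)
    next
      case (Orb_Ki x)
      then obtain a where "a \<in> Orb w" "x = (T ^^ n) a" by blast
      then show ?case by (intro bexI[of _ "fsc ((q^n)^3) (Ki a)"] Orb.intros) (simp_all add: Tn_lin Ki_Tn)
    next
      case (Orb_Cas x)
      then obtain a where a: "a \<in> Orb w" "x = (T ^^ n) a" by blast
      have "hop (Suc k) a = 0" using Orb_hop_zero[OF a(1) w(2)] k by simp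
      from Cas_Tn_hop[OF whD(1)[OF Orb_wh[OF a(1) ww]] this k]
      have "Cas x = (T ^^ n) (fsc (qi^n) (Cas a) + fsc (q^5*ps^2*(qi^n - (qi^n)^3)) (K a))"
        unfolding a(2) .
      moreover have "fsc (qi^n) (Cas a) + fsc (q^5*ps^2*(qi^n - (qi^n)^3)) (K a) \<in> Orb w"
        by (rule Orb.Orb_add; rule Orb.Orb_sc; (rule Orb.Orb_Cas | rule Orb.Orb_K); rule a(1))
      ultimately show ?case by blast
    qed
    \<comment> \<open>Here the first alternative holds for every \<open>m\<close>: the coefficient
      of \<open>K\<close> in \<open>hop_reflect\<close> vanishes only if
      \<open>q^(2*n+2*m) = 1\<close>.\<close>
    have "regular y" unfolding regular_def
    proof (intro allI impI disjI1 ballI)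
      fix m :: nat and b assume m: "m \<ge> 1" "b \<in> Orb y" "hop m b = 0"
      from Ay[OF m(2)] obtain a where a: "a \<in> Orb w" "b = (T ^^ n) a" by blast
      have "q^(2*n) * q^(2*m) \<noteq> 1" using q_root[of "2*n+2*m"] m(1) by (simp add: power_add)
      then have "qi^(2*m) \<noteq> q^(2*n)" using qi2(2)[of "2*m"] by metis
      then have c: "q^3*(qi^(2*m) - q^(2*n)) \<noteq> 0" using q_nz by simp
      have "hop (Suc k) a = 0" using Orb_hop_zero[OF a(1) w(2)] k by simp
      from hop_reflect[OF whD(1)[OF Orb_wh[OF a(1) ww]] this k, of m]
      show "b = 0"
        using KKi_inj[OF noeig Orb_sub_Gen[OF m(2) yG] Orb_wh[OF m(2) wy] _ c] m(3) unfolding a(2) by simp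
    qed
    then show False using no_regular_vector[OF s noeig yG wy] False unfolding y_def by blast
  qed
qed

lemma simple_joint:
  assumes "simple v" "wh v" "v \<noteq> 0"
  shows "\<exists>\<kappa> c. joint \<kappa> c v"
  using joint_of_K_eigenvector[OF assms] K_eigenvector_exists[OF assms] by blast

end

section \<open>Closed form of the powers of the ladder operator\<close>

text \<open>The powers of \<open>q\<close> picked up when \<open>Ki\<close>, \<open>K2\<close> and
  \<open>G\<close> are moved into place in a monomial; \<open>A\<close> and \<open>B\<close> stand
  for \<open>q^a\<close> and \<open>q^k\<close>, \<open>R\<close> and \<open>S\<close> for their
  inverses.\<close>

lemma closed_form_coeffs:
  fixes A B R S :: complex
  assumes "A * R = 1" "B * S = 1"
  shows "B^3 * A^3 * R = A^2 * B^3"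
    and "(B^3 * A^3) * (B^3 * A^3) * (S * R^2) * (S * R^2) = A^2 * B^4"
proof -
  show "B^3 * A^3 * R = A^2 * B^3" using assms(1) by algebra
  show "(B^3 * A^3) * (B^3 * A^3) * (S * R^2) * (S * R^2) = A^2 * B^4" using assms by algebra
qed

context jimbo_whittaker
begin

lemma acoef_zero: "k + j > n \<Longrightarrow> acoef q \<alpha> n k j = 0"
  by (cases "k \<le> n") (auto simp: acoef_def qbinom_def)

lemma qint_nz: "m > 0 \<Longrightarrow> qint q m \<noteq> 0"
  using be_nz[of m] by (auto simp: qint_def be_def qi_def)

lemma qfact_nz: "qfact q m \<noteq> 0"
  unfolding qfact_def using qint_nz by auto

lemma qfact_Suc: "qfact q (Suc m) = qint q (Suc m) * qfact q m"
  by (simp add: qfact_def mult.commute)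

text \<open>\<open>div\<close> commutes with adding even numbers, so the parity of the dividend plays no role.\<close>

definition "ex n k j = int j * (int n - 3) + (int k * (2 * int n + 2 * int j + int k - 7)) div 2"

text \<open>The two Gaussian binomials combine to a multinomial coefficient, symmetric in
  \<open>k\<close>, \<open>j\<close> and \<open>n - k - j\<close>.\<close>

lemma acoef_eq:
  assumes "k + j \<le> n"
  shows "acoef q \<alpha> n k j = (-1)^j * (\<alpha> * (q^2-1))^k * q powi (ex n k j) *
    (qfact q n / (qfact q k * qfact q j * qfact q (n - k - j)))"
proof -
  have "qbinom q n k * qbinom q (n - k) j = qfact q n / (qfact q k * qfact q j * qfact q (n - k - j))"
    using assms qfact_nz by (simp add: qbinom_def)
  then show ?thesis using q_nz
    by (simp add: acoef_def ex_def power_int_add power_mult_distrib mult.assoc) 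
qed

lemma ex_rec:
  "ex (Suc n) k j = ex n k j + int j + int k"
  "ex n (Suc k) j = ex n k j + (int n + int j + int k - 3)"
  "ex n k (Suc j) = ex n k j + (int n - 3 + int k)"
proof -
  have 1: "int k * (2 * int (Suc n) + 2 * int j + int k - 7) = int k * (2 * int n + 2 * int j + int k - 7) + int k * 2"
    by (simp add: algebra_simps)
  have 2: "int (Suc k) * (2 * int n + 2 * int j + int (Suc k) - 7)
    = int k * (2 * int n + 2 * int j + int k - 7) + (int n + int j + int k - 3) * 2"
    by (simp add: algebra_simps)
  have 3: "int k * (2 * int n + 2 * int (Suc j) + int k - 7) = int k * (2 * int n + 2 * int j + int k - 7) + int k * 2"
    by (simp add: algebra_simps)
  show "ex (Suc n) k j = ex n k j + int j + int k"
    unfolding ex_def 1 div_mult_self1[OF zero_neq_numeral[symmetric]] by (simp add: algebra_simps)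
  show "ex n (Suc k) j = ex n k j + (int n + int j + int k - 3)"
    unfolding ex_def 2 div_mult_self1[OF zero_neq_numeral[symmetric]] by (simp add: algebra_simps)
  show "ex n k (Suc j) = ex n k j + (int n - 3 + int k)"
    unfolding ex_def 3 div_mult_self1[OF zero_neq_numeral[symmetric]] by (simp add: algebra_simps)
qed

text \<open>The right-hand side telescopes. This is the Pascal rule of the multinomial coefficients,
  stripped of their common factor.\<close>

lemma qint_rec: "q^(j+k) * qint q (m+k+j) = qint q m + q^(m+k) * qint q k + q^(m+2*k+j) * qint q j"
proof -
  have "q^(j+k) * (q^(m+k+j) - inverse q^(m+k+j)) = (q^m - inverse q^m)
      + q^(m+k) * (q^k - inverse q^k) + q^(m+2*k+j) * (q^j - inverse q^j)"
    using q_nz by (simp add: field_simps power_add power_mult power2_eq_square)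
  then show ?thesis unfolding qint_def by (simp only: times_divide_eq_right add_divide_distrib[symmetric])
qed

text \<open>The three terms come from the three summands of \<open>T\<close> applied to
  \<open>(T ^^ n) v\<close>, with the scalars of \<open>T_MN\<close>.\<close>

lemma acoef_rec:
  "acoef q \<alpha> (Suc n) k j = acoef q \<alpha> n k j
    + (if k = 0 then 0 else \<alpha> * (q^2-1) * qi^2 * (q^(n - (k-1)))^2 * (q^(k-1))^3 * acoef q \<alpha> n (k-1) j)
    - (if j = 0 then 0 else qi^2 * (q^(n-k))^2 * (q^k)^4 * acoef q \<alpha> n k (j-1))"
proof (cases "k + j \<le> Suc n")
  case False
  then show ?thesis by (simp add: acoef_zero)
next
  case True
  define m where "m = Suc n - k - j"
  have n: "Suc n = m + k + j" using True by (simp add: m_def)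
  have m': "Suc n - (k + j) = m" by (simp add: m_def)
  \<comment> \<open>The factor common to all four coefficients; what remains after splitting it off
    is \<open>qint_rec\<close>.\<close>
  define X where "X = (-1)^j * (\<alpha> * (q^2-1))^k * q powi (ex n k j) * (qfact q n / (qfact q k * qfact q j * qfact q m))"
  have 0: "acoef q \<alpha> (Suc n) k j = X * (q^(j+k) * qint q (m+k+j))"
    unfolding acoef_eq[OF True] ex_rec qfact_Suc X_def using q_nz
    by (simp add: power_int_add power_add n[symmetric] m' mult_ac)
  have 1: "acoef q \<alpha> n k j = X * qint q m"
  proof (cases m)
    case 0
    then have "k + j > n" using n by simp
    then show ?thesis by (simp add: acoef_zero 0 qint_def)
  next
    case (Suc m')
    then have "k + j \<le> n" "n - k - j = m'" using n by auto
    then show ?thesis unfolding X_def acoef_eq[OF \<open>k + j \<le> n\<close>] Suc qfact_Suc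
      using qint_nz[of "Suc m'"] by (simp add: mult_ac)
  qed
  have 2: "(if k = 0 then 0 else \<alpha> * (q^2-1) * qi^2 * (q^(n - (k-1)))^2 * (q^(k-1))^3 * acoef q \<alpha> n (k-1) j) = X * (q^(m+k) * qint q k)"
  proof (cases k)
    case 0
    then show ?thesis by (simp add: qint_def)
  next
    case (Suc k')
    then have l: "k' + j \<le> n" "n - k' - j = m" "n - k' = m + j" "n = m + k' + j" using n by auto
    have "q powi (ex n k j) = q powi (ex n k' j) * q powi (int n + int j + int k' - 3)"
      unfolding Suc ex_rec using q_nz by (simp add: power_int_add)
    also have "q powi (int n + int j + int k' - 3) = q^(n+j+k') / q^3"
    proof -
      have "int n + int j + int k' - 3 = int (n + j + k') - 3" by simp
      then show ?thesis using q_nz power_int_of_nat[of q "n + j + k'"] by (simp add: power_int_diff)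
    qed
    finally have e: "q powi (ex n k j) = q powi (ex n k' j) * (q^(n+j+k') / q^3)" .
    have "k - 1 = k'" using Suc by simp
    show ?thesis unfolding X_def e \<open>k - 1 = k'\<close> acoef_eq[OF l(1)] l(2) unfolding Suc qfact_Suc
      using qint_nz[of "Suc k'"] qfact_nz q_nz q2
      by (simp add: l qi_def field_simps power_add power2_eq_square power3_eq_cube)
  qed
  have 3: "(if j = 0 then 0 else qi^2 * (q^(n-k))^2 * (q^k)^4 * acoef q \<alpha> n k (j-1)) = - X * (q^(m+2*k+j) * qint q j)"
  proof (cases j)
    case 0
    then show ?thesis by (simp add: qint_def)
  next
    case (Suc j')
    then have l: "k + j' \<le> n" "n - k - j' = m" "n - k = m + j'" "n = m + k + j'" using n by auto
    have "q powi (ex n k j) = q powi (ex n k j') * q powi (int n - 3 + int k)"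
      unfolding Suc ex_rec using q_nz by (simp add: power_int_add)
    also have "q powi (int n - 3 + int k) = q^(n+k) / q^3"
      using q_nz power_int_diff[of q "int (n+k)" 3] power_int_of_nat[of q "n + k"] by (simp add: algebra_simps)
    finally have e: "q powi (ex n k j) = q powi (ex n k j') * (q^(n+k) / q^3)" .
    have "j - 1 = j'" using Suc by simp
    show ?thesis unfolding X_def e \<open>j - 1 = j'\<close> acoef_eq[OF l(1)] l(2) unfolding Suc qfact_Suc
      using qint_nz[of "Suc j'"] qfact_nz q_nz q2
      by (simp add: l qi_def field_simps power_add power2_eq_square power3_eq_cube power4_eq_xxxx mult_2 power_mult)
  qed
  show ?thesis unfolding 0 1 2 3 qint_rec by (simp add: algebra_simps)
qed

definition "mn v a k j = (F2 ^^ a) ((G ^^ k) ((K2 ^^ (2 * j)) ((Ki ^^ (2 * j + k)) v)))"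

lemma pow_comm:
  assumes "lin f" "lin g" "\<And>x. f (g x) = fsc c (g (f x))"
  shows "f ((g ^^ n) x) = fsc (c ^ n) ((g ^^ n) (f x))"
  by (induction n) (simp_all add: assms lin_sc[OF assms(2)] mult.commute)

lemmas Ki_F2n = pow_comm[OF lin_ops(10,4) KF(8)]
lemmas Ki_Gn = pow_comm[OF lin_ops(10,11) KG(4)]
lemmas K2_F2n = pow_comm[OF lin_ops(7,4) KF(3)]
lemmas K2_Gn = pow_comm[OF lin_ops(7,11) KG(1)]
lemmas G_F2n = pow_comm[OF lin_ops(11,4) F_comm(3)]

lemma Ki_K2n: "Ki ((K2 ^^ n) x) = (K2 ^^ n) (Ki x)"
  by (induction n) (simp_all add: KK2)

lemma lin_Gn: "lin (G ^^ n)" by (intro lin_funpow lin_ops)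

lemma T_MN: "T (mn v a k j) = mn v (Suc a) k j
   + fsc (\<alpha> * (q^2-1) * qi^2 * (q^a)^2 * (q^k)^3) (mn v a (Suc k) j)
   - fsc (qi^2 * (q^a)^2 * (q^k)^4) (mn v (Suc a) k (Suc j))"
proof -
  note ls = lin_sc[OF lin_Fn] lin_sc[OF lin_Gn] gen_lin
  have a: "q^a * qi^a = 1" and k: "q^k * qi^k = 1" by (rule qi2)+
  have c: "(x^m)^l = (x^l)^m" for x :: complex and m l by (simp add: power_mult[symmetric] mult.commute)
  have cG: "(q^3)^k * (q^3)^a * qi^a = (q^a)^2 * (q^k)^3"
    unfolding c[of q 3] by (rule closed_form_coeffs(1)[OF a k])
  have cF: "((q^3)^k * (q^3)^a) * ((q^3)^k * (q^3)^a) * (qi^k * (qi^2)^a) * (qi^k * (qi^2)^a) = (q^a)^2 * (q^k)^4"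
    unfolding c[of q 3] c[of qi 2] by (rule closed_form_coeffs(2)[OF a k])
  have Gm: "G (Ki (mn v a k j)) = fsc ((q^a)^2 * (q^k)^3) (mn v a (Suc k) j)"
    unfolding mn_def Ki_F2n Ki_Gn ls G_F2n cG[symmetric]
    by (simp add: Ki_K2n mult_ac)
  have Fm: "F2 (K2 (K2 (Ki (Ki (mn v a k j))))) = fsc ((q^a)^2 * (q^k)^4) (mn v (Suc a) k (Suc j))"
    unfolding mn_def Ki_F2n Ki_Gn ls K2_F2n K2_Gn cF[symmetric]
    by (simp add: Ki_K2n mult_ac)
  show ?thesis unfolding T_def Gm Fm
    by (simp add: mn_def fv.scale_right_diff_distrib mult_ac)
qed

text \<open>A square index range replaces the triangle \<open>k + j \<le> n\<close>, outside of
  which \<open>acoef\<close> vanishes, so that raising \<open>k\<close> or \<open>j\<close> is a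
  shift of a full range.\<close>

lemma Tn_closed_form: "(T ^^ n) v = (\<Sum>k\<le>n. \<Sum>j\<le>n. fsc (acoef q \<alpha> n k j) (mn v (n - k) k j))"
proof (induction n)
  case 0
  show ?case by (simp add: mn_def acoef_def qbinom_def qfact_def)
next
  case (Suc n)
  let ?M = "\<lambda>k j. mn v (Suc n - k) k j"
  let ?b = "\<lambda>k. \<alpha> * (q^2-1) * qi^2 * (q^(n-k))^2 * (q^k)^3"
  let ?c = "\<lambda>k. qi^2 * (q^(n-k))^2 * (q^k)^4"
  let ?a = "acoef q \<alpha> n"
  have "(T ^^ Suc n) v = (\<Sum>k\<le>n. \<Sum>j\<le>n. fsc (?a k j) (T (mn v (n - k) k j)))"
    by (simp add: Suc lin_sum[OF lin_T] op_lin)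
  also have "\<dots> = (\<Sum>k\<le>n. \<Sum>j\<le>n. fsc (?a k j) (?M k j) + fsc (?b k * ?a k j) (?M (Suc k) j) - fsc (?c k * ?a k j) (?M k (Suc j)))"
    by (intro sum.cong refl) (simp add: T_MN Suc_diff_le fv.scale_right_distrib fv.scale_right_diff_distrib mult_ac)
  also have "\<dots> = (\<Sum>k\<le>n. \<Sum>j\<le>n. fsc (?a k j) (?M k j)) + (\<Sum>k\<le>n. \<Sum>j\<le>n. fsc (?b k * ?a k j) (?M (Suc k) j))
     - (\<Sum>k\<le>n. \<Sum>j\<le>n. fsc (?c k * ?a k j) (?M k (Suc j)))"
    by (simp add: sum.distrib sum_subtractf)
  also have "(\<Sum>k\<le>n. \<Sum>j\<le>n. fsc (?a k j) (?M k j)) = (\<Sum>k\<le>Suc n. \<Sum>j\<le>Suc n. fsc (?a k j) (?M k j))"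
    by (simp add: acoef_zero)
  also have "(\<Sum>k\<le>n. \<Sum>j\<le>n. fsc (?b k * ?a k j) (?M (Suc k) j))
    = (\<Sum>k\<le>Suc n. \<Sum>j\<le>Suc n. fsc (if k = 0 then 0 else ?b (k-1) * ?a (k-1) j) (?M k j))"
    by (subst sum.atMost_Suc_shift) (simp add: acoef_zero)
  also have "(\<Sum>k\<le>n. \<Sum>j\<le>n. fsc (?c k * ?a k j) (?M k (Suc j)))
    = (\<Sum>k\<le>n. \<Sum>j\<le>Suc n. fsc (if j = 0 then 0 else ?c k * ?a k (j-1)) (?M k j))"
    by (rule sum.cong[OF refl]) (subst sum.atMost_Suc_shift, simp)
  also have "\<dots> = (\<Sum>k\<le>Suc n. \<Sum>j\<le>Suc n. fsc (if j = 0 then 0 else ?c k * ?a k (j-1)) (?M k j))"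
    by (simp add: acoef_zero cong: if_cong)
  also have "(\<Sum>k\<le>Suc n. \<Sum>j\<le>Suc n. fsc (?a k j) (?M k j))
      + (\<Sum>k\<le>Suc n. \<Sum>j\<le>Suc n. fsc (if k = 0 then 0 else ?b (k-1) * ?a (k-1) j) (?M k j))
      - (\<Sum>k\<le>Suc n. \<Sum>j\<le>Suc n. fsc (if j = 0 then 0 else ?c k * ?a k (j-1)) (?M k j))
    = (\<Sum>k\<le>Suc n. \<Sum>j\<le>Suc n. fsc (acoef q \<alpha> (Suc n) k j) (?M k j))"
    unfolding acoef_rec[of n] fv.scale_left_distrib fv.scale_left_diff_distrib sum.distrib sum_subtractf ..
  finally show ?case .
qed

end

section \<open>Quotients of the free algebra\<close>

lemma fadd_plus: "fadd = (+)" and fsub_minus: "fsub = (-)" and fzero_0: "fzero = 0"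
  by (auto simp: fadd_def fsub_def fzero_def fun_eq_iff pointwise)

lemma fsum_sum: "fsum f S = (\<Sum>i\<in>S. f i)"
  by (simp add: fsum_def fun_eq_iff sum_apply)

lemma fmul_Nil: "(f \<odot> g) [] = f [] * g []"
  by (simp add: fmul_def)

text \<open>With \<open>fmul_Nil\<close> this is a recursion on the word that shifts the left
  factor; associativity then follows by list induction for an arbitrary left factor.\<close>

lemma fmul_Cons: "(f \<odot> g) (x # w) = f [] * g (x # w) + ((\<lambda>u. f (x # u)) \<odot> g) w"
  by (simp add: fmul_def sum.atMost_Suc_shift del: sum.atMost_Suc)

lemma fmul_zero [simp]: "0 \<odot> g = 0"
  by (simp add: fmul_def fun_eq_iff pointwise)

lemma fmul_add_left: "(f + g) \<odot> h = f \<odot> h + g \<odot> h"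
  and fmul_add_right: "f \<odot> (g + h) = f \<odot> g + f \<odot> h"
  and fmul_sc_left: "fsc c f \<odot> h = fsc c (f \<odot> h)"
  and fmul_sc_right: "f \<odot> fsc c h = fsc c (f \<odot> h)"
  by (simp_all add: fmul_def fun_eq_iff pointwise algebra_simps sum.distrib sum_distrib_left)

lemma fmul_assoc: "(f \<odot> g) \<odot> h = f \<odot> (g \<odot> h)"
proof
  fix w show "((f \<odot> g) \<odot> h) w = (f \<odot> (g \<odot> h)) w"
  proof (induction w arbitrary: f)
    case (Cons x w)
    have "(\<lambda>u. (f \<odot> g) (x # u)) = fsc (f []) (\<lambda>u. g (x # u)) + (\<lambda>u. f (x # u)) \<odot> g"
      by (simp add: fun_eq_iff fmul_Cons pointwise)
    then show ?case
      by (simp add: fmul_Cons fmul_Nil fmul_add_left fmul_sc_left pointwise Cons algebra_simps)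
  qed (simp add: fmul_Nil)
qed

lemma fmul_one_left [simp]: "fone \<odot> f = f"
proof
  fix w show "(fone \<odot> f) w = f w"
  proof (cases w)
    case (Cons x u)
    have "(\<lambda>u. fone (x # u)) = 0" by (simp add: fone_def fun_eq_iff pointwise)
    then show ?thesis unfolding Cons fmul_Cons by (simp add: pointwise) (simp add: fone_def)
  qed (simp add: fmul_Nil fone_def)
qed

lemma fmul_one_right [simp]: "f \<odot> fone = f"
proof
  fix w show "(f \<odot> fone) w = f w"
    by (induction w arbitrary: f) (auto simp: fmul_Nil fmul_Cons fone_def)
qed

lemma lin_fmul: "lin (\<lambda>g. f \<odot> g)"
  by (simp add: lin_def fmul_add_right fmul_sc_right)

lemma FA_subspace: "fv.subspace FA"
proof (rule fv.subspaceI)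
  show "0 \<in> FA" by (simp add: FA_def pointwise)
next
  fix x y assume "x \<in> FA" "y \<in> FA"
  then have "finite ({w. x w \<noteq> 0} \<union> {w. y w \<noteq> 0})" by (simp add: FA_def)
  moreover have "{w. (x + y) w \<noteq> 0} \<subseteq> {w. x w \<noteq> 0} \<union> {w. y w \<noteq> 0}" by (auto simp: pointwise)
  ultimately show "x + y \<in> FA" unfolding FA_def by (simp add: finite_subset)
next
  fix c x assume "x \<in> FA"
  moreover have "{w. (fsc c x) w \<noteq> 0} \<subseteq> {w. x w \<noteq> 0}" by (auto simp: pointwise)
  ultimately show "fsc c x \<in> FA" unfolding FA_def by (simp add: finite_subset)
qed

lemma FA_fone: "fone \<in> FA" and FA_fgen: "fgen x \<in> FA"
  by (auto simp: FA_def fone_def fgen_def)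

lemma FA_fmul: assumes "f \<in> FA" "g \<in> FA" shows "f \<odot> g \<in> FA"
proof -
  have "{w. (f \<odot> g) w \<noteq> 0} \<subseteq> (\<lambda>(u, v). u @ v) ` ({w. f w \<noteq> 0} \<times> {w. g w \<noteq> 0})"
  proof
    fix w assume "w \<in> {w. (f \<odot> g) w \<noteq> 0}"
    then have "(\<Sum>i\<le>length w. f (take i w) * g (drop i w)) \<noteq> 0" by (simp add: fmul_def)
    then obtain i where "f (take i w) * g (drop i w) \<noteq> 0" by (meson sum.neutral)
    then show "w \<in> (\<lambda>(u, v). u @ v) ` ({w. f w \<noteq> 0} \<times> {w. g w \<noteq> 0})"
      by (intro image_eqI[of _ _ "(take i w, drop i w)"]) auto
  qed
  moreover have "finite ((\<lambda>(u, v). u @ v) ` ({w. f w \<noteq> 0} \<times> {w. g w \<noteq> 0}))"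
    using assms by (simp add: FA_def)
  ultimately show ?thesis unfolding FA_def by (simp add: finite_subset)
qed

lemmas FA_add = fv.subspace_add[OF FA_subspace] and FA_sc = fv.subspace_scale[OF FA_subspace]
  and FA_0 = fv.subspace_0[OF FA_subspace] and FA_diff = fv.subspace_diff[OF FA_subspace]
  and FA_sum = fv.subspace_sum[OF FA_subspace]

lemma FA_gens: "E i \<in> FA" "F i \<in> FA" "Kg i \<in> FA" "Kgi i \<in> FA"
  by (simp_all add: E_def F_def Kg_def Kgi_def FA_fgen)

lemma FA_fpow: "f \<in> FA \<Longrightarrow> fpow f n \<in> FA"
  by (induction n) (auto intro: FA_fone FA_fmul)

lemmas FA_closed = FA_add FA_sc FA_0 FA_diff FA_fone FA_fmul FA_gens FA_fpow

definition fword :: "gen list \<Rightarrow> falg" where "fword w = (\<lambda>u. if u = w then 1 else 0)"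

lemma fword_Nil: "fword [] = fone"
  by (simp add: fword_def fone_def)

lemma fword_Cons: "fword (x # w) = fgen x \<odot> fword w"
proof
  fix u
  show "fword (x # w) u = (fgen x \<odot> fword w) u"
  proof (cases u)
    case (Cons y u')
    have "(\<lambda>u. fgen x (y # u)) = (if y = x then fone else 0)"
      by (auto simp: fgen_def fone_def fun_eq_iff pointwise)
    then show ?thesis unfolding Cons fmul_Cons
      by (simp add: pointwise) (simp add: fgen_def fword_def)
  qed (simp add: fmul_Nil fgen_def fword_def)
qed

lemma FA_decomp: assumes "f \<in> FA" shows "f = (\<Sum>w\<in>{w. f w \<noteq> 0}. fsc (f w) (fword w))"
proof
  fix u
  have fin: "finite {w. f w \<noteq> 0}" using assms by (simp add: FA_def)
  have "(\<Sum>w\<in>{w. f w \<noteq> 0}. fsc (f w) (fword w)) u = (\<Sum>w\<in>{w. f w \<noteq> 0}. if w = u then f w else 0)"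
    unfolding sum_apply by (intro sum.cong refl) (auto simp: pointwise fword_def)
  also have "\<dots> = f u" using fin by (simp add: sum.delta)
  finally show "f u = (\<Sum>w\<in>{w. f w \<noteq> 0}. fsc (f w) (fword w)) u" by simp
qed

lemma FA_induct:
  assumes "f \<in> FA" "fv.subspace {f. Q f}" "Q fone" "\<And>x w. w \<in> FA \<Longrightarrow> Q w \<Longrightarrow> Q (fgen x \<odot> w)"
  shows "Q f"
proof -
  have FAw: "fword w \<in> FA" for w by (simp add: FA_def fword_def)
  have w: "Q (fword w)" for w
    by (induction w) (auto simp: fword_Nil fword_Cons assms FAw)
  have "(\<Sum>w\<in>{w. f w \<noteq> 0}. fsc (f w) (fword w)) \<in> {f. Q f}"
    using w by (intro fv.subspace_sum[OF assms(2)] fv.subspace_scale[OF assms(2)]) simp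
  then show ?thesis using FA_decomp[OF assms(1)] by simp
qed

lemma lideal_FA: "S \<subseteq> FA \<Longrightarrow> lideal S \<subseteq> FA"
proof
  fix x assume "S \<subseteq> FA" "x \<in> lideal S"
  from this(2,1) show "x \<in> FA"
    by (induction rule: lideal.induct) (auto simp: fadd_plus fzero_0 intro: FA_closed)
qed

lemma tideal_FA: "S \<subseteq> FA \<Longrightarrow> tideal S \<subseteq> FA"
proof
  fix x assume "S \<subseteq> FA" "x \<in> tideal S"
  from this(2,1) show "x \<in> FA"
    by (induction rule: tideal.induct) (auto simp: fadd_plus fzero_0 intro: FA_closed)
qed

lemma jimbo_FA: "jimbo_rels q \<subseteq> FA"
  by (auto simp: jimbo_rels_def fadd_plus fsub_minus fzero_0 intro!: FA_closed)

lemma fconst_FA: "fconst c \<in> FA"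
  by (auto simp: fconst_def intro!: FA_closed)

lemma Mker_FA: "Mker q \<alpha> \<subseteq> FA"
  unfolding Mker_def
  by (rule lideal_FA) (use tideal_FA[OF jimbo_FA] in \<open>auto simp: fsub_minus intro!: FA_closed fconst_FA\<close>)

lemma submodule_lideal:
  assumes "S \<subseteq> FA" "Mker q \<alpha> \<subseteq> lideal S"
  shows "is_submodule q \<alpha> (lideal S)"
  unfolding is_submodule_def using lideal_FA[OF assms(1)] assms(2) by (auto intro: lideal.intros)

lemma lideal_least:
  assumes "is_submodule q \<alpha> N" "S \<subseteq> N"
  shows "lideal S \<subseteq> N"
proof
  fix x assume "x \<in> lideal S"
  then show "x \<in> N"
    by (induction rule: lideal.induct) (use assms in \<open>auto simp: is_submodule_def\<close>)
qed

lemma submodule_subspace: assumes "is_submodule q \<alpha> N" shows "fv.subspace N"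
proof (rule fv.subspaceI)
  fix c x assume x: "x \<in> N"
  have "fconst c \<odot> x \<in> N" using assms x fconst_FA by (auto simp: is_submodule_def)
  then show "fsc c x \<in> N" by (simp add: fconst_def fmul_sc_left)
qed (use assms in \<open>auto simp: is_submodule_def fadd_plus fzero_0\<close>)

text \<open>A basis of \<open>N\<close> is extended first inside \<open>FA\<close>, then to the
  whole type; \<open>P\<close> keeps the vectors added by the first extension and kills the others.
  So \<open>P\<close> is total, and its range is a complement of \<open>N\<close> in
  \<open>FA\<close>.\<close>

lemma complement_projection:
  assumes "fv.subspace N" "N \<subseteq> FA"
  obtains P where "lin P" "\<And>x. x \<in> N \<Longrightarrow> P x = 0" "\<And>x. P x \<in> FA" "\<And>x. P (P x) = P x"
    "\<And>x. x \<in> FA \<Longrightarrow> x - P x \<in> N"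
proof -
  interpret vp: vector_space_pair fsc fsc by unfold_locales
  obtain B1 where B1: "B1 \<subseteq> N" "fv.independent B1" "N \<subseteq> fv.span B1"
    by (rule fv.maximal_independent_subset)
  obtain B2 where B2: "B1 \<subseteq> B2" "B2 \<subseteq> FA" "fv.independent B2" "FA \<subseteq> fv.span B2"
    by (rule fv.maximal_independent_subset_extend[OF subset_trans[OF B1(1) assms(2)] B1(2)])
  obtain B3 where B3: "B2 \<subseteq> B3" "fv.independent B3" "UNIV \<subseteq> fv.span B3"
    by (rule fv.maximal_independent_subset_extend[OF subset_UNIV B2(3)])
  obtain P where P: "Vector_Spaces.linear fsc fsc P" "\<forall>b\<in>B3. P b = (if b \<in> B2 - B1 then b else 0)"
    using vp.linear_independent_extend[OF B3(2), of "\<lambda>b. if b \<in> B2 - B1 then b else 0"] by blast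
  have lin: "lin P" unfolding lin_def
    using Vector_Spaces.linear.axioms(3)[OF P(1)] by (auto simp: module_hom.add module_hom.scale)
  have Pb: "P b = (if b \<in> B2 - B1 then b else 0)" if "b \<in> B3" for b using P(2) that by blast
  have ind: "Q x" if "x \<in> fv.span B" "fv.subspace {x. Q x}" "\<And>b. b \<in> B \<Longrightarrow> Q b" for Q B x
    using fv.span_induct[of x B Q] that by auto
  note lp = lin_zero[OF lin] lin_add[OF lin] lin_sc[OF lin]
  have 1: "P x = 0" if "x \<in> N" for x
  proof (rule ind[of x B1])
    show "P b = 0" if "b \<in> B1" for b using Pb[of b] B2 B3 that by auto
  qed (use that B1(3) in \<open>auto intro!: fv.subspaceI simp: lp\<close>)
  have 2: "P x \<in> FA" for x
  proof (rule ind[of x B3])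
    show "P b \<in> FA" if "b \<in> B3" for b using Pb[of b] B2 B3 that FA_0 by auto
  qed (use B3(3) in \<open>auto intro!: fv.subspaceI simp: lp FA_closed\<close>)
  have 3: "P (P x) = P x" for x
  proof (rule ind[of x B3])
    show "P (P b) = P b" if "b \<in> B3" for b using Pb[of b] B2 B3 that by (auto simp: lp)
  qed (use B3(3) in \<open>auto intro!: fv.subspaceI simp: lp\<close>)
  have 4: "x - P x \<in> N" if "x \<in> FA" for x
  proof (rule ind[of x B2])
    show "b - P b \<in> N" if "b \<in> B2" for b using Pb[OF subsetD[OF B3(1) that]] B1(1) that fv.subspace_0[OF assms(1)] by auto
    show "fv.subspace {x. x - P x \<in> N}"
    proof (rule fv.subspaceI)
      show "0 \<in> {x. x - P x \<in> N}" using fv.subspace_0[OF assms(1)] by (simp add: lp)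
    next
      fix x y assume "x \<in> {x. x - P x \<in> N}" "y \<in> {x. x - P x \<in> N}"
      then show "x + y \<in> {x. x - P x \<in> N}" 
        using fv.subspace_add[OF assms(1), of "x - P x" "y - P y"] by (simp add: lp algebra_simps)
    next
      fix c x assume "x \<in> {x. x - P x \<in> N}"
      then show "fsc c x \<in> {x. x - P x \<in> N}" 
        using fv.subspace_scale[OF assms(1), of "x - P x" c] by (simp add: lp fv.scale_right_diff_distrib)
    qed
  qed (use that B2(4) in auto)
  show ?thesis by (rule that[of P]) (use lin 1 2 3 4 in auto)
qed

section \<open>The module structure on a quotient\<close>

locale quot =
  fixes q \<alpha> :: complex and N :: "falg set" and P :: "falg \<Rightarrow> falg"
  assumes q0: "q \<noteq> 0" and qr: "\<And>m::nat. m > 0 \<Longrightarrow> q ^ m \<noteq> 1" and \<alpha>0: "\<alpha> \<noteq> 0"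
    and Nsub: "is_submodule q \<alpha> N"
    and lP: "lin P" and PN: "\<And>x. x \<in> N \<Longrightarrow> P x = 0" and PFA: "\<And>x. P x \<in> FA" and PP: "\<And>x. P (P x) = P x"
    and xP: "\<And>x. x \<in> FA \<Longrightarrow> x - P x \<in> N"
begin

lemmas lp = lin_zero[OF lP] lin_add[OF lP] lin_sc[OF lP] lin_diff[OF lP]

text \<open>\<open>P\<close> identifies \<open>FA / N\<close> with its range. There \<open>act f c\<close> is the action of \<open>f\<close> on the quotient; on the
  kernel of \<open>P\<close> it is the scalar \<open>c\<close>, the value of the counit at \<open>f\<close>. This trivial summand makes
  the Jimbo relations hold on the whole type.\<close>

definition act :: "falg \<Rightarrow> complex \<Rightarrow> falg \<Rightarrow> falg" where
  "act f c x = P (f \<odot> P x) + fsc c (x - P x)"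

lemma lin_act: "lin (act f c)"
  unfolding lin_def act_def
  by (auto simp: lp fmul_add_right fmul_sc_right) (simp_all add: fun_eq_iff pointwise algebra_simps)

lemma P_mul: "f \<in> FA \<Longrightarrow> y \<in> FA \<Longrightarrow> P (f \<odot> P y) = P (f \<odot> y)"
proof -
  assume fy: "f \<in> FA" "y \<in> FA"
  have "f \<odot> (y - P y) \<in> N" using Nsub xP[OF fy(2)] fy(1) by (auto simp: is_submodule_def)
  then have "P (f \<odot> (y - P y)) = 0" by (rule PN)
  then show ?thesis by (simp add: lin_diff[OF lin_fmul] lp)
qed

lemma P_act: "f \<in> FA \<Longrightarrow> y \<in> FA \<Longrightarrow> act f c (P y) = P (f \<odot> y)"
  by (simp add: act_def PP P_mul)

lemma act_mul: "f \<in> FA \<Longrightarrow> g \<in> FA \<Longrightarrow> act (f \<odot> g) (c * d) x = act f c (act g d x)"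
proof -
  assume fg: "f \<in> FA" "g \<in> FA"
  have "P (act g d x) = P (g \<odot> P x)" by (simp add: act_def lp PP)
  then show ?thesis using P_mul[OF fg(1) FA_fmul[OF fg(2) PFA]]
    by (simp add: act_def[of f] act_def[of "f \<odot> g"] fmul_assoc) (simp add: act_def)
qed

lemma act_add: "act (f + g) (c + d) x = act f c x + act g d x"
  and act_sub: "act (f - g) (c - d) x = act f c x - act g d x"
  and act_sc: "act (fsc a f) (a * c) x = fsc a (act f c x)"
proof -
  have "(f - g) \<odot> y = f \<odot> y - g \<odot> y" for y
    using fmul_add_left[of "f - g" g y] by simp
  then show "act (f + g) (c + d) x = act f c x + act g d x"
    "act (f - g) (c - d) x = act f c x - act g d x"
    "act (fsc a f) (a * c) x = fsc a (act f c x)"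
    by (simp_all add: act_def fmul_add_left fmul_sc_left lp) (simp_all add: fun_eq_iff pointwise algebra_simps)
qed

lemma act_one: "act fone 1 x = x"
  by (simp add: act_def PP)

lemma act_rel: "r \<in> jimbo_rels q \<Longrightarrow> act r 0 x = 0"
proof -
  assume "r \<in> jimbo_rels q"
  then have "fone \<odot> r \<odot> P x \<in> tideal (jimbo_rels q)" by (intro tideal.mult tideal.gen FA_fone PFA)
  then have "r \<odot> P x \<in> Mker q \<alpha>" unfolding Mker_def by (intro lideal.gen) simp
  then have "r \<odot> P x \<in> N" using Nsub by (auto simp: is_submodule_def)
  then show ?thesis by (simp add: act_def PN)
qed

lemma act_eq: "fsub f g \<in> jimbo_rels q \<Longrightarrow> act f c x = act g c x"
  using act_rel[of "f - g" x] act_sub[of f g c c x] by (simp add: fsub_minus)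

lemma act3: "f \<in> FA \<Longrightarrow> g \<in> FA \<Longrightarrow> h \<in> FA \<Longrightarrow> act (f \<odot> g \<odot> h) (a * b * c) x = act f a (act g b (act h c x))"
  by (simp add: act_mul FA_fmul)

abbreviation "e i \<equiv> act (E i) 0"
abbreviation "f i \<equiv> act (F i) 0"
abbreviation "k i \<equiv> act (Kg i) 1"
abbreviation "ki i \<equiv> act (Kgi i) 1"

lemma kk: "k 1 (k 2 x) = k 2 (k 1 x)"
  using act_eq[of "Kg 1 \<odot> Kg 2" "Kg 2 \<odot> Kg 1" 1 x] act_mul[of _ _ 1 1]
  by (simp add: jimbo_rels_def FA_gens)

lemma kki: assumes "i \<in> {1,2}" shows "k i (ki i x) = x" "ki i (k i x) = x"
  using act_eq[of "Kg i \<odot> Kgi i" fone 1 x] act_eq[of "Kgi i \<odot> Kg i" fone 1 x] act_mul[of _ _ 1 1] assms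
  by (auto simp: jimbo_rels_def FA_gens act_one)

lemma kek: assumes "i \<in> {1,2}" "j \<in> {1,2}" shows "k i (e j (ki i x)) = fsc (q powi cartan i j) (e j x)"
proof -
  have "fsub (Kg i \<odot> E j \<odot> Kgi i) (fsc (q powi cartan i j) (E j)) \<in> jimbo_rels q"
    using assms unfolding jimbo_rels_def by blast
  from act_eq[OF this, of 0 x] act3[of "Kg i" "E j" "Kgi i" 1 0 1 x] act_sc[of "q powi cartan i j" "E j" 0 x]
  show ?thesis by (simp add: FA_gens)
qed

lemma kfk: assumes "i \<in> {1,2}" "j \<in> {1,2}" shows "k i (f j (ki i x)) = fsc (q powi (- cartan i j)) (f j x)"
proof -
  have "fsub (Kg i \<odot> F j \<odot> Kgi i) (fsc (q powi (- cartan i j)) (F j)) \<in> jimbo_rels q"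
    using assms unfolding jimbo_rels_def by blast
  from act_eq[OF this, of 0 x] act3[of "Kg i" "F j" "Kgi i" 1 0 1 x] act_sc[of "q powi (- cartan i j)" "F j" 0 x]
  show ?thesis by (simp add: FA_gens)
qed

lemma ef: assumes "i \<in> {1,2}" "j \<in> {1,2}"
  shows "e i (f j x) = f j (e i x) + (if i = j then fsc (1 / (q - inverse q)) (k i x - ki i x) else 0)"
proof -
  have "fsub (fsub (E i \<odot> F j) (F j \<odot> E i))
      (if i = j then fsc (1 / (q - inverse q)) (fsub (Kg i) (Kgi i)) else fzero) \<in> jimbo_rels q"
    using assms unfolding jimbo_rels_def by blast
  from act_eq[OF this, of 0 x] have 1: "act (E i \<odot> F j - F j \<odot> E i) 0 x =
     act (if i = j then fsc (1 / (q - inverse q)) (Kg i - Kgi i) else 0) 0 x"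
    by (simp add: fsub_minus fzero_0)
  have 2: "act (E i \<odot> F j - F j \<odot> E i) 0 x = e i (f j x) - f j (e i x)"
    using act_sub[of "E i \<odot> F j" "F j \<odot> E i" 0 0 x] act_mul[of "E i" "F j" 0 0 x] act_mul[of "F j" "E i" 0 0 x]
    by (simp add: FA_gens)
  have 3: "act (fsc a (Kg i - Kgi i)) 0 x = fsc a (k i x - ki i x)" for a
    using act_sc[of a "Kg i - Kgi i" 0 x] act_sub[of "Kg i" "Kgi i" 1 1 x] by simp
  have 4: "act 0 0 x = 0" by (simp add: act_def lp)
  show ?thesis
  proof (cases "i = j")
    case True
    have "e i (f j x) - f j (e i x) = fsc (1 / (q - inverse q)) (k i x - ki i x)"
      using 1 unfolding 2 if_P[OF True] 3 .
    then show ?thesis unfolding if_P[OF True] by (metis add.commute diff_add_cancel)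
  qed (use 1 2 4 in simp)
qed

lemma serre: assumes "i \<in> {1,2}" "j \<in> {1,2}" "i \<noteq> j"
  shows "f i (f i (f j x)) - fsc (q + inverse q) (f i (f j (f i x))) + f j (f i (f i x)) = 0"
proof -
  have "fadd (fsub (F i \<odot> F i \<odot> F j) (fsc (q + inverse q) (F i \<odot> F j \<odot> F i))) (F j \<odot> F i \<odot> F i) \<in> jimbo_rels q"
    unfolding jimbo_rels_def
    by (rule UnI2, rule UN_I[OF assms(1)], rule UN_I[OF assms(2)], unfold if_not_P[OF assms(3)]) auto
  from act_rel[OF this, of x] show ?thesis
    using act_add[of "F i \<odot> F i \<odot> F j - fsc (q + inverse q) (F i \<odot> F j \<odot> F i)" "F j \<odot> F i \<odot> F i" 0 0 x]
      act_sub[of "F i \<odot> F i \<odot> F j" "fsc (q + inverse q) (F i \<odot> F j \<odot> F i)" 0 0 x]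
      act_sc[of "q + inverse q" "F i \<odot> F j \<odot> F i" 0 x] act3[of _ _ _ 0 0 0 x]
    by (simp add: fadd_plus fsub_minus FA_gens)
qed

lemma inv_q: "1 / (q - inverse q) = q * inverse (q\<^sup>2 - 1)"
proof -
  have "q^2 \<noteq> 1" using qr[of 2] by simp
  then show ?thesis using q0 by (simp add: field_simps power2_eq_square)
qed

definition "e1 = e 1"
definition "e2 = e 2"
definition "f1 = f 1"
definition "f2 = f 2"
definition "k1 = k 1"
definition "k1i = ki 1"
definition "k2 = k 2"
definition "k2i = ki 2"

lemmas ops_def = e1_def e2_def f1_def f2_def k1_def k1i_def k2_def k2i_def

sublocale jimbo_whittaker q e1 e2 f1 f2 k1 k1i k2 k2i \<alpha>
proof (unfold_locales, goal_cases)
  case 1 show ?case by (rule q0)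
next
  case (2 m) then show ?case by (rule qr)
qed (simp_all add: ops_def lin_act kk kki kek kfk ef \<alpha>0 inv_q cartan_def power_int_minus power_inverse
  serre[of 1 2] serre[of 2 1] del: One_nat_def)

definition "v = P fone"

lemma act_fgen: "act (fgen GE1) 0 = e1" "act (fgen GE2) 0 = e2" "act (fgen GF1) 0 = f1" "act (fgen GF2) 0 = f2"
  "act (fgen GK1) 1 = k1" "act (fgen GK1i) 1 = k1i" "act (fgen GK2) 1 = k2" "act (fgen GK2i) 1 = k2i"
  by (simp_all add: ops_def E_def F_def Kg_def Kgi_def)

lemma submod_mul:
  assumes "submod S" "y \<in> FA" "P y \<in> S" "g \<in> FA"
  shows "P (g \<odot> y) \<in> S"
proof (rule FA_induct[OF assms(4), where Q = "\<lambda>g. P (g \<odot> y) \<in> S"])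
  show "fv.subspace {g. P (g \<odot> y) \<in> S}"
    using submod_sub[OF assms(1)]
    by (intro fv.subspaceI) (auto simp: fmul_add_left fmul_sc_left lp fv.subspace_def)
next
  fix x w assume w: "w \<in> FA" "P (w \<odot> y) \<in> S"
  \<comment> \<open>On the range of \<open>P\<close> the counit value \<open>c\<close> has no
    influence, so 0 or 1 can be chosen to match the operator of the generator.\<close>
  have *: "P (fgen x \<odot> w \<odot> y) = act (fgen x) c (P (w \<odot> y))" for c
    using P_act[OF FA_fgen FA_fmul[OF w(1) assms(2)], of x c] by (simp add: fmul_assoc)
  show "P (fgen x \<odot> w \<odot> y) \<in> S"
    using assms(1) w(2) *[of 0] *[of 1] by (cases x) (auto simp: submod_def act_fgen)
qed (simp add: assms(3))

lemma P_Gen: "x \<in> FA \<Longrightarrow> P x \<in> Gen v"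
  using submod_mul[OF submod_Gen FA_fone, of v x] Gen_base[of v] by (simp add: v_def)

lemma wh_v: "wh v"
proof -
  have N: "fsub (E 1) (fconst \<alpha>) \<in> N" "E 2 \<in> N"
  proof -
    have "fsub (E 1) (fconst \<alpha>) \<in> Mker q \<alpha>" "E 2 \<in> Mker q \<alpha>"
      unfolding Mker_def by (rule lideal.gen, simp)+
    then show "fsub (E 1) (fconst \<alpha>) \<in> N" "E 2 \<in> N" using Nsub by (auto simp: is_submodule_def)
  qed
  have "P (E 1) = fsc \<alpha> (P fone)" using PN[OF N(1)] by (simp add: fsub_minus lp fconst_def)
  moreover have "P (E 2) = 0" by (rule PN[OF N(2)])
  moreover have "e1 v = P (E 1)" "e2 v = P (E 2)"
    unfolding v_def e1_def e2_def by (simp_all add: P_act FA_gens FA_fone del: One_nat_def)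
  ultimately show ?thesis by (simp add: wh_def v_def)
qed

lemma submod_image:
  assumes "is_submodule q \<alpha> N'"
  shows "submod (P ` N')"
proof -
  have "N' \<subseteq> FA" and mul: "\<And>x g. x \<in> N' \<Longrightarrow> g \<in> FA \<Longrightarrow> g \<odot> x \<in> N'"
    using assms by (auto simp: is_submodule_def)
  then have "act g c (P x) \<in> P ` N'" if "x \<in> N'" "g \<in> FA" for x g c
    using that P_act[of g x c] by auto
  then show ?thesis
    using subspace_image[OF lP submodule_subspace[OF assms]] unfolding submod_def
    by (auto simp: ops_def FA_gens)
qed

lemma P_gens:
  assumes "y \<in> FA"
  shows "P (F 1 \<odot> y) = f1 (P y)" "P (F 2 \<odot> y) = f2 (P y)" "P (E 1 \<odot> y) = e1 (P y)" "P (Kg 1 \<odot> y) = k1 (P y)"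
    "P (Kgi 1 \<odot> y) = k1i (P y)" "P (Kg 2 \<odot> y) = k2 (P y)" "P (Kgi 2 \<odot> y) = k2i (P y)"
  using assms by (simp_all add: ops_def P_act FA_gens del: One_nat_def)

lemma P_els:
  assumes "y \<in> FA"
  shows P_Keli: "P (Keli \<odot> y) = Ki (P y)" and P_Kel: "P (Kel \<odot> y) = K (P y)" and P_F3: "P (F3 q \<odot> y) = G (P y)"
proof -
  have d: "(g - h) \<odot> y = g \<odot> y - h \<odot> y" for g h
    using fmul_add_left[of "g - h" h y] by simp
  show "P (Keli \<odot> y) = Ki (P y)" "P (Kel \<odot> y) = K (P y)" "P (F3 q \<odot> y) = G (P y)"
    using assms unfolding Keli_def Kel_def F3_def Ki_def K_def G_def
    by (simp_all add: P_gens FA_closed fmul_assoc fsub_minus d fmul_sc_left lp del: One_nat_def)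
qed

lemma P_fpow:
  assumes "g \<in> FA" "\<And>y. y \<in> FA \<Longrightarrow> P (g \<odot> y) = h (P y)" "y \<in> FA"
  shows "P (fpow g n \<odot> y) = (h ^^ n) (P y)"
  by (induction n) (simp_all add: fmul_assoc assms FA_closed)

lemma FA_els: "Kel \<in> FA" "Keli \<in> FA" "F3 q \<in> FA" "C1 q \<in> FA" "uel q \<alpha> n \<in> FA"
  by (auto simp: Kel_def Keli_def F3_def C1_def uel_def fsum_sum fadd_plus fsub_minus intro!: FA_closed FA_sum)

lemma P_uel: "P (uel q \<alpha> n) = (T ^^ n) v"
proof -
  have "P (fpow (F 2) a \<odot> fpow (F3 q) b \<odot> fpow (Kg 2) c \<odot> fpow Keli d) = (f2 ^^ a) ((G ^^ b) ((k2 ^^ c) ((Ki ^^ d) v)))" for a b c d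
  proof -
    \<comment> \<open>A trailing \<open>fone\<close> gives the rightmost power something to act on,
      and \<open>P fone\<close> is \<open>v\<close>.\<close>
    have "P (fpow (F 2) a \<odot> (fpow (F3 q) b \<odot> (fpow (Kg 2) c \<odot> (fpow Keli d \<odot> fone)))) = (f2 ^^ a) ((G ^^ b) ((k2 ^^ c) ((Ki ^^ d) v)))"
      by (simp only: P_fpow[OF FA_gens(2) P_gens(2)] P_fpow[OF FA_els(3) P_F3]
          P_fpow[OF FA_gens(3) P_gens(6)] P_fpow[OF FA_els(2) P_Keli] FA_closed FA_els v_def)
    then show ?thesis by (simp add: fmul_assoc)
  qed
  then have "P (uel q \<alpha> n) = (\<Sum>k = 0..n. \<Sum>j = 0..n - k. fsc (acoef q \<alpha> n k j) (mn v (n - k) k j))"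
    unfolding uel_def fsum_sum by (simp add: lin_sum[OF lP] lp mn_def)
  also have "\<dots> = (\<Sum>k\<le>n. \<Sum>j\<le>n. fsc (acoef q \<alpha> n k j) (mn v (n - k) k j))"
    unfolding atLeast0AtMost
    by (intro sum.cong refl sum.mono_neutral_left) (auto simp: acoef_zero)
  finally show ?thesis by (simp add: Tn_closed_form)
qed

lemma P_Kel_one: "P Kel = K v"
  using P_Kel[OF FA_fone] by (simp add: v_def)

lemma P_C1: "P (C1 q) = Cas v"
proof -
  have e: "1 / (q - inverse q)^2 = q^2 * ps^2"
    using inv_q by (simp add: ps_def power_mult_distrib flip: power_one_over)
  have g: "P (F 1 \<odot> E 1) = f1 (e1 v)" "P (Kg 1) = k1 v" "P (Kgi 1) = k1i v"
    using P_gens(1)[OF FA_gens(1), of 1] P_gens(3,4,5)[OF FA_fone] by (simp_all add: v_def)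
  show ?thesis unfolding C1_def Cas_def e fadd_plus by (simp add: lp g qi_def del: One_nat_def)
qed

lemma in_N: "x \<in> FA \<Longrightarrow> P x = 0 \<Longrightarrow> x \<in> N"
  using xP[of x] by simp

lemma v_nz: "N \<noteq> FA \<Longrightarrow> v \<noteq> 0"
proof
  assume "N \<noteq> FA" "v = 0"
  then have "fone \<in> N" using in_N FA_fone by (simp add: v_def)
  then have "x \<in> N" if "x \<in> FA" for x
    using Nsub that fmul_one_right[of x] unfolding is_submodule_def by metis
  with \<open>N \<noteq> FA\<close> Nsub show False by (auto simp: is_submodule_def)
qed

text \<open>The elements of \<open>FA\<close> that \<open>P\<close> sends into \<open>Gen x\<close>
  form a submodule properly containing \<open>N\<close>, so by maximality it contains
  \<open>fone\<close>.\<close>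

lemma simple_if_maximal:
  assumes "maximal_submodule q \<alpha> N"
  shows "simple v"
  unfolding simple_def
proof (intro ballI impI)
  fix x assume x: "x \<in> Gen v" "x \<noteq> 0"
  \<comment> \<open>The range of \<open>P\<close> is a submodule containing \<open>v\<close>, so
    \<open>Gen v\<close> avoids the trivial summand and \<open>x\<close> represents an element of
    the quotient.\<close>
  have "submod {z \<in> FA. P z = z}"
  proof -
    have "act g c z \<in> {z \<in> FA. P z = z}" if "g \<in> FA" "z \<in> {z \<in> FA. P z = z}" for g c z
      using that P_act[of g z c] by (auto simp: PFA PP)
    moreover have "fv.subspace {z \<in> FA. P z = z}"
      by (rule fv.subspaceI) (auto simp: lp FA_closed)
    ultimately show ?thesis unfolding submod_def
      by (auto simp: ops_def FA_gens)
  qed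
  then have xF: "x \<in> FA" "P x = x" using Gen_min[of "{z \<in> FA. P z = z}" v] x(1) by (auto simp: v_def PFA PP)
  define N' where "N' = {y \<in> FA. P y \<in> Gen x}"
  have NF: "N \<subseteq> FA" "Mker q \<alpha> \<subseteq> N" using Nsub by (auto simp: is_submodule_def)
  note G = submod_sub[OF submod_Gen, of x]
  have NN: "N \<subseteq> N'" using NF PN fv.subspace_0[OF G] by (auto simp: N'_def)
  have "is_submodule q \<alpha> N'"
    unfolding is_submodule_def
  proof (intro conjI ballI)
    show "Mker q \<alpha> \<subseteq> N'" using NN NF by blast
    show "fzero \<in> N'" using fv.subspace_0[OF G] FA_0 by (simp add: N'_def fzero_0 lp)
  next
    fix a b assume "a \<in> N'" "b \<in> N'"
    then show "fadd a b \<in> N'" using fv.subspace_add[OF G] by (simp add: N'_def fadd_plus lp FA_closed)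
  next
    fix a g assume "a \<in> N'" "g \<in> FA"
    then show "g \<odot> a \<in> N'" using submod_mul[OF submod_Gen, of a x g] by (simp add: N'_def FA_closed)
  qed (auto simp: N'_def)
  moreover have "x \<in> N'" using xF Gen_base[of x] by (simp add: N'_def)
  moreover have "x \<notin> N" using PN xF(2) x(2) by auto
  ultimately have "N' = FA" using assms NN unfolding maximal_submodule_def by blast
  then have "fone \<in> N'" using FA_fone by simp
  then show "v \<in> Gen x" by (simp add: N'_def v_def)
qed

end

section \<open>Classification of the maximal submodules\<close>

lemma quot_exists:
  assumes "q \<noteq> 0" "\<forall>m::nat. m > 0 \<longrightarrow> q ^ m \<noteq> 1" "\<alpha> \<noteq> 0" "is_submodule q \<alpha> N"
  obtains P where "quot q \<alpha> N P"
proof -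
  have "N \<subseteq> FA" using assms(4) by (simp add: is_submodule_def)
  from complement_projection[OF submodule_subspace[OF assms(4)] this] obtain P where
    "lin P" "\<And>x. x \<in> N \<Longrightarrow> P x = 0" "\<And>x. P x \<in> FA" "\<And>x. P (P x) = P x" "\<And>x. x \<in> FA \<Longrightarrow> x - P x \<in> N"
    by blast
  then have "quot q \<alpha> N P" using assms by unfold_locales auto
  then show ?thesis by (rule that)
qed

lemma Wsub_gens_FA: "Mker q \<alpha> \<union> {fsub Kel (fconst \<kappa>), fsub (C1 q) (fconst c)} \<subseteq> FA"
  using Mker_FA by (auto simp: Kel_def C1_def fsub_minus fadd_plus intro!: FA_closed fconst_FA)

lemma submodule_Wsub: "is_submodule q \<alpha> (Wsub q \<alpha> \<kappa> c)"
  unfolding Wsub_def by (rule submodule_lideal[OF Wsub_gens_FA]) (auto intro: lideal.gen)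

lemma uel_FA: "uel q \<alpha> n \<in> FA"
  by (auto simp: uel_def fsum_sum Keli_def F3_def fsub_minus intro!: FA_closed FA_sum)

lemma Wsub_Whatm: "Wsub q \<alpha> \<kappa> c \<subseteq> Whatm q \<alpha> \<kappa> c"
  unfolding Whatm_def by (auto intro: lideal.gen)

lemma submodule_Whatm: "is_submodule q \<alpha> (Whatm q \<alpha> \<kappa> c)"
  unfolding Whatm_def
proof (rule submodule_lideal)
  have "Wsub q \<alpha> \<kappa> c \<subseteq> FA" "Mker q \<alpha> \<subseteq> Wsub q \<alpha> \<kappa> c"
    using submodule_Wsub by (auto simp: is_submodule_def)
  then show "Wsub q \<alpha> \<kappa> c \<union> {uel q \<alpha> (nminus q \<kappa> c)} \<subseteq> FA"
    "Mker q \<alpha> \<subseteq> lideal (Wsub q \<alpha> \<kappa> c \<union> {uel q \<alpha> (nminus q \<kappa> c)})"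
    using uel_FA by (auto intro: lideal.gen)
qed

text \<open>The quotient is taken by \<open>M\<close>, and \<open>joint_simple\<close> applies to
  it. If \<open>N\<close> were larger than \<open>M\<close>, its image would contain
  \<open>v\<close>, and \<open>N\<close> would be everything. Assumption \<open>h\<close> holds
  vacuously for non-critical pairs, and with \<open>m = nminus q \<kappa> c\<close> for critical
  ones.\<close>

lemma maximal_eq:
  assumes "q \<noteq> 0" "\<forall>m::nat. m > 0 \<longrightarrow> q ^ m \<noteq> 1" "\<alpha> \<noteq> 0"
    and N: "is_submodule q \<alpha> N" "N \<noteq> FA"
    and M: "is_submodule q \<alpha> M" "M \<subseteq> N" "fsub Kel (fconst \<kappa>) \<in> M" "fsub (C1 q) (fconst c) \<in> M"
    and h: "\<And>i. i \<ge> 1 \<Longrightarrow> hfun q i \<kappa> c = 0 \<Longrightarrow> \<exists>m\<le>i. uel q \<alpha> m \<in> M"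
  shows "N = M"
proof -
  obtain P where "quot q \<alpha> M P" using quot_exists[OF assms(1-3) M(1)] .
  then interpret quot q \<alpha> M P .
  have one: "fone \<notin> N"
  proof
    assume "fone \<in> N"
    then have "x \<in> N" if "x \<in> FA" for x
      using N(1) that fmul_one_right[of x] unfolding is_submodule_def by metis
    with N show False by (auto simp: is_submodule_def)
  qed
  have "M \<noteq> FA" using one M(2) FA_fone by auto
  have "P (fsub Kel (fconst \<kappa>)) = 0" "P (fsub (C1 q) (fconst c)) = 0" by (rule PN, rule M)+
  then have "joint \<kappa> c v"
    using wh_v v_nz[OF \<open>M \<noteq> FA\<close>] by (simp add: joint_def fsub_minus lp P_Kel_one P_C1 fconst_def v_def[symmetric])
  then have s: "simple v"
  proof (rule joint_simple)
    fix n i assume n: "(T ^^ n) v \<noteq> 0" "1 \<le> i" "i \<le> n"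
    show "hfun q i \<kappa> c \<noteq> 0"
    proof
      assume "hfun q i \<kappa> c = 0"
      from h[OF n(2) this] obtain m where m: "m \<le> i" "uel q \<alpha> m \<in> M" by blast
      have "(T ^^ m) v = 0" using PN[OF m(2)] by (simp add: P_uel)
      moreover have "(T ^^ n) v = (T ^^ (n - m)) ((T ^^ m) v)"
        using m(1) n(3) by (intro funpow_split) simp
      ultimately show False using n(1) by (simp add: Tn_lin)
    qed
  qed
  have "N \<subseteq> M"
  proof
    fix x assume x: "x \<in> N"
    have xF: "x \<in> FA" using x N(1) by (auto simp: is_submodule_def)
    have "P x = 0"
    proof (rule ccontr)
      assume "P x \<noteq> 0"
      then have "v \<in> Gen (P x)" using s P_Gen[OF xF] by (auto simp: simple_def)
      also have "Gen (P x) \<subseteq> P ` N" by (rule Gen_min[OF submod_image[OF N(1)]]) (use x in blast)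
      finally obtain y where y: "y \<in> N" "P fone = P y" by (auto simp: v_def)
      have yF: "y \<in> FA" using y N(1) by (auto simp: is_submodule_def)
      have "fone - y \<in> M" by (rule in_N) (use yF y(2) in \<open>auto simp: lp intro: FA_closed\<close>)
      then have "(fone - y) + y \<in> N" using M(2) y(1) fv.subspace_add[OF submodule_subspace[OF N(1)]] by blast
      with one show False by simp
    qed
    then show "x \<in> M" by (rule in_N[OF xF])
  qed
  with M(2) show ?thesis by blast
qed

theorem theorem5p11:
  fixes q \<alpha> :: complex and N :: "falg set"
  assumes "q \<noteq> 0" and "\<forall>m::nat. m > 0 \<longrightarrow> q ^ m \<noteq> 1" and "\<alpha> \<noteq> 0"
    and "maximal_submodule q \<alpha> N"
  shows "(\<exists>\<kappa> c. noncritical q \<kappa> c \<and> N = Wsub q \<alpha> \<kappa> c)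
       \<or> (\<exists>\<kappa> c. critical q \<kappa> c \<and> N = Whatm q \<alpha> \<kappa> c)"
proof -
  have N: "is_submodule q \<alpha> N" "N \<noteq> FA" using assms(4) by (auto simp: maximal_submodule_def)
  obtain P where "quot q \<alpha> N P" using quot_exists[OF assms(1-3) N(1)] .
  then interpret quot q \<alpha> N P .
  have s: "simple v" by (rule simple_if_maximal[OF assms(4)])
  obtain \<kappa> c where j: "joint \<kappa> c v" using simple_joint[OF s wh_v v_nz[OF N(2)]] by blast
  have \<kappa>: "\<kappa> \<noteq> 0" by (rule joint_kappa[OF j])
  have gens: "fsub Kel (fconst \<kappa>) \<in> N" "fsub (C1 q) (fconst c) \<in> N"
    using j by (auto simp: fsub_minus joint_def lp P_Kel_one P_C1 fconst_def v_def[symmetric] intro!: in_N FA_closed FA_els)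
  then have W: "Wsub q \<alpha> \<kappa> c \<subseteq> N"
    unfolding Wsub_def using N(1) by (intro lideal_least[OF N(1)]) (auto simp: is_submodule_def)
  have gW: "fsub Kel (fconst \<kappa>) \<in> Wsub q \<alpha> \<kappa> c" "fsub (C1 q) (fconst c) \<in> Wsub q \<alpha> \<kappa> c"
    unfolding Wsub_def by (auto intro: lideal.gen)
  show ?thesis
  proof (cases "\<exists>n\<ge>1. hfun q n \<kappa> c = 0")
    case False
    then have "N = Wsub q \<alpha> \<kappa> c"
      using maximal_eq[OF assms(1-3) N submodule_Wsub W gW] by blast
    moreover have "noncritical q \<kappa> c" using False \<kappa> by (auto simp: noncritical_def)
    ultimately show ?thesis by blast
  next
    case True
    then have crit: "critical q \<kappa> c" using \<kappa> by (auto simp: critical_def)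
    let ?n = "nminus q \<kappa> c"
    have n: "?n \<ge> 1 \<and> hfun q ?n \<kappa> c = 0" unfolding nminus_def using True by (rule LeastI_ex)
    have le: "?n \<le> i" if "i \<ge> 1" "hfun q i \<kappa> c = 0" for i
      unfolding nminus_def using that by (intro Least_le) auto
    \<comment> \<open>Simplicity of the quotient by \<open>N\<close> puts the singular vector into
      \<open>N\<close>; \<open>maximal_eq\<close> then works in the quotient by the submodule it
      generates together with \<open>Wsub q \<alpha> \<kappa> c\<close>.\<close>
    have "(T ^^ ?n) v = 0" using singular_power_zero[OF s Gen_base j] n by blast
    then have "uel q \<alpha> ?n \<in> N" by (intro in_N FA_els) (simp add: P_uel)
    then have "Whatm q \<alpha> \<kappa> c \<subseteq> N" unfolding Whatm_def using W by (intro lideal_least[OF N(1)]) auto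
    moreover have "uel q \<alpha> ?n \<in> Whatm q \<alpha> \<kappa> c" unfolding Whatm_def by (auto intro: lideal.gen)
    ultimately have "N = Whatm q \<alpha> \<kappa> c"
      using maximal_eq[OF assms(1-3) N submodule_Whatm _ subsetD[OF Wsub_Whatm gW(1)] subsetD[OF Wsub_Whatm gW(2)]] le by blast
    with crit show ?thesis by blast
  qed
qed

end
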